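(* Let $S\subset(0,+\infty)$ be countable. Then the universal minimal flow of $\mathrm{iso}(\mathbf{Q}_S)$ is $\mathrm{cLO}(\mathbf{Q}_S)$ together with the action $\mathrm{iso}(\mathbf{Q}_S)\times\mathrm{cLO}(\mathbf{Q}_S)\to\mathrm{cLO}(\mathbf{Q}_S)$, $(g,<)\mapsto <^g$, where $x<^g y$ iff $g^{-1}(x)<g^{-1}(y)$. Similarly, the universal minimal flow of $\mathrm{iso}(\mathbf{U}_S)$ is $\mathrm{cLO}(\mathbf{U}_S)$ together with the action $(g,<)\mapsto<^g$ defined by the same formula.
   Context: $\mathbf{Q}_S$ is the metric space whose underlying set is the set of finitely supported functions $x:S\to\mathbb{Q}$, with $d(x,y)=\min\{s\in S:\forall t\in S\,(s<t\Rightarrow x(t)=y(t))\}$ for $x\neq y$ (and $d(x,x)=0$); it is an ultrametric space (the countable ultrahomogeneous ultrametric space whose finite subspaces are exactly the finite ultrametric spaces with distances in $S$). $\mathbf{U}_S$ denotes the metric completion of $\mathbf{Q}_S$. For an ultrametric space $\mathbf{X}$, $\mathrm{iso}(\mathbf{X})$ is its group of isometries onto itself, and $\mathrm{cLO}(\mathbf{X})$ is the set of convex linear orderings of $\mathbf{X}$, i.e. linear orderings for which every metric ball is convex. $\mathrm{iso}(\mathbf{Q}_S)$ carries the topology of pointwise convergence for the discrete topology on $\mathbf{Q}_S$, and $\mathrm{iso}(\mathbf{U}_S)$ the topology of pointwise convergence for the metric topology on $\mathbf{U}_S$. $\mathrm{cLO}(\mathbf{X})$ carries the compact topology whose basic open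 sets are $\{\prec\in\mathrm{cLO}(\mathbf{X}):\prec|_F=<|_F\}$ for $F\subset\mathbf{X}$ finite and $<\in\mathrm{cLO}(\mathbf{X})$. For a topological group $G$, a $G$-flow is a continuous action of $G$ on a compact Hausdorff space; it is minimal if every orbit is dense; the universal minimal flow $M(G)$ is the (unique up to isomorphism of flows) minimal $G$-flow which maps onto every minimal $G$-flow by a continuous $G$-equivariant surjection. *)

theory Defs
  imports "HOL-Analysis.Analysis" "HOL-Algebra.Group_Action"
begin

section \<open>The space of finitely supported rational-valued functions, and completions\<close>

text \<open>A finitely supported function from \<open>S\<close> to the rationals is represented by its extension
  by zero to all reals.\<close>

definition QS_carrier :: "real set \<Rightarrow> (real \<Rightarrow> rat) set"
  where "QS_carrier S = {x. finite {s. x s \<noteq> 0} \<and> {s. x s \<noteq> 0} \<subseteq> S}"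

text \<open>The set below has a least element, namely the largest point at which \<open>x\<close> and \<open>y\<close> differ;
  see \<open>QS_dist_properties\<close>. The guard is needed because \<open>Metric_space\<close> asks for nonnegativity
  also outside the carrier.\<close>

definition QS_dist :: "real set \<Rightarrow> (real \<Rightarrow> rat) \<Rightarrow> (real \<Rightarrow> rat) \<Rightarrow> real"
  where "QS_dist S x y =
    (if x \<in> QS_carrier S \<and> y \<in> QS_carrier S \<and> x \<noteq> y
     then (LEAST s. s \<in> S \<and> (\<forall>t\<in>S. s < t \<longrightarrow> x t = y t)) else 0)"

lemma QS_dist_properties:
  assumes "x \<in> QS_carrier S" "y \<in> QS_carrier S" "x \<noteq> y"
  shows "QS_dist S x y \<in> S" "x (QS_dist S x y) \<noteq> y (QS_dist S x y)"
    "t > QS_dist S x y \<Longrightarrow> x t = y t"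
proof -
  define D where "D = {s. x s \<noteq> y s}"
  have sub: "D \<subseteq> {s. x s \<noteq> 0} \<union> {s. y s \<noteq> 0}"
    by (auto simp: D_def)
  have fin: "finite D" and DS: "D \<subseteq> S"
    using assms finite_subset[OF sub] sub by (auto simp: QS_carrier_def)
  have "D \<noteq> {}" using assms by (auto simp: D_def)
  then have MD: "Max D \<in> D" using fin by simp
  have mem: "x t \<noteq> y t" if "t \<in> D" for t
    using that by (simp add: D_def)
  have gt: "x t = y t" if "t > Max D" for t
  proof (rule ccontr)
    assume "x t \<noteq> y t"
    then have "t \<in> D" by (simp add: D_def)
    then show False using Max_ge[OF fin] that by fastforce
  qed
  have "(LEAST s. s \<in> S \<and> (\<forall>t\<in>S. s < t \<longrightarrow> x t = y t)) = Max D"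
  proof (rule Least_equality)
    show "Max D \<in> S \<and> (\<forall>t\<in>S. Max D < t \<longrightarrow> x t = y t)"
      using MD DS gt by blast
    show "Max D \<le> s" if "s \<in> S \<and> (\<forall>t\<in>S. s < t \<longrightarrow> x t = y t)" for s
      using that MD DS mem by (meson linorder_not_le subsetD)
  qed
  then have eq: "QS_dist S x y = Max D"
    using assms by (simp add: QS_dist_def)
  show "QS_dist S x y \<in> S" "x (QS_dist S x y) \<noteq> y (QS_dist S x y)"
    "t > QS_dist S x y \<Longrightarrow> x t = y t"
    unfolding eq using MD DS mem gt by blast+
qed

lemma Metric_space_QS:
  assumes "S \<subseteq> {0<..}"
  shows "Metric_space (QS_carrier S) (QS_dist S)"
proof
  have pos: "QS_dist S x y > 0" if "x \<in> QS_carrier S" "y \<in> QS_carrier S" "x \<noteq> y" for x y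
    using QS_dist_properties(1)[OF that] assms by auto
  show "QS_dist S x y = QS_dist S y x" for x y
  proof -
    have "(\<forall>t\<in>S. s < t \<longrightarrow> x t = y t) = (\<forall>t\<in>S. s < t \<longrightarrow> y t = x t)" for s
      by metis
    then show ?thesis unfolding QS_dist_def by auto
  qed
  show "QS_dist S x y = 0 \<longleftrightarrow> x = y"
    if "x \<in> QS_carrier S" "y \<in> QS_carrier S" for x y
    using pos[OF that] that by (auto simp: QS_dist_def)
  have ultra: "QS_dist S x z \<le> max (QS_dist S x y) (QS_dist S y z)"
    if "x \<in> QS_carrier S" "y \<in> QS_carrier S" "z \<in> QS_carrier S" "x \<noteq> y" "y \<noteq> z" "x \<noteq> z"
    for x y z
  proof (rule ccontr)
    assume "\<not> ?thesis"
    then have "x (QS_dist S x z) = y (QS_dist S x z)" "y (QS_dist S x z) = z (QS_dist S x z)"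
      using QS_dist_properties(3)[of x S y] QS_dist_properties(3)[of y S z] that by auto
    then show False using QS_dist_properties(2)[of x S z] that by simp
  qed
  show nonneg: "0 \<le> QS_dist S x y" for x y
    using pos[of x y] by (cases "x \<in> QS_carrier S \<and> y \<in> QS_carrier S \<and> x \<noteq> y") (auto simp: QS_dist_def)
  show "QS_dist S x z \<le> QS_dist S x y + QS_dist S y z"
    if "x \<in> QS_carrier S" "y \<in> QS_carrier S" "z \<in> QS_carrier S" for x y z
  proof (cases "x = y \<or> y = z \<or> x = z")
    case True
    then show ?thesis
      using nonneg[of x y] nonneg[of y z] by (auto simp: QS_dist_def[of S x x] QS_dist_def[of S z z])
  next
    case False
    then show ?thesis using ultra[of x y z] nonneg[of x y] nonneg[of y z] that by auto
  qed
qed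

definition QS :: "real set \<Rightarrow> (real \<Rightarrow> rat) metric"
  where "QS S = metric (QS_carrier S, QS_dist S)"

lemma mspace_QS: "S \<subseteq> {0<..} \<Longrightarrow> mspace (QS S) = QS_carrier S"
  by (simp add: QS_def Metric_space.mspace_metric Metric_space_QS)

lemma mdist_QS: "S \<subseteq> {0<..} \<Longrightarrow> mdist (QS S) = QS_dist S"
  by (simp add: QS_def Metric_space.mdist_metric Metric_space_QS)

definition is_completion :: "'a metric \<Rightarrow> 'b metric \<Rightarrow> bool"
  where "is_completion m m' \<longleftrightarrow> mcomplete_of m' \<and>
    (\<exists>e. e \<in> mspace m \<rightarrow> mspace m' \<and>
      (\<forall>x\<in>mspace m. \<forall>y\<in>mspace m. mdist m' (e x) (e y) = mdist m x y) \<and>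
      Abstract_Topology.closure_of (mtopology_of m') (e ` mspace m) = mspace m')"

lemma is_completion_exists:
  fixes m :: "'a metric"
  shows "\<exists>m' :: ('a \<Rightarrow> real) metric. is_completion m m'"
proof -
  interpret Metric_space "mspace m" "mdist m" by simp
  show ?thesis
  proof (rule metric_completion)
    fix f :: "'a \<Rightarrow> 'a \<Rightarrow> real" and m'
    assume "mcomplete_of m'" "f \<in> mspace m \<rightarrow> mspace m'"
      "Abstract_Topology.closure_of (mtopology_of m') (f ` mspace m) = mspace m'"
      "\<And>x y. \<lbrakk>x \<in> mspace m; y \<in> mspace m\<rbrakk> \<Longrightarrow> mdist m' (f x) (f y) = mdist m x y"
    then show ?thesis
      unfolding is_completion_def by (intro exI[of _ m'] conjI exI[of _ f] ballI)
  qed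
qed


section \<open>Isometry groups\<close>

definition isometries :: "'a metric \<Rightarrow> ('a \<Rightarrow> 'a) set"
  where "isometries m = {g \<in> Bij (mspace m).
    \<forall>x\<in>mspace m. \<forall>y\<in>mspace m. mdist m (g x) (g y) = mdist m x y}"

definition iso_group :: "'a metric \<Rightarrow> ('a \<Rightarrow> 'a) monoid"
  where "iso_group m = (BijGroup (mspace m))\<lparr>carrier := isometries m\<rparr>"

text \<open>Pointwise convergence, with respect to a topology \<open>T\<close> on \<open>mspace m\<close>.\<close>

definition iso_topology :: "'a metric \<Rightarrow> 'a topology \<Rightarrow> ('a \<Rightarrow> 'a) topology"
  where "iso_topology m T = subtopology (product_topology (\<lambda>_. T) (mspace m)) (isometries m)"


section \<open>Convex linear orderings\<close>

text \<open>Orderings are strict.\<close>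

definition order_convex_in :: "'a set \<Rightarrow> ('a \<times> 'a) set \<Rightarrow> 'a set \<Rightarrow> bool"
  where "order_convex_in X r K \<longleftrightarrow>
    (\<forall>x\<in>K. \<forall>z\<in>K. \<forall>y\<in>X. (x, y) \<in> r \<and> (y, z) \<in> r \<longrightarrow> y \<in> K)"

definition cLO :: "'a metric \<Rightarrow> ('a \<times> 'a) set set"
  where "cLO m = {r. r \<subseteq> mspace m \<times> mspace m \<and> strict_linear_order_on (mspace m) r \<and>
    (\<forall>x\<in>mspace m. \<forall>\<epsilon>. order_convex_in (mspace m) r (mball_of m x \<epsilon>) \<and>
      order_convex_in (mspace m) r (mcball_of m x \<epsilon>))}"

definition cLO_topology :: "'a metric \<Rightarrow> ('a \<times> 'a) set topology"
  where "cLO_topology m = topology_generated_by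
    {{r' \<in> cLO m. r' \<inter> F \<times> F = r \<inter> F \<times> F} | F r. finite F \<and> F \<subseteq> mspace m \<and> r \<in> cLO m}"

definition cLO_action :: "'a metric \<Rightarrow> ('a \<Rightarrow> 'a) \<Rightarrow> ('a \<times> 'a) set \<Rightarrow> ('a \<times> 'a) set"
  where "cLO_action m g = (\<lambda>r\<in>cLO m. {(x, y). x \<in> mspace m \<and> y \<in> mspace m \<and>
    (inv_into (mspace m) g x, inv_into (mspace m) g y) \<in> r})"


section \<open>Flows\<close>

locale topological_group = group G for G (structure) and T :: "'g topology" +
  assumes topspace_eq_carrier: "topspace T = carrier G"
    and continuous_mult: "continuous_map (prod_topology T T) T (\<lambda>(g, h). g \<otimes> h)"
    and continuous_inv: "continuous_map T T (\<lambda>g. inv g)"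

text \<open>Phase spaces of flows are nonempty: otherwise the empty flow would be minimal, and no
  universal minimal flow would exist.\<close>

locale flow = topological_group G T + group_action G "topspace X" \<phi>
  for G (structure) and T and X :: "'x topology" and \<phi> +
  assumes nonempty: "topspace X \<noteq> {}"
    and compact: "compact_space X"
    and Hausdorff: "Hausdorff_space X"
    and continuous_action: "continuous_map (prod_topology T X) X (\<lambda>(g, x). \<phi> g x)"

locale minimal_flow = flow +
  assumes dense_orbits: "x \<in> topspace X \<Longrightarrow> Abstract_Topology.closure_of X (orbit G \<phi> x) = topspace X"

text \<open>The type argument is the type of points of the minimal flows onto which the universal one has
  to map. It is meant to be a type variable, so that a theorem about this predicate covers
  all minimal flows.\<close>

definition universal_minimal_flow ::
  "'y itself \<Rightarrow> ('g, 'b) monoid_scheme \<Rightarrow> 'g topology \<Rightarrow> 'x topology \<Rightarrow> ('g \<Rightarrow> 'x \<Rightarrow> 'x) \<Rightarrow> bool"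
  where "universal_minimal_flow _ G T X \<phi> \<longleftrightarrow> minimal_flow G T X \<phi> \<and>
    (\<forall>(Y :: 'y topology) \<psi>. minimal_flow G T Y \<psi> \<longrightarrow>
      (\<exists>f. continuous_map X Y f \<and> f ` topspace X = topspace Y \<and>
        (\<forall>g\<in>carrier G. \<forall>x\<in>topspace X. f (\<phi> g x) = \<psi> g (f x))))"

end

theory Submission
  imports Defs "HOL-Library.Ramsey"
begin

text \<open>The stabilizer of the lexicographic order \<open>r0\<close> contains, for every \<open>s\<close> and every finitely
  supported \<open>w\<close> on the part of \<open>S\<close> above \<open>s\<close>, a copy of the order automorphism group of the rationals:
  it acts on the coordinate at \<open>s\<close> of those points that continue \<open>w\<close>. By Pestov's theorem each copy has
  a fixed point in every compact flow. Copies at the same level commute and each level is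
  normalised by the higher ones, so that by compactness all copies have a common fixed point \<open>y0\<close>.
  The group they generate acts transitively on isometric copies of finite subspaces ordered by \<open>r0\<close>,
  which makes the closure of the pairs \<open>(g r0, g y0)\<close> the graph of an equivariant map from the
  convex orders to the given flow. Minimality of the flow of convex orders holds because
  permutations of the coordinates at single levels take any convex order to any other one on a given
  finite set.\<close>


section \<open>Order automorphisms of the rationals\<close>

text \<open>As \<open>S\<close> may be dense in an interval, there need not be a lowest level to
  start from: finite sets of levels are treated, and compactness does the rest. Levels are added
  from the lowest upwards, because a higher copy permutes the lower copies by conjugation and hence
  preserves the set of points fixed by all copies at the lower levels. The copies are defined on
  finitely supported functions, whereas the second group acts on the completion. The bridge is that
  a convex order compares two points in the same way as any points closer to them than their
  distance (\<open>convex_order_move\<close>). Finite sets may therefore be replaced by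
  approximations in the dense copy, and \<open>r0\<close> itself extends to the completion. Both
  groups become instances of the locale \<open>dense_QS\<close>, in which closeness means either
  equality or small distance.\<close>

definition AutQ :: "(rat \<Rightarrow> rat) set"
  where "AutQ = {\<phi>. strict_mono \<phi> \<and> surj \<phi>}"

lemma AutQ_bij: "\<phi> \<in> AutQ \<Longrightarrow> bij \<phi>"
  by (auto simp: AutQ_def bij_def strict_mono_on_imp_inj_on)

lemma AutQ_less_iff: "\<phi> \<in> AutQ \<Longrightarrow> \<phi> a < \<phi> b \<longleftrightarrow> a < b"
  by (simp add: AutQ_def strict_mono_less)

lemma id_AutQ: "id \<in> AutQ"
  by (simp add: AutQ_def strict_mono_def)

lemma comp_AutQ: "\<phi> \<in> AutQ \<Longrightarrow> \<psi> \<in> AutQ \<Longrightarrow> \<phi> \<circ> \<psi> \<in> AutQ"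
  unfolding AutQ_def mem_Collect_eq by (metis comp_surj strict_mono_o)

lemma inv_AutQ:
  assumes "\<phi> \<in> AutQ"
  shows "inv_into UNIV \<phi> \<in> AutQ"
proof -
  have "inj \<phi>" "surj \<phi>" using AutQ_bij[OF assms] unfolding bij_def by blast+
  moreover have "strict_mono (inv_into UNIV \<phi>)"
  proof (rule strict_mono_inv)
    show "strict_mono \<phi>" using assms unfolding AutQ_def by blast
    show "inv_into UNIV \<phi> (\<phi> x) = x" for x using \<open>inj \<phi>\<close> by (rule inv_f_f)
  qed (fact \<open>surj \<phi>\<close>)
  moreover have "surj (inv_into UNIV \<phi>)" using \<open>inj \<phi>\<close> by (rule inj_imp_surj_inv)
  ultimately show ?thesis unfolding AutQ_def by blast
qed

text \<open>By induction along the points in increasing order. The automorphism found so far is kept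
  up to the last point \<open>a\<close> and continued by the affine map through
  \<open>(a, f a)\<close> and \<open>(b, f b)\<close>, whose slope is a positive rational.\<close>

lemma strict_mono_on_extends_to_AutQ:
  fixes f :: "rat \<Rightarrow> rat"
  assumes "finite A" "strict_mono_on A f"
  shows "\<exists>\<phi>\<in>AutQ. \<forall>a\<in>A. \<phi> a = f a"
  using assms
proof (induction A rule: finite_linorder_max_induct)
  case empty
  show ?case using id_AutQ by blast
next
  case (insert b A)
  have "strict_mono_on A f"
    using insert.prems by (auto simp: strict_mono_on_def)
  then obtain \<phi> where \<phi>: "\<phi> \<in> AutQ" "\<And>a. a \<in> A \<Longrightarrow> \<phi> a = f a"
    using insert.IH by blast
  show ?case
  proof (cases "A = {}")
    case True
    have "(\<lambda>x. x + (f b - b)) \<in> AutQ"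
      unfolding AutQ_def by (auto simp: strict_mono_def intro!: surjI[of _ "\<lambda>x. x - (f b - b)"])
    then show ?thesis using True by (intro bexI[of _ "\<lambda>x. x + (f b - b)"]) auto
  next
    case False
    define a where "a = Max A"
    have aA: "a \<in> A" and amax: "\<And>x. x \<in> A \<Longrightarrow> x \<le> a"
      using False insert.hyps by (auto simp: a_def)
    have ab: "a < b" using aA insert.hyps by blast
    have fab: "f a < f b"
      using insert.prems aA ab by (auto simp: strict_mono_on_def)
    define c where "c = (f b - f a) / (b - a)"
    have c: "c > 0" using ab fab by (simp add: c_def)
    define \<psi> where "\<psi> x = (if x \<le> a then \<phi> x else f a + (x - a) * c)" for x
    have "strict_mono \<psi>"
    proof (rule strict_monoI)
      fix x y :: rat assume xy: "x < y"
      consider "y \<le> a" | "x \<le> a" "a < y" | "a < x" using xy by linarith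
      then show "\<psi> x < \<psi> y"
      proof cases
        case 1
        then show ?thesis using xy AutQ_less_iff[OF \<phi>(1)] by (simp add: \<psi>_def)
      next
        case 2
        have "\<phi> x \<le> f a" using 2 \<phi> aA AutQ_less_iff[OF \<phi>(1), of a x] by auto
        moreover have "(y - a) * c > 0" using 2 c by simp
        ultimately show ?thesis using 2 by (simp add: \<psi>_def)
      next
        case 3
        then show ?thesis using xy c by (simp add: \<psi>_def)
      qed
    qed
    moreover have "surj \<psi>"
    proof (rule surjI)
      fix y
      show "\<psi> (if y \<le> f a then inv_into UNIV \<phi> y else a + (y - f a) / c) = y"
      proof (cases "y \<le> f a")
        case True
        have "\<phi> (inv_into UNIV \<phi> y) = y" using \<phi>(1) by (simp add: AutQ_def surj_f_inv_f)
        moreover have "inv_into UNIV \<phi> y \<le> a"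
          using AutQ_less_iff[OF \<phi>(1), of a "inv_into UNIV \<phi> y"] True calculation \<phi>(2)[OF aA] by auto
        ultimately show ?thesis using True by (simp add: \<psi>_def)
      next
        case False
        define d where "d = (y - f a) / c"
        have "d > 0" "d * c = y - f a" using c False by (simp_all add: d_def)
        then show ?thesis using False by (simp add: \<psi>_def d_def[symmetric])
      qed
    qed
    moreover have "\<psi> x = f x" if "x \<in> insert b A" for x
      using that \<phi>(2) amax ab by (force simp: \<psi>_def c_def)
    ultimately show ?thesis by (auto simp: AutQ_def)
  qed
qed

lemma AutQ_maps_finite_set:
  assumes "finite A" "finite B" "card A = card B"
  shows "\<exists>\<phi>\<in>AutQ. \<phi> ` A = B"
proof -
  define n where "n = card A"
  define xs where "xs = sorted_list_of_set A"
  define ys where "ys = sorted_list_of_set B"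
  define f where "f x = the (map_of (zip xs ys) x)" for x
  have xs: "set xs = A" "sorted_wrt (<) xs" "length xs = n" "distinct xs"
    using assms by (auto simp: xs_def n_def)
  have ys: "set ys = B" "sorted_wrt (<) ys" "length ys = n"
    using assms by (auto simp: ys_def n_def)
  have f: "f (xs ! i) = ys ! i" if "i < n" for i
    using map_of_zip_nth[of xs ys i] that xs ys by (simp add: f_def)
  have "strict_mono_on A f"
  proof (rule strict_mono_onI)
    fix a b assume "a \<in> A" "b \<in> A" "a < b"
    then obtain i j where ij: "i < n" "a = xs ! i" "j < n" "b = xs ! j"
      using xs(1,3) by (metis in_set_conv_nth)
    have "i < j"
    proof (rule ccontr)
      assume "\<not> i < j"
      then have "j = i \<or> j < i" by auto
      then show False using \<open>a < b\<close> ij xs sorted_wrt_nth_less[OF xs(2), of j i] by auto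
    qed
    then show "f a < f b" using ij f ys sorted_wrt_nth_less[OF ys(2), of i j] by auto
  qed
  then obtain \<phi> where \<phi>: "\<phi> \<in> AutQ" "\<forall>a\<in>A. \<phi> a = f a"
    using strict_mono_on_extends_to_AutQ assms by blast
  have "map f xs = ys" using f xs(3) ys(3) by (intro nth_equalityI) auto
  then have "f ` A = B" using xs(1) ys(1) by (metis set_map)
  then show ?thesis using \<phi> by (metis image_cong)
qed

text \<open>An increasing map takes the sorted list of \<open>A\<close> to a sorted list of the same
  set, hence to the same list. In the next theorem this controls how much the choice of an
  automorphism matters for the colouring.\<close>

lemma AutQ_fixes_finite_invariant_set:
  assumes "\<phi> \<in> AutQ" "finite A" "\<phi> ` A = A" "a \<in> A"
  shows "\<phi> a = a"
proof -
  let ?xs = "sorted_list_of_set A"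
  have "map \<phi> ?xs = ?xs"
  proof (rule sorted_distinct_set_unique)
    show "sorted (map \<phi> ?xs)"
      using assms(1) by (auto simp: sorted_map AutQ_def strict_mono_less_eq)
    show "distinct (map \<phi> ?xs)"
      using AutQ_bij[OF assms(1)] assms(2)
      by (auto simp: distinct_map bij_def intro: inj_on_subset)
  qed (use assms in auto)
  then show ?thesis
    using assms(2,4) map_eq_conv[of \<phi> ?xs id] by auto
qed

text \<open>Pestov's theorem that the order automorphism group of the rationals is extremely amenable.
  Without fixed points, finitely many open sets cover the orbit of a point, each of them moved off
  itself by some automorphism; colouring the finite subsets of the rationals accordingly,
  Ramsey's theorem gives a contradiction.\<close>

theorem AutQ_fixed_point:
  fixes Z :: "'z topology" and \<alpha> :: "(rat \<Rightarrow> rat) \<Rightarrow> 'z \<Rightarrow> 'z"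
  assumes comp: "compact_space Z" and haus: "Hausdorff_space Z" and ne: "topspace Z \<noteq> {}"
    and act_comp: "\<And>\<phi> \<psi> z. \<phi> \<in> AutQ \<Longrightarrow> \<psi> \<in> AutQ \<Longrightarrow> z \<in> topspace Z \<Longrightarrow> \<alpha> (\<phi> \<circ> \<psi>) z = \<alpha> \<phi> (\<alpha> \<psi> z)"
    and act_cont: "\<And>\<phi>. \<phi> \<in> AutQ \<Longrightarrow> continuous_map Z Z (\<alpha> \<phi>)"
    and small: "\<And>z U. openin Z U \<Longrightarrow> z \<in> U \<Longrightarrow> \<exists>V A. openin Z V \<and> z \<in> V \<and> finite A \<and>
      (\<forall>\<phi>\<in>AutQ. (\<forall>a\<in>A. \<phi> a = a) \<longrightarrow> (\<forall>y\<in>V. \<alpha> \<phi> y \<in> U))"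
  shows "\<exists>z\<in>topspace Z. \<forall>\<phi>\<in>AutQ. \<alpha> \<phi> z = z"
proof (rule ccontr)
  assume nofix: "\<not> ?thesis"
  have act_in: "\<alpha> \<phi> z \<in> topspace Z" if "\<phi> \<in> AutQ" "z \<in> topspace Z" for \<phi> z
    using act_cont[OF that(1)] that(2) by (auto simp: continuous_map_def)
  have "\<exists>g U V A. g \<in> AutQ \<and> z \<in> V \<and> openin Z V \<and> finite A \<and> (\<forall>u\<in>U. \<alpha> g u \<notin> U) \<and>
      (\<forall>\<phi>\<in>AutQ. (\<forall>a\<in>A. \<phi> a = a) \<longrightarrow> (\<forall>y\<in>V. \<alpha> \<phi> y \<in> U))" if z: "z \<in> topspace Z" for z
  proof -
    obtain g where g: "g \<in> AutQ" "\<alpha> g z \<noteq> z" using nofix z by blast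
    obtain P Q where PQ: "openin Z P" "openin Z Q" "z \<in> P" "\<alpha> g z \<in> Q" "disjnt P Q"
      using haus g z act_in unfolding Hausdorff_space_def by metis
    \<comment> \<open>\<open>U\<close> lies in \<open>P\<close> while \<open>\<alpha> g\<close>
      takes it into \<open>Q\<close>, so \<open>g\<close> moves \<open>U\<close> off itself.\<close>
    define U where "U = P \<inter> {y \<in> topspace Z. \<alpha> g y \<in> Q}"
    have "openin Z U"
      unfolding U_def using PQ act_cont[OF g(1)] openin_continuous_map_preimage by blast
    moreover have "z \<in> U" using PQ z by (auto simp: U_def)
    moreover have "\<alpha> g u \<notin> U" if "u \<in> U" for u
      using that PQ by (auto simp: U_def disjnt_iff)
    ultimately show ?thesis using small[of U z] g by metis
  qed
  then obtain g U V A where gUVA: "\<And>z. z \<in> topspace Z \<Longrightarrow> g z \<in> AutQ \<and> z \<in> V z \<and> openin Z (V z) \<and>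
      finite (A z) \<and> (\<forall>u\<in>U z. \<alpha> (g z) u \<notin> U z) \<and>
      (\<forall>\<phi>\<in>AutQ. (\<forall>a\<in>A z. \<phi> a = a) \<longrightarrow> (\<forall>y\<in>V z. \<alpha> \<phi> y \<in> U z))"
    by metis
  have "\<exists>C. finite C \<and> C \<subseteq> topspace Z \<and> topspace Z \<subseteq> (\<Union>z\<in>C. V z)"
  proof -
    have "\<forall>W\<in>V ` topspace Z. openin Z W" "topspace Z \<subseteq> \<Union>(V ` topspace Z)"
      using gUVA by blast+
    then obtain \<F> where "finite \<F>" "\<F> \<subseteq> V ` topspace Z" "topspace Z \<subseteq> \<Union>\<F>"
      using comp unfolding compact_space_alt by meson
    then show ?thesis by (metis finite_subset_image)
  qed
  then obtain C where C: "finite C" "C \<subseteq> topspace Z" "topspace Z \<subseteq> (\<Union>z\<in>C. V z)" by blast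
  \<comment> \<open>An automorphism that fixes \<open>F\<close> pointwise takes \<open>V z\<close>
    into \<open>U z\<close> for all \<open>z\<close> in \<open>C\<close> at once.\<close>
  define F where "F = (\<Union>z\<in>C. A z)"
  have F: "finite F" using C gUVA unfolding F_def by blast
  obtain z0 where z0: "z0 \<in> topspace Z" using ne by blast
  define h where "h B = (SOME \<phi>. \<phi> \<in> AutQ \<and> \<phi> ` B = F)" for B
  have h: "h B \<in> AutQ" "h B ` B = F" if "finite B" "card B = card F" for B
    using someI_ex[of "\<lambda>\<phi>. \<phi> \<in> AutQ \<and> \<phi> ` B = F"] AutQ_maps_finite_set[OF that(1) F that(2)]
    unfolding h_def by blast+
  \<comment> \<open>The colour of \<open>B\<close>: a member of the cover that contains the image of
    \<open>z0\<close> under one automorphism taking \<open>B\<close> onto \<open>F\<close>.\<close>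
  define c where "c B = (SOME z. z \<in> C \<and> \<alpha> (h B) z0 \<in> V z)" for B
  have c: "c B \<in> C" "\<alpha> (h B) z0 \<in> V (c B)" if "finite B" "card B = card F" for B
    using someI_ex[of "\<lambda>z. z \<in> C \<and> \<alpha> (h B) z0 \<in> V z"] act_in[OF h(1)[OF that] z0] C(3)
    unfolding c_def by blast+
  \<comment> \<open>Any other automorphism \<open>k\<close> taking \<open>B\<close> onto
    \<open>F\<close> differs from \<open>h B\<close> by a left factor that fixes \<open>F\<close>
    pointwise; the price is passing from \<open>V\<close> to \<open>U\<close>.\<close>
  have key: "\<alpha> k z0 \<in> U (c B)" if B: "finite B" "card B = card F" and k: "k \<in> AutQ" "k ` B = F" for k B
  proof -
    define w where "w = k \<circ> inv_into UNIV (h B)"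
    have bij: "bij (h B)" using AutQ_bij h B by blast
    have w: "w \<in> AutQ" unfolding w_def using k h B by (simp add: comp_AutQ inv_AutQ)
    have "inv_into UNIV (h B) ` F = B"
      using h(2)[OF B] bij by (metis bij_betw_def image_inv_f_f)
    then have "w ` F = F" unfolding w_def image_comp[symmetric] using k by simp
    then have "\<forall>a\<in>F. w a = a" using AutQ_fixes_finite_invariant_set[OF w F] by blast
    then have "\<alpha> w (\<alpha> (h B) z0) \<in> U (c B)"
      using gUVA[of "c B"] c[OF B] C(2) w unfolding F_def by blast
    moreover have "w \<circ> h B = k" using bij by (simp add: w_def fun_eq_iff bij_is_inj)
    ultimately show ?thesis using act_comp[OF w h(1)[OF B] z0] by simp
  qed
  obtain e where e: "bij_betw e C {..<card C}"
    using ex_bij_betw_finite_nat[OF C(1)] by (auto simp: atLeast0LessThan)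
  have "\<exists>Y t. Y \<subseteq> UNIV \<and> infinite Y \<and> t < card C \<and>
      (\<forall>X. X \<subseteq> Y \<and> finite X \<and> card X = card F \<longrightarrow> (e \<circ> c) X = t)"
    by (rule Ramsey) (use c e infinite_UNIV_char_0 in \<open>auto simp: bij_betw_def\<close>)
  then obtain Y t where Y: "infinite (Y::rat set)"
    "\<And>X. X \<subseteq> Y \<Longrightarrow> finite X \<Longrightarrow> card X = card F \<Longrightarrow> e (c X) = t" by auto
  obtain B0 where B0: "B0 \<subseteq> Y" "finite B0" "card B0 = card F"
    using infinite_arbitrarily_large[OF Y(1)] by metis
  define z where "z = c B0"
  have z: "z \<in> C" using c B0 by (simp add: z_def)
  have cz: "c X = z" if "X \<subseteq> Y" "finite X" "card X = card F" for X
    using Y(2)[OF that] Y(2)[OF B0] e c[OF that(2,3)] z unfolding z_def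
    by (metis bij_betw_def inj_onD)
  have gz: "g z \<in> AutQ" using gUVA z C by blast
  \<comment> \<open>\<open>D\<close> contains \<open>F\<close> and its preimage under
    \<open>g z\<close>, so that \<open>k\<close> and \<open>g z \<circ> k\<close> each take some
    subset of the homogeneous set \<open>Y\<close> onto \<open>F\<close>. Both subsets have colour
    \<open>z\<close>, hence \<open>\<alpha> k z0\<close> and its image under \<open>g z\<close> lie
    in \<open>U z\<close>, which \<open>g z\<close> moves off itself.\<close>
  define D where "D = F \<union> g z -` F"
  have fD: "finite D"
    using F AutQ_bij[OF gz] by (auto simp: D_def bij_def intro: finite_vimageI)
  obtain H where H: "H \<subseteq> Y" "finite H" "card H = card D"
    using infinite_arbitrarily_large[OF Y(1)] by metis
  obtain k where k: "k \<in> AutQ" "k ` H = D" using AutQ_maps_finite_set[OF H(2) fD H(3)] by blast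
  have pre: "\<alpha> (l \<circ> k) z0 \<in> U z" if l: "l \<in> AutQ" "l -` F \<subseteq> D" for l
  proof -
    define X where "X = {a\<in>H. l (k a) \<in> F}"
    have lk: "l \<circ> k \<in> AutQ" using l k comp_AutQ by blast
    have "F \<subseteq> (l \<circ> k) ` X"
    proof
      fix b assume b: "b \<in> F"
      obtain d where d: "l d = b" using l by (auto simp: AutQ_def) (metis surjD)
      then have "d \<in> D" using l b by auto
      then obtain a where "a \<in> H" "k a = d" using k by blast
      then show "b \<in> (l \<circ> k) ` X" using b d by (auto simp: X_def)
    qed
    then have im: "(l \<circ> k) ` X = F" by (auto simp: X_def)
    have "card X = card F"
      using card_image[of "l \<circ> k" X] im AutQ_bij[OF lk] by (metis bij_def inj_on_subset subset_UNIV)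
    moreover have "X \<subseteq> Y" "finite X" using H by (auto simp: X_def)
    ultimately show ?thesis using key[of X "l \<circ> k"] cz[of X] lk im by metis
  qed
  have "\<alpha> k z0 \<in> U z" using pre[OF id_AutQ] by (simp add: D_def)
  moreover have "\<alpha> (g z) (\<alpha> k z0) \<in> U z"
    using pre[OF gz] act_comp[OF gz k(1) z0] by (simp add: D_def)
  ultimately show False using gUVA[of z] z C by blast
qed

section \<open>Maps acting on a single level\<close>

text \<open>For nonnegative \<open>s\<close>, two points have the same truncation at
  \<open>s\<close> exactly when their distance is at most \<open>s\<close>
  (\<open>d_le_iff\<close>), so truncations label the closed balls of radius
  \<open>s\<close>.\<close>

definition trunc :: "real \<Rightarrow> (real \<Rightarrow> rat) \<Rightarrow> real \<Rightarrow> rat"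
  where "trunc s x = (\<lambda>t. if s < t then x t else 0)"

text \<open>If every \<open>p w\<close> is a bijection and \<open>s\<close> is a level, this
  permutes, within each closed ball of radius \<open>s\<close>, the open balls of radius
  \<open>s\<close>, which are told apart by the coordinate at \<open>s\<close>. The permutation may
  vary with the closed ball.\<close>

definition level_map :: "real \<Rightarrow> ((real \<Rightarrow> rat) \<Rightarrow> rat \<Rightarrow> rat) \<Rightarrow> (real \<Rightarrow> rat) \<Rightarrow> real \<Rightarrow> rat"
  where "level_map s p x = x(s := p (trunc s x) (x s))"

definition node_map :: "real \<Rightarrow> (real \<Rightarrow> rat) \<Rightarrow> (rat \<Rightarrow> rat) \<Rightarrow> (real \<Rightarrow> rat) \<Rightarrow> real \<Rightarrow> rat"
  where "node_map s w \<phi> = level_map s (\<lambda>v. if v = w then \<phi> else id)"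

lemma trunc_eq_iff: "trunc s x = trunc s y \<longleftrightarrow> (\<forall>t>s. x t = y t)"
  by (auto simp: trunc_def fun_eq_iff)

lemma level_map_other: "t \<noteq> s \<Longrightarrow> level_map s p x t = x t"
  by (simp add: level_map_def)

lemma level_map_at: "level_map s p x s = p (trunc s x) (x s)"
  by (simp add: level_map_def)

lemma trunc_level_map [simp]: "trunc s (level_map s p x) = trunc s x"
  by (simp add: trunc_eq_iff level_map_other)

lemma level_map_comp: "level_map s p (level_map s q x) = level_map s (\<lambda>w. p w \<circ> q w) x"
  unfolding level_map_def[of s p] level_map_def[of s "\<lambda>w. p w \<circ> q w"]
  by (simp add: level_map_at fun_eq_iff level_map_other)

lemma level_map_id: "(\<And>w. p w = id) \<Longrightarrow> level_map s p x = x"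
  by (simp add: level_map_def)

lemma level_map_trunc: "s < t \<Longrightarrow> trunc s (level_map t p x) = level_map t p (trunc s x)"
  by (auto simp: fun_eq_iff level_map_def trunc_def intro!: arg_cong2[of _ _ _ _ p])

lemma level_map_inv:
  assumes "\<And>w. bij (p w)"
  shows "level_map s p (level_map s (\<lambda>w. inv_into UNIV (p w)) x) = x"
    "level_map s (\<lambda>w. inv_into UNIV (p w)) (level_map s p x) = x"
proof -
  have "p w \<circ> inv_into UNIV (p w) = id" "inv_into UNIV (p w) \<circ> p w = id" for w
    using assms[of w] by (auto simp: bij_def fun_eq_iff surj_f_inv_f)
  then show "level_map s p (level_map s (\<lambda>w. inv_into UNIV (p w)) x) = x"
    "level_map s (\<lambda>w. inv_into UNIV (p w)) (level_map s p x) = x"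
    unfolding level_map_comp by (auto intro: level_map_id)
qed

lemma node_map_comp: "node_map s w \<phi> (node_map s w \<psi> x) = node_map s w (\<phi> \<circ> \<psi>) x"
  unfolding node_map_def level_map_comp by (rule arg_cong[of _ _ "\<lambda>p. level_map s p x"]) auto

lemma node_map_commute:
  "w \<noteq> w' \<Longrightarrow> node_map s w \<phi> (node_map s w' \<psi> x) = node_map s w' \<psi> (node_map s w \<phi> x)"
  unfolding node_map_def level_map_comp by (rule arg_cong[of _ _ "\<lambda>p. level_map s p x"]) auto

lemma node_map_other: "t \<noteq> s \<or> trunc s x \<noteq> w \<Longrightarrow> node_map s w \<phi> x t = x t"
  by (auto simp: node_map_def level_map_def)

lemma node_map_at: "trunc s x = w \<Longrightarrow> node_map s w \<phi> x s = \<phi> (x s)"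
  by (auto simp: node_map_def level_map_def)

lemma node_map_inv: "bij \<phi> \<Longrightarrow> node_map s w (inv_into UNIV \<phi>) (node_map s w \<phi> x) = x"
  unfolding node_map_comp unfolding node_map_def
  by (rule level_map_id) (auto simp: bij_def)

text \<open>A map at level \<open>s\<close> leaves all coordinates from \<open>t\<close> on
  untouched, so the map at level \<open>t\<close> does the same before and after it. The map at
  level \<open>t\<close> in turn permutes the closed balls of radius \<open>s\<close>, and
  conjugation by it moves the copy at \<open>w\<close> to the copy at the image of
  \<open>w\<close>.\<close>

lemma node_map_normalises:
  assumes "s < t" "bij \<psi>"
  shows "node_map t v \<psi> (node_map s w \<phi> x) = node_map s (node_map t v \<psi> w) \<phi> (node_map t v \<psi> x)"
    (is "?L = ?R")
proof
  fix u
  have tr: "trunc t (node_map s w \<phi> x) = trunc t x"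
    using assms by (auto simp: trunc_eq_iff node_map_other)
  have iff: "trunc s (node_map t v \<psi> x) = node_map t v \<psi> w \<longleftrightarrow> trunc s x = w"
    using node_map_inv[OF assms(2)] level_map_trunc[OF assms(1)] unfolding node_map_def by metis
  consider "u = t" | "u = s" | "u \<noteq> t" "u \<noteq> s" by blast
  then show "?L u = ?R u"
  proof cases
    case 1
    then show ?thesis using assms tr
      by (cases "trunc t x = v") (auto simp: node_map_at node_map_other)
  next
    case 2
    then show ?thesis using assms iff
      by (cases "trunc s x = w") (auto simp: node_map_at node_map_other)
  qed (auto simp: node_map_other)
qed

section \<open>Balls and isometries in terms of coordinates\<close>

locale level_set =
  fixes S :: "real set"
  assumes pos: "S \<subseteq> {0<..}"
begin

abbreviation "Q \<equiv> QS_carrier S"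
abbreviation "d \<equiv> QS_dist S"

lemma d_nonneg: "0 \<le> d x y"
  using Metric_space.nonneg[OF Metric_space_QS[OF pos]] .

lemma d_self: "d x x = 0"
  by (simp add: QS_dist_def)

lemma d_comm: "d x y = d y x"
  using Metric_space.commute[OF Metric_space_QS[OF pos]] .

lemma d_zero: "x \<in> Q \<Longrightarrow> y \<in> Q \<Longrightarrow> d x y = 0 \<longleftrightarrow> x = y"
  using Metric_space.zero[OF Metric_space_QS[OF pos]] .

lemma d_mem: "x \<in> Q \<Longrightarrow> y \<in> Q \<Longrightarrow> x \<noteq> y \<Longrightarrow> d x y \<in> S"
  by (rule QS_dist_properties)

lemma d_le_iff:
  assumes "x \<in> Q" "y \<in> Q" "0 \<le> s"
  shows "d x y \<le> s \<longleftrightarrow> trunc s x = trunc s y"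
proof (cases "x = y")
  case False
  note pr = QS_dist_properties[OF assms(1,2) False]
  show ?thesis unfolding trunc_eq_iff using pr(2,3) by (metis le_less_trans linorder_not_le)
qed (use assms in \<open>simp add: d_self\<close>)

lemma d_eqI:
  assumes "x \<in> Q" "y \<in> Q" "trunc s x = trunc s y" "x s \<noteq> y s"
  shows "d x y = s"
proof -
  have "x \<noteq> y" using assms by auto
  note pr = QS_dist_properties[OF assms(1,2) this]
  show ?thesis using pr(2,3) assms(3,4) unfolding trunc_eq_iff by (metis linorder_neqE)
qed

lemma d_lessI:
  assumes "x \<in> Q" "y \<in> Q" "s > 0" "trunc s x = trunc s y" "x s = y s"
  shows "d x y < s"
proof -
  have "d x y \<le> s" using d_le_iff assms by simp
  moreover have "d x y \<noteq> s" using assms QS_dist_properties(2)[of x S y] by (metis d_self less_irrefl)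
  ultimately show ?thesis by simp
qed

lemma ultra:
  assumes "x \<in> Q" "y \<in> Q" "z \<in> Q"
  shows "d x z \<le> max (d x y) (d y z)"
  using d_le_iff[OF assms(1,2), of "max (d x y) (d y z)"] d_le_iff[OF assms(2,3), of "max (d x y) (d y z)"]
    d_le_iff[OF assms(1,3), of "max (d x y) (d y z)"] d_nonneg[of x y]
  by (simp add: le_max_iff_disj)

lemma QS_carrier_subset:
  "x \<in> Q \<Longrightarrow> s \<in> S \<Longrightarrow> {t. y t \<noteq> 0} \<subseteq> insert s {t. x t \<noteq> 0} \<Longrightarrow> y \<in> Q"
  unfolding QS_carrier_def using finite_subset[of "{t. y t \<noteq> 0}" "insert s {t. x t \<noteq> 0}"] by auto

lemma update_mem: "x \<in> Q \<Longrightarrow> s \<in> S \<Longrightarrow> x(s := a) \<in> Q"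
  by (rule QS_carrier_subset[of x s]) auto

lemma trunc_mem: "x \<in> Q \<Longrightarrow> s \<in> S \<Longrightarrow> trunc s x \<in> Q"
  by (rule QS_carrier_subset[of x s]) (auto simp: trunc_def)

lemma level_map_mem: "x \<in> Q \<Longrightarrow> s \<in> S \<Longrightarrow> level_map s p x \<in> Q"
  unfolding level_map_def by (rule update_mem)

text \<open>The largest coordinate at which \<open>x\<close> and \<open>y\<close> differ survives.
  If it is at most \<open>s\<close>, both points have the same truncation at \<open>s\<close>, so
  one and the same injective map is applied to their values there; if it is above \<open>s\<close>,
  it is not touched.\<close>

lemma level_map_dist:
  assumes x: "x \<in> Q" and y: "y \<in> Q" and s: "s \<in> S" and p: "\<And>w. bij (p w)"
  shows "d (level_map s p x) (level_map s p y) = d x y"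
proof (cases "x = y")
  case False
  note mem = level_map_mem[OF x s, of p] level_map_mem[OF y s, of p]
  note pr = QS_dist_properties[OF x y False]
  have eq: "trunc (d x y) x = trunc (d x y) y"
    using pr(3) by (simp add: trunc_eq_iff)
  show ?thesis
  proof (rule d_eqI[OF mem])
    have *: "trunc s x = trunc s y" if "d x y \<le> s"
      using that d_le_iff[OF x y] s pos by auto
    show "trunc (d x y) (level_map s p x) = trunc (d x y) (level_map s p y)"
      using eq * unfolding trunc_eq_iff[of "d x y"] level_map_def by (simp add: less_imp_le)
    show "level_map s p x (d x y) \<noteq> level_map s p y (d x y)"
      using pr(2) p * by (auto simp: level_map_def bij_def inj_eq)
  qed
qed (simp add: d_self)

lemma level_map_bij:
  assumes "s \<in> S" "\<And>w. bij (p w)"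
  shows "bij_betw (level_map s p) Q Q"
  by (rule bij_betw_byWitness[of _ "level_map s (\<lambda>w. inv_into UNIV (p w))"])
    (use level_map_inv[OF assms(2)] level_map_mem assms(1) in auto)

lemma node_map_mem: "x \<in> Q \<Longrightarrow> s \<in> S \<Longrightarrow> node_map s w \<phi> x \<in> Q"
  unfolding node_map_def by (rule level_map_mem)

lemma node_map_dist: "x \<in> Q \<Longrightarrow> y \<in> Q \<Longrightarrow> s \<in> S \<Longrightarrow> bij \<phi> \<Longrightarrow>
    d (node_map s w \<phi> x) (node_map s w \<phi> y) = d x y"
  unfolding node_map_def by (rule level_map_dist) auto

lemma node_map_bij: "s \<in> S \<Longrightarrow> bij \<phi> \<Longrightarrow> bij_betw (node_map s w \<phi>) Q Q"
  unfolding node_map_def by (rule level_map_bij) auto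


section \<open>Homogeneity of the lexicographic order\<close>

definition lex :: "((real \<Rightarrow> rat) \<times> (real \<Rightarrow> rat)) set"
  where "lex = {(x, y). x \<in> Q \<and> y \<in> Q \<and> x \<noteq> y \<and> x (d x y) < y (d x y)}"

lemma node_map_lex:
  assumes x: "x \<in> Q" and y: "y \<in> Q" and s: "s \<in> S" and \<phi>: "\<phi> \<in> AutQ"
  shows "(node_map s w \<phi> x, node_map s w \<phi> y) \<in> lex \<longleftrightarrow> (x, y) \<in> lex"
proof (cases "x = y")
  case False
  have bij: "bij \<phi>" using \<phi> by (rule AutQ_bij)
  have ne: "node_map s w \<phi> x \<noteq> node_map s w \<phi> y"
    using False node_map_inv[OF bij] by metis
  have "trunc s x = trunc s y" if "d x y = s"
    using d_le_iff[OF x y, of s] that d_nonneg[of x y] by simp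
  then have "node_map s w \<phi> x (d x y) < node_map s w \<phi> y (d x y) \<longleftrightarrow> x (d x y) < y (d x y)"
    by (cases "d x y = s \<and> trunc s x = w") (auto simp: node_map_at node_map_other AutQ_less_iff[OF \<phi>])
  then show ?thesis
    unfolding lex_def using x y s ne False by (simp add: node_map_mem node_map_dist bij)
qed (simp add: lex_def)

text \<open>New factors enter on the right, so they act first, as the correction at the largest
  coordinate does in \<open>lex_homogeneous\<close>.\<close>

inductive_set node_group :: "((real \<Rightarrow> rat) \<Rightarrow> real \<Rightarrow> rat) set"
  where node_id: "id \<in> node_group"
  | node_step: "g \<in> node_group \<Longrightarrow> s \<in> S \<Longrightarrow> \<phi> \<in> AutQ \<Longrightarrow> g \<circ> node_map s w \<phi> \<in> node_group"

text \<open>By induction on the number of pairs of an index and a coordinate at which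
  \<open>p\<close> and \<open>q\<close> differ. Let \<open>t\<close> be the largest such coordinate.
  The points \<open>p j\<close> in one closed ball of radius \<open>t\<close> and the corresponding
  \<open>q j\<close> share that ball, and equality and order of their values at \<open>t\<close> can
  be read off from distances and from \<open>lex\<close>. So \<open>p j t\<close> determines
  \<open>q j t\<close> in a strictly increasing way, and a map at one node corrects all these values
  without creating new differences.\<close>

lemma lex_homogeneous:
  assumes "finite I"
    and "\<And>i. i \<in> I \<Longrightarrow> p i \<in> Q" "\<And>i. i \<in> I \<Longrightarrow> q i \<in> Q"
    and "\<And>i j. i \<in> I \<Longrightarrow> j \<in> I \<Longrightarrow> d (p i) (p j) = d (q i) (q j)"
    and "\<And>i j. i \<in> I \<Longrightarrow> j \<in> I \<Longrightarrow> (p i, p j) \<in> lex \<longleftrightarrow> (q i, q j) \<in> lex"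
  shows "\<exists>g\<in>node_group. \<forall>i\<in>I. g (p i) = q i"
proof -
  define diff where "diff p = {(i, t). i \<in> I \<and> p i t \<noteq> q i t}" for p
  have fin: "finite (diff p)" if "\<And>i. i \<in> I \<Longrightarrow> p i \<in> Q" for p
  proof (rule finite_subset)
    show "diff p \<subseteq> (SIGMA i:I. {t. p i t \<noteq> 0} \<union> {t. q i t \<noteq> 0})"
      by (auto simp: diff_def)
    show "finite \<dots>"
      using assms(1) assms(3) that by (intro finite_SigmaI) (auto simp: QS_carrier_def)
  qed
  show ?thesis
    using assms(2,4,5)
  proof (induction "card (diff p)" arbitrary: p rule: less_induct)
    case less
    note pq = less.prems
    show ?case
    proof (cases "diff p = {}")
      case True
      then have "p i = q i" if "i \<in> I" for i
        using that by (auto simp: diff_def fun_eq_iff)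
      then show ?thesis by (intro bexI[OF _ node_id]) simp
    next
      case False
      define t where "t = Max (snd ` diff p)"
      have fd: "finite (diff p)" using fin pq(1) by blast
      have "t \<in> snd ` diff p" using Max_in[of "snd ` diff p"] fd False by (simp add: t_def)
      then obtain i where i: "i \<in> I" "p i t \<noteq> q i t" by (auto simp: diff_def)
      have above: "p j u = q j u" if "j \<in> I" "u > t" for j u
      proof (rule ccontr)
        assume "p j u \<noteq> q j u"
        then have "u \<in> snd ` diff p" using that by (force simp: diff_def)
        then have "u \<le> t" unfolding t_def by (intro Max_ge finite_imageI fd)
        then show False using that by simp
      qed
      have tS: "t \<in> S"
      proof (rule ccontr)
        assume "t \<notin> S"
        then have "p i t = 0" "q i t = 0" using pq(1) assms(3) i by (auto simp: QS_carrier_def)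
        then show False using i by simp
      qed
      define w where "w = trunc t (p i)"
      define J where "J = {j\<in>I. trunc t (p j) = w}"
      have tq: "trunc t (q j) = w" if "j \<in> J" for j
        using that above by (auto simp: J_def trunc_def)
      have less: "q j t < q k t" if jk: "j \<in> J" "k \<in> J" "p j t < p k t" for j k
      proof -
        have I: "j \<in> I" "k \<in> I" using jk by (auto simp: J_def)
        have dt: "d (p j) (p k) = t"
          using jk by (intro d_eqI pq(1)) (auto simp: J_def)
        moreover have "(p j, p k) \<in> lex" using jk dt pq(1) I by (auto simp: lex_def)
        ultimately show ?thesis
          using pq(2,3)[OF I] by (auto simp: lex_def)
      qed
      have eq: "q j t = q k t" if jk: "j \<in> J" "k \<in> J" "p j t = p k t" for j k
      proof (rule ccontr)
        assume ne: "q j t \<noteq> q k t"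
        have I: "j \<in> I" "k \<in> I" using jk by (auto simp: J_def)
        have "d (q j) (q k) = t" using ne tq jk I assms(3) by (intro d_eqI) auto
        moreover have "d (p j) (p k) < t"
          using jk I pq(1) tS pos by (intro d_lessI) (auto simp: J_def)
        ultimately show False using pq(2)[OF I] by simp
      qed
      define f where "f a = q (SOME j. j \<in> J \<and> p j t = a) t" for a
      have f: "f (p j t) = q j t" if "j \<in> J" for j
        unfolding f_def using someI[of "\<lambda>k. k \<in> J \<and> p k t = p j t" j] that eq by blast
      have "finite ((\<lambda>j. p j t) ` J)" using assms(1) by (simp add: J_def)
      moreover have "strict_mono_on ((\<lambda>j. p j t) ` J) f"
        by (rule strict_mono_onI) (use f less in auto)
      ultimately obtain \<phi> where \<phi>: "\<phi> \<in> AutQ" "\<And>j. j \<in> J \<Longrightarrow> \<phi> (p j t) = q j t"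
        using strict_mono_on_extends_to_AutQ f by (metis image_eqI)
      define p' where "p' j = node_map t w \<phi> (p j)" for j
      have p'Q: "p' j \<in> Q" if "j \<in> I" for j
        using pq(1)[OF that] tS by (simp add: p'_def node_map_mem)
      have p'J: "p' j t = q j t" if "j \<in> J" for j
        using that \<phi>(2) by (simp add: p'_def J_def node_map_at)
      have p'o: "p' j u = p j u" if "j \<in> I" "j \<notin> J \<or> u \<noteq> t" for j u
        using that by (auto simp: p'_def J_def node_map_other)
      have iJ: "i \<in> J" using i by (simp add: J_def w_def)
      have "diff p' \<subset> diff p"
      proof (rule psubsetI)
        show "diff p' \<subseteq> diff p"
        proof clarify
          fix j u assume ju: "(j, u) \<in> diff p'"
          then have "\<not> (j \<in> J \<and> u = t)" using p'J by (auto simp: diff_def)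
          then show "(j, u) \<in> diff p" using ju p'o[of j u] by (auto simp: diff_def)
        qed
        have "(i, t) \<in> diff p - diff p'" using i p'J[OF iJ] by (auto simp: diff_def)
        then show "diff p' \<noteq> diff p" by blast
      qed
      then have "card (diff p') < card (diff p)" using fd psubset_card_mono by blast
      then obtain g where g: "g \<in> node_group" "\<forall>i\<in>I. g (p' i) = q i"
        using less.hyps[of p'] p'Q pq tS \<phi>(1)
        by (force simp: p'_def node_map_dist node_map_lex AutQ_bij)
      have "g \<circ> node_map t w \<phi> \<in> node_group" using g tS \<phi> by (intro node_step)
      then show ?thesis using g(2) by (intro bexI[of _ "g \<circ> node_map t w \<phi>"]) (auto simp: p'_def)
    qed
  qed
qed

end

section \<open>Convex orders on ultrametric spaces\<close>

text \<open>Along the inverse of an isometry this is the action on orders; along an isometric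
  embedding it is the restriction of an order to a subspace.\<close>

definition pullback_order :: "'a set \<Rightarrow> ('a \<Rightarrow> 'b) \<Rightarrow> ('b \<times> 'b) set \<Rightarrow> ('a \<times> 'a) set"
  where "pullback_order X k r = {(x, y). x \<in> X \<and> y \<in> X \<and> (k x, k y) \<in> r}"

text \<open>Convexity of all balls, restated as a condition on three points; for ultrametric spaces
  the equivalence is \<open>cLO_eq_convex_order\<close>. A violation of this form is visible on two
  pairs, which serves the proof of compactness.\<close>

definition convex_order :: "'a set \<Rightarrow> ('a \<Rightarrow> 'a \<Rightarrow> real) \<Rightarrow> ('a \<times> 'a) set \<Rightarrow> bool"
  where "convex_order X d r \<longleftrightarrow> r \<subseteq> X \<times> X \<and> strict_linear_order_on X r \<and>
    (\<forall>x\<in>X. \<forall>x'\<in>X. \<forall>y\<in>X. d x x' < d x y \<longrightarrow> (x, y) \<in> r \<longrightarrow> (x', y) \<in> r)"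

lemma convex_orderD:
  assumes "convex_order X d r"
  shows "r \<subseteq> X \<times> X" "(x, x) \<notin> r" "(x, y) \<in> r \<Longrightarrow> (y, z) \<in> r \<Longrightarrow> (x, z) \<in> r"
    "x \<in> X \<Longrightarrow> y \<in> X \<Longrightarrow> x \<noteq> y \<Longrightarrow> (x, y) \<in> r \<or> (y, x) \<in> r"
    "(x, y) \<in> r \<Longrightarrow> (y, x) \<notin> r"
  using assms unfolding convex_order_def strict_linear_order_on_def trans_def irrefl_def total_on_def
  by blast+

lemma convex_orderI:
  assumes "r \<subseteq> X \<times> X" "\<And>x. (x, x) \<notin> r" "\<And>x y z. (x, y) \<in> r \<Longrightarrow> (y, z) \<in> r \<Longrightarrow> (x, z) \<in> r"
    "\<And>x y. x \<in> X \<Longrightarrow> y \<in> X \<Longrightarrow> x \<noteq> y \<Longrightarrow> (x, y) \<in> r \<or> (y, x) \<in> r"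
    "\<And>x x' y. x \<in> X \<Longrightarrow> x' \<in> X \<Longrightarrow> y \<in> X \<Longrightarrow> d x x' < d x y \<Longrightarrow> (x, y) \<in> r \<Longrightarrow> (x', y) \<in> r"
  shows "convex_order X d r"
  unfolding convex_order_def strict_linear_order_on_def
proof (intro conjI)
  show "trans r" using assms(3) unfolding trans_def by blast
  show "irrefl r" using assms(2) unfolding irrefl_def by blast
  show "total_on X r" using assms(4) unfolding total_on_def by blast
qed (use assms(1,5) in blast)+

locale ultrametric =
  fixes X :: "'a set" and d :: "'a \<Rightarrow> 'a \<Rightarrow> real"
  assumes d_nonneg: "0 \<le> d x y"
    and d_comm: "d x y = d y x"
    and d_zero: "x \<in> X \<Longrightarrow> y \<in> X \<Longrightarrow> d x y = 0 \<longleftrightarrow> x = y"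
    and ultra: "x \<in> X \<Longrightarrow> y \<in> X \<Longrightarrow> z \<in> X \<Longrightarrow> d x z \<le> max (d x y) (d y z)"
begin

lemma d_isosceles: "x \<in> X \<Longrightarrow> x' \<in> X \<Longrightarrow> y \<in> X \<Longrightarrow> d x x' < d x y \<Longrightarrow> d x' y = d x y"
  using ultra[of x x' y] ultra[of x' x y] d_comm[of x x'] by auto

lemma d_isosceles2:
  assumes "x \<in> X" "x' \<in> X" "y \<in> X" "y' \<in> X" "d x x' < d x y" "d y y' < d x y"
  shows "d x' y' = d x y"
  using d_isosceles[of x x' y] d_isosceles[of y y' x'] assms d_comm by metis

text \<open>Convexity lets the smaller point move, and totality turns the pair round, so that the
  other point can move too. Hence only the open balls of radius \<open>d x y\<close> matter, which
  later allows points to be replaced by approximations from a dense set.\<close>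

lemma convex_order_move:
  assumes r: "convex_order X d r" and X: "x \<in> X" "x' \<in> X" "y \<in> X" "y' \<in> X"
    and d: "d x x' < d x y" "d y y' < d x y"
  shows "(x, y) \<in> r \<longleftrightarrow> (x', y') \<in> r"
proof -
  have move: "(v, b) \<in> r" if "u \<in> X" "v \<in> X" "b \<in> X" "d u v < d u b" "(u, b) \<in> r" for u v b
    using r that unfolding convex_order_def by blast
  have *: "(v, b) \<in> r \<longleftrightarrow> (u, b) \<in> r" if "u \<in> X" "v \<in> X" "b \<in> X" "d u v < d u b" for u v b
    using move[of u v b] move[of v u b] d_isosceles[of u v b] that d_comm[of u v] by metis
  have d': "d x' y = d x y" using d_isosceles X d by blast
  have ne: "x' \<noteq> y" "x' \<noteq> y'"
    using d' d_isosceles2[OF X d] d d_zero X d_nonneg[of x x'] by fastforce+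
  have "(x, y) \<in> r \<longleftrightarrow> (x', y) \<in> r" using *[of x x' y] X d by blast
  also have "\<dots> \<longleftrightarrow> (y, x') \<notin> r" using convex_orderD(4,5)[OF r] X ne by metis
  also have "\<dots> \<longleftrightarrow> (y', x') \<notin> r" using *[of y y' x'] X d d' d_comm by metis
  also have "\<dots> \<longleftrightarrow> (x', y') \<in> r" using convex_orderD(4,5)[OF r] X ne by metis
  finally show ?thesis .
qed

lemma convex_order_pullback:
  assumes r: "convex_order Y e r" and k: "k \<in> X \<rightarrow> Y"
    and iso: "\<And>x y. x \<in> X \<Longrightarrow> y \<in> X \<Longrightarrow> e (k x) (k y) = d x y"
    and e: "\<And>y. y \<in> Y \<Longrightarrow> e y y = 0"
  shows "convex_order X d (pullback_order X k r)"
proof (rule convex_orderI)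
  show "(x, y) \<in> pullback_order X k r \<or> (y, x) \<in> pullback_order X k r"
    if "x \<in> X" "y \<in> X" "x \<noteq> y" for x y
  proof -
    have "k x \<noteq> k y" using iso[of x y] d_zero[of x y] e[of "k y"] that k by force
    then show ?thesis using convex_orderD(4)[OF r, of "k x" "k y"] k that
      by (auto simp: pullback_order_def)
  qed
  show "(x', y) \<in> pullback_order X k r"
    if "x \<in> X" "x' \<in> X" "y \<in> X" "d x x' < d x y" "(x, y) \<in> pullback_order X k r" for x x' y
  proof -
    have "k x \<in> Y" "k x' \<in> Y" "k y \<in> Y" using k that by auto
    moreover have "e (k x) (k x') < e (k x) (k y)" using iso that by simp
    moreover have "(k x, k y) \<in> r" using that by (simp add: pullback_order_def)
    ultimately have "(k x', k y) \<in> r" using r unfolding convex_order_def by blast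
    then show ?thesis using that by (simp add: pullback_order_def)
  qed
qed (use convex_orderD(2,3)[OF r] in \<open>auto simp: pullback_order_def\<close>)

end

text \<open>The open ball around \<open>x\<close> of radius \<open>d x y\<close> contains
  \<open>x\<close> and \<open>x'\<close> but not \<open>y\<close>, so if it is convex,
  \<open>y\<close> is on the same side of both. Conversely, two points of a ball are closer to each
  other than to any point outside it, which therefore cannot lie between them.\<close>

lemma cLO_eq_convex_order:
  assumes "ultrametric (mspace m) (mdist m)"
  shows "cLO m = {r. convex_order (mspace m) (mdist m) r}"
proof -
  interpret ultrametric "mspace m" "mdist m" by fact
  let ?X = "mspace m" and ?d = "mdist m"
  have ball: "y \<in> mball_of m x \<epsilon> \<longleftrightarrow> x \<in> ?X \<and> y \<in> ?X \<and> ?d x y < \<epsilon>"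
    and cball: "y \<in> mcball_of m x \<epsilon> \<longleftrightarrow> x \<in> ?X \<and> y \<in> ?X \<and> ?d x y \<le> \<epsilon>" for x y \<epsilon>
    by (auto simp: mball_of_def mcball_of_def Metric_space.in_mball[OF Metric_space_mspace_mdist]
        Metric_space.in_mcball[OF Metric_space_mspace_mdist])
  have "convex_order ?X ?d r" if "r \<in> cLO m" for r
  proof -
    have lin: "r \<subseteq> ?X \<times> ?X" "strict_linear_order_on ?X r"
      and cv: "\<And>x \<epsilon>. x \<in> ?X \<Longrightarrow> order_convex_in ?X r (mball_of m x \<epsilon>)"
      using that by (auto simp: cLO_def)
    have "(x', y) \<in> r" if x: "x \<in> ?X" "x' \<in> ?X" "y \<in> ?X" "?d x x' < ?d x y" "(x, y) \<in> r" for x x' y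
    proof (rule ccontr)
      assume "(x', y) \<notin> r"
      moreover have "x' \<noteq> y" using x by auto
      ultimately have "(y, x') \<in> r"
        using lin(2) x unfolding strict_linear_order_on_def total_on_def by blast
      moreover have "?d x x < ?d x y"
        using le_less_trans[OF d_nonneg[of x x'] x(4)] d_zero[OF x(1) x(1)] by simp
      then have "x \<in> mball_of m x (?d x y)" "x' \<in> mball_of m x (?d x y)"
        using x by (simp_all add: ball)
      ultimately have "y \<in> mball_of m x (?d x y)"
        using cv[OF x(1)] x(3,5) unfolding order_convex_in_def by blast
      then show False by (simp add: ball)
    qed
    then show ?thesis using lin unfolding convex_order_def by blast
  qed
  moreover have "r \<in> cLO m" if r: "convex_order ?X ?d r" for r
  proof -
    \<comment> \<open>The property assumed of \<open>K\<close> is common to open and closed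
      balls.\<close>
    have cvx: "order_convex_in ?X r K"
      if K: "K \<subseteq> ?X" "\<And>x y z. x \<in> K \<Longrightarrow> z \<in> K \<Longrightarrow> y \<in> ?X \<Longrightarrow> ?d x y \<le> ?d x z \<Longrightarrow> y \<in> K" for K
      unfolding order_convex_in_def
    proof (intro ballI impI, rule ccontr)
      fix x z y assume *: "x \<in> K" "z \<in> K" "y \<in> ?X" "(x, y) \<in> r \<and> (y, z) \<in> r" "y \<notin> K"
      then have "?d x z < ?d x y" using K(2)[of x z y] by force
      then have "(z, y) \<in> r" using r * K(1) unfolding convex_order_def by blast
      then show False using convex_orderD(5)[OF r] * by blast
    qed
    have mb: "y \<in> mball_of m c \<epsilon>"
      if "x \<in> mball_of m c \<epsilon>" "z \<in> mball_of m c \<epsilon>" "y \<in> ?X" "?d x y \<le> ?d x z" for x y z c \<epsilon>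
      using that ultra[of c x y] ultra[of x c z] d_comm[of c x] by (auto simp: ball)
    have mc: "y \<in> mcball_of m c \<epsilon>"
      if "x \<in> mcball_of m c \<epsilon>" "z \<in> mcball_of m c \<epsilon>" "y \<in> ?X" "?d x y \<le> ?d x z" for x y z c \<epsilon>
      using that ultra[of c x y] ultra[of x c z] d_comm[of c x] by (auto simp: cball)
    have "order_convex_in ?X r (mball_of m x \<epsilon>)" for x \<epsilon>
      by (rule cvx[OF _ mb]) (auto simp: ball)
    moreover have "order_convex_in ?X r (mcball_of m x \<epsilon>)" for x \<epsilon>
      by (rule cvx[OF _ mc]) (auto simp: cball)
    ultimately show ?thesis using r unfolding cLO_def convex_order_def by blast
  qed
  ultimately show ?thesis by blast
qed


section \<open>Matching two convex orders on a finite set\<close>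

text \<open>Induction on the size, matching the maxima \<open>a\<close> and \<open>b\<close>
  first.\<close>

lemma finite_linear_orders_isomorphic:
  assumes "finite A" "finite B" "card A = card B"
    "transp R" "irreflp R" "totalp R" "transp R'" "irreflp R'" "totalp R'"
  shows "\<exists>f. bij_betw f A B \<and> (\<forall>a\<in>A. \<forall>b\<in>A. R (f a) (f b) \<longleftrightarrow> R' a b)"
  using assms(1-3)
proof (induction "card A" arbitrary: A B)
  case 0
  then have "A = {}" "B = {}" by auto
  then show ?case by (simp add: bij_betw_def)
next
  case (Suc n)
  have ne: "A \<noteq> {}" "B \<noteq> {}" using Suc by auto
  have as: "asymp_on B R" "asymp_on A R'"
    using assms(4-9) by (meson asymp_on_iff_irreflp_on_if_transp_on asymp_on_subset subset_UNIV)+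
  have tr: "transp_on B R" "transp_on A R'"
    using assms(4,7) by (meson transp_on_subset subset_UNIV)+
  obtain a where a: "a \<in> A" "\<And>x. x \<in> A \<Longrightarrow> x \<noteq> a \<Longrightarrow> \<not> R' a x"
    using Finite_Set.bex_max_element[OF Suc.prems(1) as(2) tr(2) ne(1)] by blast
  obtain b where b: "b \<in> B" "\<And>x. x \<in> B \<Longrightarrow> x \<noteq> b \<Longrightarrow> \<not> R b x"
    using Finite_Set.bex_max_element[OF Suc.prems(2) as(1) tr(1) ne(2)] by blast
  have "n = card (A - {a})" "card (A - {a}) = card (B - {b})"
    using Suc a b by simp_all
  then obtain f where f: "bij_betw f (A - {a}) (B - {b})"
    "\<forall>x\<in>A-{a}. \<forall>y\<in>A-{a}. R (f x) (f y) \<longleftrightarrow> R' x y"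
    using Suc.hyps(1)[of "A - {a}" "B - {b}"] Suc.prems by auto
  let ?f = "f(a := b)"
  have fB: "f x \<in> B \<and> f x \<noteq> b" if "x \<in> A" "x \<noteq> a" for x
    using f(1) that by (auto simp: bij_betw_def)
  have "bij_betw ?f (A - {a}) (B - {b})"
    using f(1) by (rule bij_betw_cong[THEN iffD1, rotated]) auto
  then have "bij_betw ?f (insert a (A - {a})) (insert b (B - {b}))"
    using notIn_Un_bij_betw3[of a "A - {a}" ?f "B - {b}"] by auto
  then have bij: "bij_betw ?f A B" using a b by (simp add: insert_absorb)
  have iso: "R (?f x) (?f y) \<longleftrightarrow> R' x y" if xy: "x \<in> A" "y \<in> A" for x y
  proof -
    have irr: "\<not> R u u" for u using assms(5) by (auto dest: irreflpD)
    have irr': "\<not> R' u u" for u using assms(8) by (auto dest: irreflpD)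
    consider "x = a" "y = a" | "x = a" "y \<noteq> a" | "x \<noteq> a" "y = a" | "x \<noteq> a" "y \<noteq> a" by blast
    then show ?thesis
    proof cases
      case 1
      then show ?thesis using irr irr' by simp
    next
      case 2
      then show ?thesis using a(2)[of y] b(2)[of "f y"] fB[of y] xy by auto
    next
      case 3
      have "R (f x) b"
        using totalpD[OF assms(6), of "f x" b] b(2)[of "f x"] fB[OF xy(1) 3(1)] by blast
      moreover have "R' x a" using totalpD[OF assms(9) 3(1)] a(2)[OF xy(1) 3(1)] by blast
      ultimately show ?thesis using 3 by simp
    next
      case 4
      then show ?thesis using f(2) xy by simp
    qed
  qed
  show ?case by (rule exI[of _ ?f], intro conjI ballI bij iso)
qed

text \<open>The permutation of \<open>A\<close> is continued by the identity, since
  \<open>level_map_bij\<close> asks for bijections of all rationals.\<close>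

lemma finite_linear_orders_permutation:
  fixes R R' :: "'a \<Rightarrow> 'a \<Rightarrow> bool"
  assumes "finite A"
    "transp R" "irreflp R" "totalp R" "transp R'" "irreflp R'" "totalp R'"
  shows "\<exists>f. bij f \<and> (\<forall>a\<in>A. \<forall>b\<in>A. R (f a) (f b) \<longleftrightarrow> R' a b)"
proof -
  obtain f where f: "bij_betw f A A" "\<forall>a\<in>A. \<forall>b\<in>A. R (f a) (f b) \<longleftrightarrow> R' a b"
    using finite_linear_orders_isomorphic[OF assms(1,1) refl assms(2-)] by blast
  let ?f = "\<lambda>x. if x \<in> A then f x else x"
  have "bij_betw ?f (A \<union> - A) (A \<union> - A)"
    by (rule bij_betw_combine) (use f(1) in \<open>auto simp: bij_betw_def inj_on_def\<close>)
  then have "bij ?f" by (simp add: Compl_partition)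
  then show ?thesis using f(2) by (intro exI[of _ ?f]) simp
qed

context level_set
begin

lemma ultrametric_QS: "ultrametric Q d"
  by standard (auto simp: d_nonneg d_zero ultra intro: d_comm)

sublocale U: ultrametric Q d
  by (rule ultrametric_QS)

lemma lex_convex: "convex_order Q d lex"
proof (rule convex_orderI)
  show "(x, z) \<in> lex" if "(x, y) \<in> lex" "(y, z) \<in> lex" for x y z
  proof -
    have Q: "x \<in> Q" "y \<in> Q" "z \<in> Q" "x \<noteq> y" "y \<noteq> z" and l: "x (d x y) < y (d x y)" "y (d y z) < z (d y z)"
      using that by (auto simp: lex_def)
    note pr = QS_dist_properties(3)[OF Q(1,2,4)] QS_dist_properties(3)[OF Q(2,3,5)]
    define t where "t = max (d x y) (d y z)"
    have lt: "x t < z t"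
      using l pr[of t] unfolding t_def
      by (cases "d x y" "d y z" rule: linorder_cases) (auto simp: max_def)
    have "d x z = t"
      using pr lt by (intro d_eqI Q) (auto simp: t_def trunc_eq_iff)
    then show ?thesis using lt Q by (auto simp: lex_def)
  qed
  show "(x, y) \<in> lex \<or> (y, x) \<in> lex" if "x \<in> Q" "y \<in> Q" "x \<noteq> y" for x y
    using QS_dist_properties(2)[OF that] that d_comm[of x y] by (auto simp: lex_def)
  show "(x', y) \<in> lex" if "x \<in> Q" "x' \<in> Q" "y \<in> Q" "d x x' < d x y" "(x, y) \<in> lex" for x x' y
  proof -
    have "d x' y = d x y" using U.d_isosceles that by blast
    moreover have "x (d x y) = x' (d x y)"
      using QS_dist_properties(3)[of x S x'] that by (cases "x = x'") auto
    moreover have "x' \<noteq> y" using that by auto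
    ultimately show ?thesis using that by (auto simp: lex_def)
  qed
qed (auto simp: lex_def)

text \<open>Cutting off the coordinates below \<open>t\<close> moves either point by less than
  \<open>t\<close>, which \<open>convex_order_move\<close> permits. So within a closed ball of
  radius \<open>t\<close>, the order of points at distance \<open>t\<close> comes from a linear
  order of the rationals.\<close>

lemma convex_order_move_update:
  assumes r: "convex_order Q d r" and xy: "x \<in> Q" "y \<in> Q" "d x y = t" "x \<noteq> y"
    and w: "trunc t x = w"
  shows "(x, y) \<in> r \<longleftrightarrow> (w(t := x t), w(t := y t)) \<in> r"
proof (rule U.convex_order_move[OF r])
  have t: "t \<in> S" "t > 0" using d_mem[OF xy(1,2,4)] xy(3) pos by auto
  have w': "trunc t y = w" using d_le_iff[OF xy(1,2), of t] xy(3) t w by simp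
  show Q: "w(t := x t) \<in> Q" "w(t := y t) \<in> Q"
    using xy t w by (auto intro: update_mem trunc_mem)
  have ww: "trunc t (w(t := a)) = w" for a
    unfolding w[symmetric] by (auto simp: trunc_def fun_eq_iff)
  show "d x (w(t := x t)) < d x y" "d y (w(t := y t)) < d x y"
    unfolding xy(3) using xy Q t w w' ww by (auto intro!: d_lessI)
qed (use xy in auto)

text \<open>The levels at which the two orders disagree on \<open>P\<close> are treated from the largest to the
  smallest: a permutation of the values at one level has no effect on pairs at larger distance.\<close>

lemma convex_orders_match:
  assumes "finite P" "P \<subseteq> Q" "convex_order Q d r" "convex_order Q d r'"
  shows "\<exists>k. bij_betw k Q Q \<and> (\<forall>x\<in>Q. \<forall>y\<in>Q. d (k x) (k y) = d x y) \<and>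
    (\<forall>x\<in>P. \<forall>y\<in>P. (k x, k y) \<in> r \<longleftrightarrow> (x, y) \<in> r')"
proof -
  \<comment> \<open>\<open>T\<close> holds the distances at which the orders may still disagree. It
    is closed downwards among the distances of distinct points of \<open>P\<close>, because a repair
    at level \<open>t\<close> may create disagreements at smaller distances.\<close>
  have main: "\<exists>k. bij_betw k Q Q \<and> (\<forall>x\<in>Q. \<forall>y\<in>Q. d (k x) (k y) = d x y) \<and>
    (\<forall>x\<in>P. \<forall>y\<in>P. (k x, k y) \<in> r \<longleftrightarrow> (x, y) \<in> r')"
    if "finite T" "convex_order Q d r"
      "\<And>x y. x \<in> P \<Longrightarrow> y \<in> P \<Longrightarrow> (x, y) \<in> r \<longleftrightarrow> (x, y) \<notin> r' \<Longrightarrow> d x y \<in> T"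
      "\<And>x y t. x \<in> P \<Longrightarrow> y \<in> P \<Longrightarrow> x \<noteq> y \<Longrightarrow> t \<in> T \<Longrightarrow> d x y \<le> t \<Longrightarrow> d x y \<in> T" for T r
    using that
  proof (induction T arbitrary: r rule: finite_linorder_max_induct)
    case empty
    have "bij_betw id Q Q" by (rule bij_betw_id)
    moreover have "(x, y) \<in> r \<longleftrightarrow> (x, y) \<in> r'" if "x \<in> P" "y \<in> P" for x y
      using empty(2)[OF that] by blast
    ultimately show ?case by (metis id_apply)
  next
    case (insert t T)
    note r = insert.prems(1)
    have down: "d x y \<in> T" if "x \<in> P" "y \<in> P" "x \<noteq> y" "u \<in> T" "d x y \<le> u" for x y u
      using insert.prems(3)[of x y u] insert.hyps(2) that by force
    show ?case
    proof (cases "t \<in> S")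
      \<comment> \<open>Such a \<open>t\<close> is not a distance of distinct points. This disposes
        of \<open>0\<close>, which enters \<open>T\<close> through pairs of equal points.\<close>
      case False
      show ?thesis
      proof (rule insert.IH[OF r _ down])
        fix x y assume xy: "x \<in> P" "y \<in> P" "(x, y) \<in> r \<longleftrightarrow> (x, y) \<notin> r'"
        then have "x \<noteq> y" using convex_orderD(2)[OF r] convex_orderD(2)[OF assms(4)] by blast
        then have "d x y \<in> S" using d_mem xy assms(2) by blast
        then show "d x y \<in> T" using insert.prems(2)[OF xy] False by auto
      qed
    next
      case True
      then have t0: "t > 0" using pos by auto
      define A where "A = (\<lambda>x. x t) ` P"
      have lin: "transp (\<lambda>a b. (w(t := a), w(t := b)) \<in> \<rho>)" "irreflp (\<lambda>a b. (w(t := a), w(t := b)) \<in> \<rho>)"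
        "totalp (\<lambda>a b. (w(t := a), w(t := b)) \<in> \<rho>)"
        if "convex_order Q d \<rho>" "w \<in> Q" for w \<rho>
      proof -
        have ne: "w(t := a) \<noteq> w(t := b)" if "a \<noteq> b" for a b
          using that by (metis fun_upd_same)
        show "transp (\<lambda>a b. (w(t := a), w(t := b)) \<in> \<rho>)"
          by (rule transpI) (use convex_orderD(3)[OF that(1)] in blast)
        show "irreflp (\<lambda>a b. (w(t := a), w(t := b)) \<in> \<rho>)"
          by (rule irreflpI) (use convex_orderD(2)[OF that(1)] in blast)
        show "totalp (\<lambda>a b. (w(t := a), w(t := b)) \<in> \<rho>)"
          by (rule totalpI) (use convex_orderD(4)[OF that(1)] update_mem[OF that(2) True] ne in blast)
      qed
      have fA: "finite A" using assms(1) by (simp add: A_def)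
      \<comment> \<open>For each \<open>w\<close> in \<open>Q\<close> the rationals carry two linear
        orders, induced by \<open>r\<close> and \<open>r'\<close> through the coordinate
        \<open>t\<close>; a permutation matches them on the finite set \<open>A\<close> of values
        that occur. Outside \<open>Q\<close> any bijection will do.\<close>
      have "\<exists>f. bij f \<and> (w \<in> Q \<longrightarrow> (\<forall>a\<in>A. \<forall>b\<in>A.
          (w(t := f a), w(t := f b)) \<in> r \<longleftrightarrow> (w(t := a), w(t := b)) \<in> r'))" for w
        using finite_linear_orders_permutation[OF fA lin[OF r, of w] lin[OF assms(4), of w]] bij_id by metis
      then obtain \<pi> where \<pi>: "\<And>w. bij (\<pi> w)"
        "\<And>w a b. w \<in> Q \<Longrightarrow> a \<in> A \<Longrightarrow> b \<in> A \<Longrightarrow>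
          (w(t := \<pi> w a), w(t := \<pi> w b)) \<in> r \<longleftrightarrow> (w(t := a), w(t := b)) \<in> r'"
        by metis
      define k1 where "k1 = level_map t \<pi>"
      have k1: "bij_betw k1 Q Q" and k1d: "\<And>x y. x \<in> Q \<Longrightarrow> y \<in> Q \<Longrightarrow> d (k1 x) (k1 y) = d x y"
        using level_map_bij level_map_dist True \<pi>(1) unfolding k1_def by blast+
      have k1Q: "k1 x \<in> Q" if "x \<in> Q" for x
        using level_map_mem True that by (simp add: k1_def)
      \<comment> \<open>Points move by at most \<open>t\<close>, so pairs at distance above
        \<open>t\<close> keep their order.\<close>
      have near: "d x (k1 x) \<le> t" if "x \<in> Q" for x
        using that k1Q[OF that] t0 by (subst d_le_iff) (auto simp: k1_def)
      define r1 where "r1 = pullback_order Q k1 r"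
      have r1: "convex_order Q d r1"
        unfolding r1_def by (rule U.convex_order_pullback[OF r]) (auto simp: k1Q k1d d_self)
      have bad: "d x y \<in> T" if xy: "x \<in> P" "y \<in> P" "(x, y) \<in> r1 \<longleftrightarrow> (x, y) \<notin> r'" for x y
      proof -
        have Q: "x \<in> Q" "y \<in> Q" using xy assms(2) by auto
        have ne: "x \<noteq> y"
          using xy(3) convex_orderD(2)[OF r1] convex_orderD(2)[OF assms(4)] by blast
        have r1xy: "(x, y) \<in> r1 \<longleftrightarrow> (k1 x, k1 y) \<in> r" using Q by (simp add: r1_def pullback_order_def)
        consider "d x y < t" | "d x y = t" | "d x y > t" by linarith
        then show ?thesis
        proof cases
          case 1
          then have "d x y \<in> insert t T" using insert.prems(3)[of x y t] xy ne by auto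
          then show ?thesis using 1 by auto
        next
          case 2
          define w where "w = trunc t x"
          have w: "w \<in> Q" using Q True by (simp add: w_def trunc_mem)
          have w': "trunc t y = w" using d_le_iff[OF Q, of t] 2 t0 by (simp add: w_def)
          have "(k1 x, k1 y) \<in> r \<longleftrightarrow> (w(t := k1 x t), w(t := k1 y t)) \<in> r"
          proof (rule convex_order_move_update[OF r])
            show "k1 x \<noteq> k1 y" using k1 Q ne by (auto simp: bij_betw_def inj_on_def)
          qed (use Q k1Q k1d 2 in \<open>auto simp: k1_def w_def\<close>)
          also have "\<dots> \<longleftrightarrow> (w(t := x t), w(t := y t)) \<in> r'"
            using \<pi>(2)[OF w, of "x t" "y t"] xy w' by (simp add: A_def k1_def level_map_at w_def)
          also have "\<dots> \<longleftrightarrow> (x, y) \<in> r'"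
            by (rule convex_order_move_update[OF assms(4) Q 2 ne, symmetric]) (simp add: w_def)
          finally show ?thesis using r1xy xy(3) by blast
        next
          case 3
          have "(x, y) \<in> r \<longleftrightarrow> (k1 x, k1 y) \<in> r"
            by (rule U.convex_order_move[OF r]) (use Q k1Q near[OF Q(1)] near[OF Q(2)] 3 in auto)
          then have "d x y \<in> insert t T" using insert.prems(2)[of x y] xy r1xy by blast
          then show ?thesis using 3 by auto
        qed
      qed
      have "\<exists>k. bij_betw k Q Q \<and> (\<forall>x\<in>Q. \<forall>y\<in>Q. d (k x) (k y) = d x y) \<and>
          (\<forall>x\<in>P. \<forall>y\<in>P. (k x, k y) \<in> r1 \<longleftrightarrow> (x, y) \<in> r')"
        by (rule insert.IH[OF r1 bad down])
      then obtain k where k: "bij_betw k Q Q" "\<forall>x\<in>Q. \<forall>y\<in>Q. d (k x) (k y) = d x y"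
        "\<forall>x\<in>P. \<forall>y\<in>P. (k x, k y) \<in> r1 \<longleftrightarrow> (x, y) \<in> r'"
        by (elim exE conjE) (rule that)
      have kQ: "k x \<in> Q" if "x \<in> Q" for x using k(1) that by (auto simp: bij_betw_def)
      show ?thesis
      proof (intro exI[of _ "k1 \<circ> k"] conjI ballI)
        show "bij_betw (k1 \<circ> k) Q Q" using k(1) k1 by (rule bij_betw_trans)
        show "d ((k1 \<circ> k) x) ((k1 \<circ> k) y) = d x y" if "x \<in> Q" "y \<in> Q" for x y
          using k(2) kQ k1d that by simp
        show "((k1 \<circ> k) x, (k1 \<circ> k) y) \<in> r \<longleftrightarrow> (x, y) \<in> r'" if "x \<in> P" "y \<in> P" for x y
          using k(3) kQ that assms(2) by (auto simp: r1_def pullback_order_def subset_iff)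
      qed
    qed
  qed
  define T where "T = (\<lambda>(x, y). d x y) ` (P \<times> P)"
  have T: "finite T" "\<And>x y. x \<in> P \<Longrightarrow> y \<in> P \<Longrightarrow> d x y \<in> T"
    using assms(1) by (auto simp: T_def)
  show ?thesis by (rule main[OF T(1) assms(3) T(2) T(2)])
qed

end

section \<open>Isometry groups as topological groups\<close>

lemma isometriesD:
  assumes "g \<in> isometries m"
  shows "g \<in> extensional (mspace m)" "bij_betw g (mspace m) (mspace m)" "inj_on g (mspace m)"
    "g ` mspace m = mspace m"
    "x \<in> mspace m \<Longrightarrow> g x \<in> mspace m"
    "x \<in> mspace m \<Longrightarrow> y \<in> mspace m \<Longrightarrow> mdist m (g x) (g y) = mdist m x y"
    "x \<in> mspace m \<Longrightarrow> inv_into (mspace m) g x \<in> mspace m"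
    "x \<in> mspace m \<Longrightarrow> g (inv_into (mspace m) g x) = x"
    "x \<in> mspace m \<Longrightarrow> inv_into (mspace m) g (g x) = x"
proof -
  have g: "g \<in> Bij (mspace m)" "\<And>x y. x \<in> mspace m \<Longrightarrow> y \<in> mspace m \<Longrightarrow> mdist m (g x) (g y) = mdist m x y"
    using assms by (auto simp: isometries_def)
  show "g \<in> extensional (mspace m)" "bij_betw g (mspace m) (mspace m)"
    using g(1) by (auto simp: Bij_def)
  then show inj: "inj_on g (mspace m)" and im: "g ` mspace m = mspace m"
    by (auto simp: bij_betw_def)
  show "x \<in> mspace m \<Longrightarrow> g x \<in> mspace m" using im by blast
  show "x \<in> mspace m \<Longrightarrow> y \<in> mspace m \<Longrightarrow> mdist m (g x) (g y) = mdist m x y" by (rule g(2))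
  show "x \<in> mspace m \<Longrightarrow> inv_into (mspace m) g x \<in> mspace m"
    using im by (metis inv_into_into)
  show "x \<in> mspace m \<Longrightarrow> g (inv_into (mspace m) g x) = x"
    using im by (metis f_inv_into_f)
  show "x \<in> mspace m \<Longrightarrow> inv_into (mspace m) g (g x) = x"
    using inj by (rule inv_into_f_f)
qed

lemma restrict_isometry:
  assumes "bij_betw g (mspace m) (mspace m)"
    "\<And>x y. x \<in> mspace m \<Longrightarrow> y \<in> mspace m \<Longrightarrow> mdist m (g x) (g y) = mdist m x y"
  shows "restrict g (mspace m) \<in> isometries m"
  using assms by (simp add: isometries_def Bij_def)

lemma restrict_inv_isometry:
  assumes "g \<in> isometries m"
  shows "restrict (inv_into (mspace m) g) (mspace m) \<in> isometries m"
proof (rule restrict_isometry)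
  note g = isometriesD[OF assms]
  show "bij_betw (inv_into (mspace m) g) (mspace m) (mspace m)"
    using g(2) by (rule bij_betw_inv_into)
  show "mdist m (inv_into (mspace m) g x) (inv_into (mspace m) g y) = mdist m x y"
    if "x \<in> mspace m" "y \<in> mspace m" for x y
    using g(6)[OF g(7) g(7)] g(8) that by metis
qed

lemma compose_isometry:
  assumes "g \<in> isometries m" "h \<in> isometries m"
  shows "compose (mspace m) g h \<in> isometries m"
  using assms isometriesD(5)[OF assms(2)] by (simp add: isometries_def compose_Bij compose_eq)

lemma carrier_iso_group [simp]: "carrier (iso_group m) = isometries m"
  by (simp add: iso_group_def)

lemma mult_iso_group:
  "g \<in> isometries m \<Longrightarrow> h \<in> isometries m \<Longrightarrow> g \<otimes>\<^bsub>iso_group m\<^esub> h = compose (mspace m) g h"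
  by (simp add: iso_group_def BijGroup_def isometries_def)

lemma one_iso_group: "\<one>\<^bsub>iso_group m\<^esub> = (\<lambda>x\<in>mspace m. x)"
  by (simp add: iso_group_def BijGroup_def)

lemma subgroup_isometries: "subgroup (isometries m) (BijGroup (mspace m))"
proof (rule group.subgroupI[OF group_BijGroup])
  show "isometries m \<subseteq> carrier (BijGroup (mspace m))"
    by (auto simp: isometries_def BijGroup_def)
  have "restrict (\<lambda>x. x) (mspace m) \<in> isometries m"
    by (rule restrict_isometry) (auto simp: bij_betw_def)
  then show "isometries m \<noteq> {}" by blast
  show "inv\<^bsub>BijGroup (mspace m)\<^esub> g \<in> isometries m" if "g \<in> isometries m" for g
    using restrict_inv_isometry[OF that] that by (simp add: inv_BijGroup isometries_def)
  show "g \<otimes>\<^bsub>BijGroup (mspace m)\<^esub> h \<in> isometries m" if "g \<in> isometries m" "h \<in> isometries m" for g h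
    using compose_isometry[OF that] that by (simp add: BijGroup_def isometries_def)
qed

lemma group_iso_group: "group (iso_group m)"
  unfolding iso_group_def by (rule subgroup.subgroup_is_group[OF subgroup_isometries group_BijGroup])

lemma inv_iso_group:
  "g \<in> isometries m \<Longrightarrow> inv\<^bsub>iso_group m\<^esub> g = restrict (inv_into (mspace m) g) (mspace m)"
  unfolding iso_group_def group.m_inv_consistent[OF group_BijGroup subgroup_isometries]
  by (rule inv_BijGroup) (simp add: isometries_def)

lemma continuous_map_prodI:
  assumes "\<And>x y. x \<in> topspace X \<Longrightarrow> y \<in> topspace Y \<Longrightarrow> f x y \<in> topspace Z"
    and "\<And>U x y. openin Z U \<Longrightarrow> x \<in> topspace X \<Longrightarrow> y \<in> topspace Y \<Longrightarrow> f x y \<in> U \<Longrightarrow>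
      \<exists>V W. openin X V \<and> openin Y W \<and> x \<in> V \<and> y \<in> W \<and> (\<forall>x'\<in>V. \<forall>y'\<in>W. f x' y' \<in> U)"
  shows "continuous_map (prod_topology X Y) Z (\<lambda>(x, y). f x y)"
  unfolding continuous_map_def
proof (intro conjI allI impI)
  show "(\<lambda>(x, y). f x y) \<in> topspace (prod_topology X Y) \<rightarrow> topspace Z"
    using assms(1) by auto
  fix U assume U: "openin Z U"
  show "openin (prod_topology X Y) {p \<in> topspace (prod_topology X Y). (case p of (x, y) \<Rightarrow> f x y) \<in> U}"
    unfolding openin_prod_topology_alt
  proof (intro allI impI)
    fix x y assume "(x, y) \<in> {p \<in> topspace (prod_topology X Y). (case p of (x, y) \<Rightarrow> f x y) \<in> U}"
    then have xy: "x \<in> topspace X" "y \<in> topspace Y" "f x y \<in> U" by auto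
    obtain V W where VW: "openin X V" "openin Y W" "x \<in> V" "y \<in> W" "\<forall>x'\<in>V. \<forall>y'\<in>W. f x' y' \<in> U"
      using assms(2)[OF U xy] by blast
    then have "V \<times> W \<subseteq> {p \<in> topspace (prod_topology X Y). (case p of (x, y) \<Rightarrow> f x y) \<in> U}"
      using openin_subset[OF VW(1)] openin_subset[OF VW(2)] by auto
    then show "\<exists>V W. openin X V \<and> openin Y W \<and> x \<in> V \<and> y \<in> W \<and>
        V \<times> W \<subseteq> {p \<in> topspace (prod_topology X Y). (case p of (x, y) \<Rightarrow> f x y) \<in> U}"
      using VW by blast
  qed
qed

text \<open>With \<open>disc\<close> true this is closeness in the discrete topology, so that both topologies on
  isometry groups can be treated at once.\<close>

definition near :: "bool \<Rightarrow> 'a metric \<Rightarrow> real \<Rightarrow> 'a \<Rightarrow> 'a \<Rightarrow> bool"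
  where "near disc m \<epsilon> x y \<longleftrightarrow> x = y \<or> (\<not> disc \<and> mdist m x y < \<epsilon>)"

text \<open>The assumption makes \<open>T\<close> the metric topology or the discrete one, according
  to \<open>disc\<close>. Because of the ultrametric inequality, \<open>near\<close> at a fixed
  radius is an equivalence relation on the space, so that no radius ever has to be halved.\<close>

locale near_space = ultrametric "mspace m" "mdist m" for m :: "'a metric" +
  fixes T :: "'a topology" and disc :: bool
  assumes openin_T: "openin T U \<longleftrightarrow> U \<subseteq> mspace m \<and>
    (\<forall>x\<in>U. \<exists>\<epsilon>>0. \<forall>y\<in>mspace m. near disc m \<epsilon> x y \<longrightarrow> y \<in> U)"
begin

abbreviation "X \<equiv> mspace m"
abbreviation "G \<equiv> isometries m"

lemma topspace_T: "topspace T = X"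
proof
  show "topspace T \<subseteq> X" using openin_T[of "topspace T"] by simp
  have "openin T X" unfolding openin_T by (auto intro: exI[of _ 1])
  then show "X \<subseteq> topspace T" by (rule openin_subset)
qed

lemma near_refl: "near disc m \<epsilon> x x"
  by (simp add: near_def)

lemma near_sym: "near disc m \<epsilon> x y \<Longrightarrow> near disc m \<epsilon> y x"
  by (auto simp: near_def d_comm)

lemma near_trans:
  "x \<in> X \<Longrightarrow> y \<in> X \<Longrightarrow> z \<in> X \<Longrightarrow> near disc m \<epsilon> x y \<Longrightarrow> near disc m \<epsilon> y z \<Longrightarrow> near disc m \<epsilon> x z"
  using ultra[of x y z] by (auto simp: near_def)

lemma near_mono: "\<epsilon> \<le> \<epsilon>' \<Longrightarrow> near disc m \<epsilon> x y \<Longrightarrow> near disc m \<epsilon>' x y"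
  by (auto simp: near_def)

lemma near_dist:
  assumes "near disc m \<epsilon> x y" "x \<in> X" "\<epsilon> > 0"
  shows "mdist m x y < \<epsilon>"
proof -
  have "mdist m x x = 0" using d_zero assms(2) by blast
  then show ?thesis using assms by (metis near_def)
qed

lemma near_iso: "g \<in> G \<Longrightarrow> x \<in> X \<Longrightarrow> y \<in> X \<Longrightarrow> near disc m \<epsilon> (g x) (g y) \<longleftrightarrow> near disc m \<epsilon> x y"
  using isometriesD(3)[of g m] isometriesD(6)[of g m x y] by (auto simp: near_def inj_on_def)

lemma near_eqI:
  assumes "x \<in> X" "y \<in> X" "\<And>\<epsilon>. \<epsilon> > 0 \<Longrightarrow> near disc m \<epsilon> x y"
  shows "x = y"
proof (rule ccontr)
  assume "x \<noteq> y"
  then have "mdist m x y > 0" using d_zero[OF assms(1,2)] d_nonneg[of x y] by linarith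
  then show False using near_dist[OF assms(3)[of "mdist m x y"] assms(1)] by auto
qed

lemma openin_near_ball:
  assumes "x \<in> X" "\<epsilon> > 0"
  shows "openin T {y\<in>X. near disc m \<epsilon> x y}"
  unfolding openin_T
  using assms near_trans[of x] by blast

lemma topspace_iso_topology: "topspace (iso_topology m T) = G"
proof -
  have "g \<in> (\<Pi>\<^sub>E x\<in>X. X)" if "g \<in> G" for g
    using isometriesD(1,5)[OF that] by (simp add: PiE_iff)
  then show ?thesis by (auto simp: iso_topology_def topspace_T)
qed

lemma openin_iso_topology:
  "openin (iso_topology m T) U \<longleftrightarrow> U \<subseteq> G \<and>
    (\<forall>g\<in>U. \<exists>F \<epsilon>. finite F \<and> F \<subseteq> X \<and> \<epsilon> > 0 \<and>
      (\<forall>h\<in>G. (\<forall>x\<in>F. near disc m \<epsilon> (g x) (h x)) \<longrightarrow> h \<in> U))" (is "?L \<longleftrightarrow> ?R")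
proof
  assume ?L
  then obtain V where V: "openin (product_topology (\<lambda>_. T) X) V" "U = V \<inter> G"
    by (auto simp: iso_topology_def openin_subtopology)
  show ?R
  proof (intro conjI ballI)
    show "U \<subseteq> G" using V by blast
    fix g assume g: "g \<in> U"
    obtain W where W: "finite {i\<in>X. W i \<noteq> topspace T}" "\<forall>i\<in>X. openin T (W i)"
      "g \<in> Pi\<^sub>E X W" "Pi\<^sub>E X W \<subseteq> V"
      using V g unfolding openin_product_topology_alt by blast
    define F where "F = {i\<in>X. W i \<noteq> topspace T}"
    have "\<exists>\<epsilon>>0. \<forall>y\<in>X. near disc m \<epsilon> (g i) y \<longrightarrow> y \<in> W i" if "i \<in> F" for i
      using W that unfolding F_def openin_T by (simp add: PiE_iff)
    then obtain e where e: "\<And>i. i \<in> F \<Longrightarrow> e i > 0 \<and> (\<forall>y\<in>X. near disc m (e i) (g i) y \<longrightarrow> y \<in> W i)"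
      by metis
    \<comment> \<open>One radius for the whole finite set; the \<open>1\<close> keeps the minimum
      meaningful when \<open>F\<close> is empty.\<close>
    define \<epsilon> where "\<epsilon> = Min (insert 1 (e ` F))"
    have fF: "finite F" using W by (simp add: F_def)
    then have \<epsilon>: "\<epsilon> > 0" "\<And>i. i \<in> F \<Longrightarrow> \<epsilon> \<le> e i" using e by (auto simp: \<epsilon>_def)
    have "h \<in> U" if h: "h \<in> G" "\<forall>x\<in>F. near disc m \<epsilon> (g x) (h x)" for h
    proof -
      have "h i \<in> W i" if "i \<in> X" for i
      proof (cases "i \<in> F")
        case True
        then show ?thesis using e[OF True] h near_mono[OF \<epsilon>(2)[OF True]] isometriesD(5)[OF h(1) that] by blast
      next
        case False
        then show ?thesis using that isometriesD(5)[OF h(1) that] by (auto simp: F_def topspace_T)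
      qed
      then have "h \<in> Pi\<^sub>E X W" using isometriesD(1)[OF h(1)] by (auto simp: PiE_iff)
      then show ?thesis using W V h by blast
    qed
    then show "\<exists>F \<epsilon>. finite F \<and> F \<subseteq> X \<and> \<epsilon> > 0 \<and>
      (\<forall>h\<in>G. (\<forall>x\<in>F. near disc m \<epsilon> (g x) (h x)) \<longrightarrow> h \<in> U)"
      using fF \<epsilon>(1) by (intro exI[of _ F] exI[of _ \<epsilon>]) (auto simp: F_def)
  qed
next
  assume R: ?R
  then obtain F \<epsilon> where F: "\<And>g. g \<in> U \<Longrightarrow> finite (F g) \<and> F g \<subseteq> X \<and> \<epsilon> g > 0 \<and>
      (\<forall>h\<in>G. (\<forall>x\<in>F g. near disc m (\<epsilon> g) (g x) (h x)) \<longrightarrow> h \<in> U)"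
    by metis
  define B where "B g = Pi\<^sub>E X (\<lambda>i. if i \<in> F g then {y\<in>X. near disc m (\<epsilon> g) (g i) y} else X)" for g
  have UG: "U \<subseteq> G" using R by blast
  have "openin (product_topology (\<lambda>_. T) X) (B g)" if g: "g \<in> U" for g
  proof -
    have "finite {i\<in>X. (if i \<in> F g then {y\<in>X. near disc m (\<epsilon> g) (g i) y} else X) \<noteq> topspace T}"
      by (rule finite_subset[of _ "F g"]) (use F[OF g] in \<open>auto simp: topspace_T\<close>)
    moreover have "openin T (if i \<in> F g then {y\<in>X. near disc m (\<epsilon> g) (g i) y} else X)" if "i \<in> X" for i
      using openin_near_ball[OF isometriesD(5)[of g m i]] F[OF g] UG g that topspace_T openin_topspace[of T]
      by auto
    ultimately show ?thesis unfolding B_def openin_PiE_gen by blast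
  qed
  then have "openin (product_topology (\<lambda>_. T) X) (\<Union>g\<in>U. B g)" by blast
  moreover have "U = (\<Union>g\<in>U. B g) \<inter> G"
  proof
    have "g \<in> B g" if "g \<in> U" for g
      using UG isometriesD(1,5)[of g m] that by (auto simp: B_def PiE_iff near_refl)
    then show "U \<subseteq> (\<Union>g\<in>U. B g) \<inter> G" using UG by blast
    show "(\<Union>g\<in>U. B g) \<inter> G \<subseteq> U"
    proof clarify
      fix g h assume g: "g \<in> U" "h \<in> B g" "h \<in> G"
      have "near disc m (\<epsilon> g) (g x) (h x)" if "x \<in> F g" for x
        using PiE_mem[of h X _ x] g(2) F[OF g(1)] that unfolding B_def by force
      then show "h \<in> U" using F[OF g(1)] g(3) by blast
    qed
  qed
  ultimately show ?L unfolding iso_topology_def openin_subtopology by blast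
qed

lemma openin_iso_nbhd:
  assumes g: "g \<in> G" and F: "finite F" "F \<subseteq> X" and \<epsilon>: "\<epsilon> > 0"
  shows "openin (iso_topology m T) {h\<in>G. \<forall>x\<in>F. near disc m \<epsilon> (g x) (h x)}"
  unfolding openin_iso_topology
proof (intro conjI ballI)
  fix h assume h: "h \<in> {h\<in>G. \<forall>x\<in>F. near disc m \<epsilon> (g x) (h x)}"
  have "k \<in> {h\<in>G. \<forall>x\<in>F. near disc m \<epsilon> (g x) (h x)}"
    if "k \<in> G" "\<forall>x\<in>F. near disc m \<epsilon> (h x) (k x)" for k
    using near_trans[OF isometriesD(5)[OF g] isometriesD(5)[of h m] isometriesD(5)[OF that(1)]] h that F(2)
    by blast
  then show "\<exists>F' \<epsilon>'. finite F' \<and> F' \<subseteq> X \<and> \<epsilon>' > 0 \<and> (\<forall>k\<in>G. (\<forall>x\<in>F'. near disc m \<epsilon>' (h x) (k x)) \<longrightarrow>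
      k \<in> {h\<in>G. \<forall>x\<in>F. near disc m \<epsilon> (g x) (h x)})"
    using F \<epsilon> by blast
qed auto

text \<open>Isometries preserve \<open>near\<close>. So closeness of \<open>g'\<close> to
  \<open>g\<close> on the image of \<open>F\<close> under \<open>h\<close>, together with closeness
  of \<open>h'\<close> to \<open>h\<close> on \<open>F\<close>, gives closeness of the products on
  \<open>F\<close>; and closeness of \<open>h\<close> to \<open>g\<close> on the preimage of
  \<open>F\<close> under \<open>g\<close> gives closeness of the inverses on
  \<open>F\<close>.\<close>

lemma topological_group_iso: "topological_group (iso_group m) (iso_topology m T)"
proof -
  interpret group "iso_group m" by (rule group_iso_group)
  have mult: "continuous_map (prod_topology (iso_topology m T) (iso_topology m T)) (iso_topology m T)
      (\<lambda>(g, h). g \<otimes>\<^bsub>iso_group m\<^esub> h)"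
  proof (rule continuous_map_prodI)
    show "g \<otimes>\<^bsub>iso_group m\<^esub> h \<in> topspace (iso_topology m T)"
      if "g \<in> topspace (iso_topology m T)" "h \<in> topspace (iso_topology m T)" for g h
      using m_closed[of g h] that by (simp add: topspace_iso_topology)
    fix U g h
    assume U: "openin (iso_topology m T) U" and "g \<in> topspace (iso_topology m T)"
      "h \<in> topspace (iso_topology m T)" and gh: "g \<otimes>\<^bsub>iso_group m\<^esub> h \<in> U"
    then have g: "g \<in> G" and h: "h \<in> G" by (auto simp: topspace_iso_topology)
    obtain F \<epsilon> where F: "finite F" "F \<subseteq> X" "\<epsilon> > 0"
      "\<And>k. k \<in> G \<Longrightarrow> \<forall>x\<in>F. near disc m \<epsilon> ((g \<otimes>\<^bsub>iso_group m\<^esub> h) x) (k x) \<Longrightarrow> k \<in> U"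
      using U gh unfolding openin_iso_topology by meson
    define V where "V = {k\<in>G. \<forall>x\<in>h ` F. near disc m \<epsilon> (g x) (k x)}"
    define W where "W = {k\<in>G. \<forall>x\<in>F. near disc m \<epsilon> (h x) (k x)}"
    have "openin (iso_topology m T) V" "openin (iso_topology m T) W"
      unfolding V_def W_def using F isometriesD(5)[OF h] by (intro openin_iso_nbhd g h; force)+
    moreover have "g \<in> V" "h \<in> W" using g h by (auto simp: V_def W_def near_refl)
    moreover have "g' \<otimes>\<^bsub>iso_group m\<^esub> h' \<in> U" if "g' \<in> V" "h' \<in> W" for g' h'
    proof -
      have g': "g' \<in> G" and h': "h' \<in> G" using that by (auto simp: V_def W_def)
      have "near disc m \<epsilon> (g (h x)) (g' (h' x))" if x: "x \<in> F" for x
      proof -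
        have X: "x \<in> X" "h x \<in> X" "h' x \<in> X" using x F(2) isometriesD(5)[OF h] isometriesD(5)[OF h'] by auto
        have "near disc m \<epsilon> (g (h x)) (g' (h x))" using \<open>g' \<in> V\<close> x by (simp add: V_def)
        moreover have "near disc m \<epsilon> (g' (h x)) (g' (h' x))"
          using \<open>h' \<in> W\<close> x X by (simp add: W_def near_iso[OF g'])
        ultimately show ?thesis
          using near_trans X isometriesD(5)[OF g] isometriesD(5)[OF g'] by blast
      qed
      then show ?thesis
        using F(2) g h g' h' m_closed[of g' h'] by (intro F(4)) (auto simp: mult_iso_group compose_eq)
    qed
    ultimately show "\<exists>V W. openin (iso_topology m T) V \<and> openin (iso_topology m T) W \<and> g \<in> V \<and> h \<in> W \<and>
        (\<forall>g'\<in>V. \<forall>h'\<in>W. g' \<otimes>\<^bsub>iso_group m\<^esub> h' \<in> U)" by blast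
  qed
  have "openin (iso_topology m T) {g \<in> topspace (iso_topology m T). inv\<^bsub>iso_group m\<^esub> g \<in> U}"
    if U: "openin (iso_topology m T) U" for U
    unfolding openin_iso_topology topspace_iso_topology
  proof (intro conjI ballI)
    fix g assume "g \<in> {g\<in>G. inv\<^bsub>iso_group m\<^esub> g \<in> U}"
    then have g: "g \<in> G" and gU: "inv\<^bsub>iso_group m\<^esub> g \<in> U" by auto
    obtain F \<epsilon> where F: "finite F" "F \<subseteq> X" "\<epsilon> > 0"
      "\<And>k. k \<in> G \<Longrightarrow> \<forall>x\<in>F. near disc m \<epsilon> ((inv\<^bsub>iso_group m\<^esub> g) x) (k x) \<Longrightarrow> k \<in> U"
      using U gU unfolding openin_iso_topology by meson
    have "inv\<^bsub>iso_group m\<^esub> h \<in> U"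
      if h: "h \<in> G" "\<forall>x\<in>inv_into X g ` F. near disc m \<epsilon> (g x) (h x)" for h
    proof (rule F(4))
      show "inv\<^bsub>iso_group m\<^esub> h \<in> G" using inv_closed[of h] h by simp
      show "\<forall>x\<in>F. near disc m \<epsilon> ((inv\<^bsub>iso_group m\<^esub> g) x) ((inv\<^bsub>iso_group m\<^esub> h) x)"
      proof
        fix x assume x: "x \<in> F"
        then have xX: "x \<in> X" using F(2) by blast
        have "near disc m \<epsilon> x (h (inv_into X g x))"
          using h(2) x isometriesD(8)[OF g xX] by force
        then have "near disc m \<epsilon> (h (inv_into X h x)) (h (inv_into X g x))"
          using isometriesD(8)[OF h(1) xX] by simp
        then have "near disc m \<epsilon> (inv_into X h x) (inv_into X g x)"
          using near_iso[OF h(1)] isometriesD(7)[OF h(1) xX] isometriesD(7)[OF g xX] by blast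
        then show "near disc m \<epsilon> ((inv\<^bsub>iso_group m\<^esub> g) x) ((inv\<^bsub>iso_group m\<^esub> h) x)"
          using xX near_sym by (simp add: inv_iso_group g h)
      qed
    qed
    then have "\<forall>h\<in>G. (\<forall>x\<in>inv_into X g ` F. near disc m \<epsilon> (g x) (h x)) \<longrightarrow> h \<in> {g\<in>G. inv\<^bsub>iso_group m\<^esub> g \<in> U}"
      by blast
    moreover have "finite (inv_into X g ` F)" "inv_into X g ` F \<subseteq> X"
      using F isometriesD(7)[OF g] by auto
    ultimately show "\<exists>F \<epsilon>. finite F \<and> F \<subseteq> X \<and> \<epsilon> > 0 \<and>
      (\<forall>h\<in>G. (\<forall>x\<in>F. near disc m \<epsilon> (g x) (h x)) \<longrightarrow> h \<in> {g\<in>G. inv\<^bsub>iso_group m\<^esub> g \<in> U})"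
      using F(3) by blast
  qed auto
  then have "continuous_map (iso_topology m T) (iso_topology m T) (\<lambda>g. inv\<^bsub>iso_group m\<^esub> g)"
    unfolding continuous_map_def using inv_closed by (auto simp: topspace_iso_topology)
  then show ?thesis
    using mult by unfold_locales (auto simp: topspace_iso_topology)
qed

end

section \<open>The space of convex orders as a flow\<close>

lemma topspace_cLO: "topspace (cLO_topology m) = cLO m"
proof
  show "topspace (cLO_topology m) \<subseteq> cLO m"
    unfolding cLO_topology_def topology_generated_by_topspace by blast
  have "r \<in> topspace (cLO_topology m)" if "r \<in> cLO m" for r
    unfolding cLO_topology_def topology_generated_by_topspace
    by (rule UnionI[of "{r' \<in> cLO m. r' \<inter> {} \<times> {} = r \<inter> {} \<times> {}}"]) (use that in blast)+
  then show "cLO m \<subseteq> topspace (cLO_topology m)" by blast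
qed

lemma openin_cLO_basic:
  "finite F \<Longrightarrow> F \<subseteq> mspace m \<Longrightarrow> r \<in> cLO m \<Longrightarrow>
    openin (cLO_topology m) {r' \<in> cLO m. r' \<inter> F \<times> F = r \<inter> F \<times> F}"
  unfolding cLO_topology_def by (rule topology_generated_by_Basis) blast

lemma openin_cLO:
  "openin (cLO_topology m) U \<longleftrightarrow> U \<subseteq> cLO m \<and> (\<forall>r\<in>U. \<exists>F. finite F \<and> F \<subseteq> mspace m \<and>
    (\<forall>r'\<in>cLO m. r' \<inter> F \<times> F = r \<inter> F \<times> F \<longrightarrow> r' \<in> U))" (is "?L U \<longleftrightarrow> ?R U")
proof
  assume "?L U"
  then have "generate_topology_on
      {{r' \<in> cLO m. r' \<inter> F \<times> F = r \<inter> F \<times> F} | F r. finite F \<and> F \<subseteq> mspace m \<and> r \<in> cLO m} U"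
    unfolding cLO_topology_def openin_topology_generated_by_iff .
  then show "?R U"
  proof induction
    case (Int a b)
    show ?case
    proof (intro conjI ballI)
      fix r assume r: "r \<in> a \<inter> b"
      from r have ra: "r \<in> a" and rb: "r \<in> b" by blast+
      from bspec[OF conjunct2[OF Int.IH(1)] ra]
      obtain F where F: "finite F" "F \<subseteq> mspace m" "\<forall>r'\<in>cLO m. r' \<inter> F \<times> F = r \<inter> F \<times> F \<longrightarrow> r' \<in> a"
        by (elim exE conjE) (rule that)
      from bspec[OF conjunct2[OF Int.IH(2)] rb]
      obtain K where K: "finite K" "K \<subseteq> mspace m" "\<forall>r'\<in>cLO m. r' \<inter> K \<times> K = r \<inter> K \<times> K \<longrightarrow> r' \<in> b"
        by (elim exE conjE) (rule that)
      have "r' \<in> a \<inter> b" if "r' \<in> cLO m" "r' \<inter> (F \<union> K) \<times> (F \<union> K) = r \<inter> (F \<union> K) \<times> (F \<union> K)" for r'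
      proof -
        have "r' \<inter> F \<times> F = r \<inter> F \<times> F" "r' \<inter> K \<times> K = r \<inter> K \<times> K" using that(2) by blast+
        then show ?thesis using F K that by blast
      qed
      then show "\<exists>F. finite F \<and> F \<subseteq> mspace m \<and> (\<forall>r'\<in>cLO m. r' \<inter> F \<times> F = r \<inter> F \<times> F \<longrightarrow> r' \<in> a \<inter> b)"
        using F K by (intro exI[of _ "F \<union> K"]) auto
    qed (use conjunct1[OF Int.IH(1)] in blast)
  next
    case (UN K)
    then show ?case by (meson UnionE UnionI Union_least)
  next
    case (Basis s)
    then obtain F r where "s = {r' \<in> cLO m. r' \<inter> F \<times> F = r \<inter> F \<times> F}" "finite F" "F \<subseteq> mspace m"
      by blast
    then show ?case by auto
  qed simp
next
  assume R: "?R U"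
  have "\<exists>V. openin (cLO_topology m) V \<and> r \<in> V \<and> V \<subseteq> U" if r: "r \<in> U" for r
  proof -
    obtain F where F: "finite F" "F \<subseteq> mspace m" "\<forall>r'\<in>cLO m. r' \<inter> F \<times> F = r \<inter> F \<times> F \<longrightarrow> r' \<in> U"
      using R r by blast
    have "r \<in> cLO m" using R r by blast
    then show ?thesis
      using openin_cLO_basic[OF F(1,2)] F(3) by (intro exI[of _ "{r' \<in> cLO m. r' \<inter> F \<times> F = r \<inter> F \<times> F}"]) blast
  qed
  then show "?L U" by (subst openin_subopen) blast
qed

lemma Hausdorff_cLO: "Hausdorff_space (cLO_topology m)"
  unfolding Hausdorff_space_def topspace_cLO
proof (intro allI impI)
  fix r r' assume "r \<in> cLO m \<and> r' \<in> cLO m \<and> r \<noteq> r'"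
  then have r: "r \<in> cLO m" "r' \<in> cLO m" "r \<noteq> r'" by auto
  then obtain x y where xy: "(x, y) \<in> r \<longleftrightarrow> (x, y) \<notin> r'" by auto
  have "r \<subseteq> mspace m \<times> mspace m" "r' \<subseteq> mspace m \<times> mspace m" using r by (auto simp: cLO_def)
  then have F: "finite {x, y}" "{x, y} \<subseteq> mspace m" using xy by auto
  show "\<exists>U V. openin (cLO_topology m) U \<and> openin (cLO_topology m) V \<and> r \<in> U \<and> r' \<in> V \<and> disjnt U V"
    by (intro exI conjI, rule openin_cLO_basic[OF F r(1)], rule openin_cLO_basic[OF F r(2)])
      (use r xy in \<open>auto simp: disjnt_iff set_eq_iff\<close>)
qed

lemma openin_product_bool:
  assumes "V \<subseteq> topspace (product_topology (\<lambda>_. discrete_topology (UNIV :: bool set)) I)"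
    "\<And>f. f \<in> V \<Longrightarrow> \<exists>K. finite K \<and> K \<subseteq> I \<and>
      (\<forall>g\<in>topspace (product_topology (\<lambda>_. discrete_topology (UNIV :: bool set)) I). (\<forall>i\<in>K. g i = f i) \<longrightarrow> g \<in> V)"
  shows "openin (product_topology (\<lambda>_. discrete_topology (UNIV :: bool set)) I) V"
  unfolding openin_product_topology_alt
proof
  fix f assume f: "f \<in> V"
  obtain K where K: "finite K" "K \<subseteq> I"
    "\<And>g. g \<in> topspace (product_topology (\<lambda>_. discrete_topology (UNIV :: bool set)) I) \<Longrightarrow> \<forall>i\<in>K. g i = f i \<Longrightarrow> g \<in> V"
    using assms(2)[OF f] by blast
  let ?U = "\<lambda>i. if i \<in> K then {f i} else (UNIV :: bool set)"
  have "finite {i \<in> I. ?U i \<noteq> UNIV}" by (rule finite_subset[OF _ K(1)]) auto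
  moreover have "f \<in> Pi\<^sub>E I ?U" using f assms(1) by (auto simp: PiE_iff)
  moreover have "Pi\<^sub>E I ?U \<subseteq> V"
  proof
    fix g assume g: "g \<in> Pi\<^sub>E I ?U"
    then have "g i = f i" if "i \<in> K" for i
      using PiE_mem[OF g, of i] that K(2) by auto
    moreover have "g \<in> topspace (product_topology (\<lambda>_. discrete_topology (UNIV :: bool set)) I)"
      using g by (simp add: PiE_iff)
    ultimately show "g \<in> V" using K(3) by blast
  qed
  ultimately show "\<exists>U. finite {i \<in> I. U i \<noteq> topspace (discrete_topology UNIV)} \<and>
      (\<forall>i\<in>I. openin (discrete_topology UNIV) (U i)) \<and> f \<in> Pi\<^sub>E I U \<and> Pi\<^sub>E I U \<subseteq> V"
    by (intro exI[of _ ?U]) auto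
qed

text \<open>In the compact cube of all relations the convex orders form a closed set: a failure of
  one of the conditions in \<open>convex_order\<close> is due to at most three pairs, so failing is
  an open condition. Compactness then passes to \<open>cLO m\<close> along the continuous surjection
  \<open>R\<close>.\<close>

lemma compact_cLO:
  assumes "ultrametric (mspace m) (mdist m)"
  shows "compact_space (cLO_topology m)"
proof -
  let ?X = "mspace m"
  define P where "P = product_topology (\<lambda>_. discrete_topology (UNIV :: bool set)) (?X \<times> ?X)"
  define R where "R f = {p \<in> ?X \<times> ?X. f p}" for f
  have P: "compact_space P"
    unfolding P_def compact_space_product_topology by (simp add: compact_space_discrete_topology)
  have opI: "openin P V" if "V \<subseteq> topspace P"
    "\<And>f. f \<in> V \<Longrightarrow> \<exists>K. finite K \<and> K \<subseteq> ?X \<times> ?X \<and> (\<forall>g\<in>topspace P. (\<forall>i\<in>K. g i = f i) \<longrightarrow> g \<in> V)" for V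
    using openin_product_bool that unfolding P_def by blast
  define C where "C = {f \<in> topspace P. R f \<in> cLO m}"
  have bad: "\<exists>K. finite K \<and> K \<subseteq> ?X \<times> ?X \<and> (\<forall>g. (\<forall>i\<in>K. g i = f i) \<longrightarrow> R g \<notin> cLO m)"
    if "R f \<notin> cLO m" for f
  proof -
    have nc: "\<not> convex_order ?X (mdist m) (R f)" using that cLO_eq_convex_order[OF assms] by blast
    have no: "R g \<notin> cLO m" if "\<not> convex_order ?X (mdist m) (R g)" for g
      using that cLO_eq_convex_order[OF assms] by blast
    consider x where "(x, x) \<in> R f"
      | x y z where "(x, y) \<in> R f" "(y, z) \<in> R f" "(x, z) \<notin> R f"
      | x y where "x \<in> ?X" "y \<in> ?X" "x \<noteq> y" "(x, y) \<notin> R f" "(y, x) \<notin> R f"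
      | x x' y where "x \<in> ?X" "x' \<in> ?X" "y \<in> ?X" "mdist m x x' < mdist m x y" "(x, y) \<in> R f" "(x', y) \<notin> R f"
    proof (rule ccontr)
      assume no: "\<not> thesis"
      have "convex_order ?X (mdist m) (R f)"
      proof (rule convex_orderI)
        show "R f \<subseteq> ?X \<times> ?X" by (auto simp: R_def)
        show "(x, x) \<notin> R f" for x using that(1) no by blast
        show "(x, z) \<in> R f" if "(x, y) \<in> R f" "(y, z) \<in> R f" for x y z
          using \<open>\<And>x y z. \<lbrakk>(x, y) \<in> R f; (y, z) \<in> R f; (x, z) \<notin> R f\<rbrakk> \<Longrightarrow> thesis\<close>[OF that] no by blast
        show "(x, y) \<in> R f \<or> (y, x) \<in> R f" if "x \<in> ?X" "y \<in> ?X" "x \<noteq> y" for x y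
          using \<open>\<And>x y. \<lbrakk>x \<in> ?X; y \<in> ?X; x \<noteq> y; (x, y) \<notin> R f; (y, x) \<notin> R f\<rbrakk> \<Longrightarrow> thesis\<close>[OF that] no by blast
        show "(x', y) \<in> R f"
          if "x \<in> ?X" "x' \<in> ?X" "y \<in> ?X" "mdist m x x' < mdist m x y" "(x, y) \<in> R f" for x x' y
          using \<open>\<And>x x' y. \<lbrakk>x \<in> ?X; x' \<in> ?X; y \<in> ?X; mdist m x x' < mdist m x y; (x, y) \<in> R f; (x', y) \<notin> R f\<rbrakk>
            \<Longrightarrow> thesis\<close>[OF that] no by blast
      qed
      then show False using nc by blast
    qed
    then show ?thesis
    proof cases
      case 1
      have "R g \<notin> cLO m" if "\<forall>i\<in>{(x, x)}. g i = f i" for g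
      proof (rule no)
        have "(x, x) \<in> R g" using 1 that by (simp add: R_def)
        then show "\<not> convex_order ?X (mdist m) (R g)" using convex_orderD(2) by metis
      qed
      then show ?thesis using 1 by (intro exI[of _ "{(x, x)}"]) (auto simp: R_def)
    next
      case 2
      have "R g \<notin> cLO m" if "\<forall>i\<in>{(x, y), (y, z), (x, z)}. g i = f i" for g
      proof (rule no)
        have "(x, y) \<in> R g" "(y, z) \<in> R g" "(x, z) \<notin> R g" using 2 that by (auto simp: R_def)
        then show "\<not> convex_order ?X (mdist m) (R g)" using convex_orderD(3) by metis
      qed
      then show ?thesis using 2 by (intro exI[of _ "{(x, y), (y, z), (x, z)}"]) (auto simp: R_def)
    next
      case 3
      have "R g \<notin> cLO m" if "\<forall>i\<in>{(x, y), (y, x)}. g i = f i" for g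
      proof (rule no)
        have "(x, y) \<notin> R g" "(y, x) \<notin> R g" using 3 that by (auto simp: R_def)
        then show "\<not> convex_order ?X (mdist m) (R g)" using convex_orderD(4) 3 by metis
      qed
      then show ?thesis using 3 by (intro exI[of _ "{(x, y), (y, x)}"]) auto
    next
      case 4
      have "R g \<notin> cLO m" if "\<forall>i\<in>{(x, y), (x', y)}. g i = f i" for g
      proof (rule no)
        have "(x, y) \<in> R g" "(x', y) \<notin> R g" using 4 that by (auto simp: R_def)
        then show "\<not> convex_order ?X (mdist m) (R g)" using 4 unfolding convex_order_def by blast
      qed
      then show ?thesis using 4 by (intro exI[of _ "{(x, y), (x', y)}"]) auto
    qed
  qed
  have "openin P (topspace P - C)"
  proof (rule opI)
    fix f assume "f \<in> topspace P - C"
    then obtain K where "finite K" "K \<subseteq> ?X \<times> ?X" "\<forall>g. (\<forall>i\<in>K. g i = f i) \<longrightarrow> R g \<notin> cLO m"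
      using bad[of f] by (auto simp: C_def)
    then show "\<exists>K. finite K \<and> K \<subseteq> ?X \<times> ?X \<and> (\<forall>g\<in>topspace P. (\<forall>i\<in>K. g i = f i) \<longrightarrow> g \<in> topspace P - C)"
      by (intro exI[of _ K]) (auto simp: C_def)
  qed blast
  then have "closedin P C" by (simp add: closedin_def C_def)
  then have "compactin P C" using P by (rule closedin_compact_space[rotated])
  then have "compact_space (subtopology P C)" by (simp add: compact_space_subtopology)
  moreover have "continuous_map (subtopology P C) (cLO_topology m) R"
    unfolding continuous_map_def topspace_cLO
  proof (intro conjI allI impI)
    show "R \<in> topspace (subtopology P C) \<rightarrow> cLO m" by (auto simp: C_def)
    fix U assume U: "openin (cLO_topology m) U"
    define V where "V = {f \<in> topspace P. R f \<in> cLO m \<longrightarrow> R f \<in> U}"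
    have "openin P V"
    proof (rule opI)
      fix f assume f: "f \<in> V"
      show "\<exists>K. finite K \<and> K \<subseteq> ?X \<times> ?X \<and> (\<forall>g\<in>topspace P. (\<forall>i\<in>K. g i = f i) \<longrightarrow> g \<in> V)"
      proof (cases "R f \<in> cLO m")
        case False
        then show ?thesis using bad[OF False] unfolding V_def by blast
      next
        case True
        then have "R f \<in> U" using f by (simp add: V_def)
        then obtain F where F: "finite F" "F \<subseteq> ?X" "\<forall>r'\<in>cLO m. r' \<inter> F \<times> F = R f \<inter> F \<times> F \<longrightarrow> r' \<in> U"
          using U unfolding openin_cLO by meson
        have "g \<in> V" if "g \<in> topspace P" "\<forall>i\<in>F\<times>F. g i = f i" for g
        proof -
          have "R g \<inter> F \<times> F = R f \<inter> F \<times> F" using that(2) by (auto simp: R_def)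
          then show ?thesis using F(3) that(1) by (simp add: V_def)
        qed
        then show ?thesis using F by (intro exI[of _ "F \<times> F"]) auto
      qed
    qed (auto simp: V_def)
    moreover have "{f \<in> topspace (subtopology P C). R f \<in> U} = C \<inter> V"
      using U unfolding openin_cLO by (auto simp: C_def V_def)
    ultimately show "openin (subtopology P C) {f \<in> topspace (subtopology P C). R f \<in> U}"
      using openin_subtopology_Int2 by metis
  qed
  ultimately have "compactin (cLO_topology m) (R ` topspace (subtopology P C))"
    unfolding compact_space_def using image_compactin by blast
  moreover have "R ` topspace (subtopology P C) = cLO m"
  proof
    show "R ` topspace (subtopology P C) \<subseteq> cLO m" by (auto simp: C_def)
    show "cLO m \<subseteq> R ` topspace (subtopology P C)"
    proof
      fix r assume r: "r \<in> cLO m"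
      let ?f = "\<lambda>p\<in>?X \<times> ?X. p \<in> r"
      have "r \<subseteq> ?X \<times> ?X" using r by (simp add: cLO_def)
      then have Rf: "R ?f = r" by (auto simp: R_def)
      have "?f \<in> topspace P" by (simp add: P_def)
      then have "?f \<in> topspace (subtopology P C)" using Rf r by (simp add: C_def)
      then show "r \<in> R ` topspace (subtopology P C)" using Rf by blast
    qed
  qed
  ultimately show ?thesis by (simp add: compact_space_def topspace_cLO)
qed

lemma group_actionI:
  assumes "group G" "\<And>g. g \<in> carrier G \<Longrightarrow> \<phi> g \<in> extensional E"
    "\<And>g x. g \<in> carrier G \<Longrightarrow> x \<in> E \<Longrightarrow> \<phi> g x \<in> E"
    "\<And>x. x \<in> E \<Longrightarrow> \<phi> \<one>\<^bsub>G\<^esub> x = x"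
    "\<And>g h x. g \<in> carrier G \<Longrightarrow> h \<in> carrier G \<Longrightarrow> x \<in> E \<Longrightarrow> \<phi> (g \<otimes>\<^bsub>G\<^esub> h) x = \<phi> g (\<phi> h x)"
  shows "group_action G E \<phi>"
proof -
  interpret group G by fact
  have bij: "\<phi> g \<in> Bij E" if g: "g \<in> carrier G" for g
  proof -
    have "bij_betw (\<phi> g) E E"
    proof (rule bij_betw_byWitness[of _ "\<phi> (inv\<^bsub>G\<^esub> g)"])
      show "\<forall>x\<in>E. \<phi> (inv\<^bsub>G\<^esub> g) (\<phi> g x) = x" "\<forall>x\<in>E. \<phi> g (\<phi> (inv\<^bsub>G\<^esub> g) x) = x"
        using assms(4) assms(5)[symmetric] g by simp_all
    qed (use assms(3) g in auto)
    then show ?thesis using assms(2) g by (simp add: Bij_def)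
  qed
  have "\<phi> (g \<otimes>\<^bsub>G\<^esub> h) = \<phi> g \<otimes>\<^bsub>BijGroup E\<^esub> \<phi> h" if gh: "g \<in> carrier G" "h \<in> carrier G" for g h
  proof -
    have "\<phi> (g \<otimes>\<^bsub>G\<^esub> h) = compose E (\<phi> g) (\<phi> h)"
      by (rule extensionalityI[of _ E]) (use assms gh in \<open>auto simp: compose_eq\<close>)
    then show ?thesis using bij gh by (simp add: BijGroup_def)
  qed
  then have "\<phi> \<in> hom G (BijGroup E)" using bij by (auto simp: hom_def BijGroup_def)
  then show ?thesis
    by (simp add: group_action_def group_hom_def group_hom_axioms_def group_BijGroup is_group)
qed

lemma cLO_action_eq:
  "r \<in> cLO m \<Longrightarrow> cLO_action m g r = pullback_order (mspace m) (inv_into (mspace m) g) r"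
  by (simp add: cLO_action_def pullback_order_def)

lemma cLO_action_mem:
  "r \<in> cLO m \<Longrightarrow> (x, y) \<in> cLO_action m g r \<longleftrightarrow> x \<in> mspace m \<and> y \<in> mspace m \<and>
    (inv_into (mspace m) g x, inv_into (mspace m) g y) \<in> r"
  by (simp add: cLO_action_def)

context near_space
begin

lemma convex_order_of_cLO: "r \<in> cLO m \<Longrightarrow> convex_order X (mdist m) r"
  using cLO_eq_convex_order[OF ultrametric_axioms] by blast

lemma cLO_of_convex_order: "convex_order X (mdist m) r \<Longrightarrow> r \<in> cLO m"
  using cLO_eq_convex_order[OF ultrametric_axioms] by blast

lemma pullback_order_cLO:
  assumes "r \<in> cLO m" "k \<in> X \<rightarrow> X" "\<And>x y. x \<in> X \<Longrightarrow> y \<in> X \<Longrightarrow> mdist m (k x) (k y) = mdist m x y"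
  shows "pullback_order X k r \<in> cLO m"
proof (rule cLO_of_convex_order, rule convex_order_pullback)
  show "convex_order X (mdist m) r" using assms(1) by (rule convex_order_of_cLO)
  show "mdist m y y = 0" if "y \<in> X" for y using d_zero that by blast
qed (use assms in auto)

lemma cLO_action_closed:
  assumes g: "g \<in> G" and r: "r \<in> cLO m"
  shows "cLO_action m g r \<in> cLO m"
  unfolding cLO_action_eq[OF r]
  by (rule pullback_order_cLO[OF r])
    (use isometriesD(5,6)[OF restrict_inv_isometry[OF g]] in auto)

lemma group_action_cLO: "group_action (iso_group m) (cLO m) (cLO_action m)"
proof (rule group_actionI[OF group_iso_group])
  show "cLO_action m g \<in> extensional (cLO m)" for g by (simp add: cLO_action_def)
  show "cLO_action m g r \<in> cLO m" if "g \<in> carrier (iso_group m)" "r \<in> cLO m" for g r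
    using that by (simp add: cLO_action_closed)
  show "cLO_action m \<one>\<^bsub>iso_group m\<^esub> r = r" if r: "r \<in> cLO m" for r
  proof -
    have "inv_into X (\<lambda>x\<in>X. x) x = x" if "x \<in> X" for x
      using inv_into_f_f[of "\<lambda>x\<in>X. x" X x] that by (simp add: inj_on_def)
    moreover have "r \<subseteq> X \<times> X" using r by (simp add: cLO_def)
    ultimately show ?thesis
      unfolding cLO_action_eq[OF r] one_iso_group pullback_order_def by auto
  qed
  fix g h r assume "g \<in> carrier (iso_group m)" "h \<in> carrier (iso_group m)" and r: "r \<in> cLO m"
  then have g: "g \<in> G" and h: "h \<in> G" by auto
  have inv: "inv_into X (g \<otimes>\<^bsub>iso_group m\<^esub> h) x = inv_into X h (inv_into X g x)" if x: "x \<in> X" for x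
  proof -
    have gh: "g \<otimes>\<^bsub>iso_group m\<^esub> h \<in> G"
      using compose_isometry[OF g h] by (simp add: mult_iso_group g h)
    have "(g \<otimes>\<^bsub>iso_group m\<^esub> h) (inv_into X h (inv_into X g x)) = x"
      using x by (simp add: mult_iso_group g h compose_eq isometriesD(7,8)[OF g] isometriesD(7,8)[OF h])
    then show ?thesis
      using isometriesD(9)[OF gh, of "inv_into X h (inv_into X g x)"] x isometriesD(7)[OF g] isometriesD(7)[OF h] by simp
  qed
  show "cLO_action m (g \<otimes>\<^bsub>iso_group m\<^esub> h) r = cLO_action m g (cLO_action m h r)"
    using isometriesD(7)[OF g] isometriesD(7)[OF h]
    by (auto simp: cLO_action_mem r cLO_action_closed[OF h r] inv)
qed

lemma finite_separation:
  assumes "finite F" "F \<subseteq> X"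
  shows "\<exists>\<epsilon>>0. \<forall>x\<in>F. \<forall>y\<in>F. x \<noteq> y \<longrightarrow> \<epsilon> \<le> mdist m x y"
proof -
  \<comment> \<open>The \<open>1\<close> covers the case that \<open>F\<close> has no two distinct
    points.\<close>
  define D where "D = insert 1 ((\<lambda>(x, y). mdist m x y) ` {p \<in> F \<times> F. fst p \<noteq> snd p})"
  have D: "finite D" "D \<noteq> {}" using assms by (auto simp: D_def)
  have "0 < mdist m x y" if "x \<in> F" "y \<in> F" "x \<noteq> y" for x y
    using d_zero[of x y] d_nonneg[of x y] that assms(2) by (metis less_eq_real_def subsetD)
  then have "\<forall>e\<in>D. 0 < e" by (auto simp: D_def)
  then have "Min D > 0" using D by simp
  moreover have "Min D \<le> mdist m x y" if "x \<in> F" "y \<in> F" "x \<noteq> y" for x y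
    using D(1) that by (intro Min_le) (force simp: D_def)+
  ultimately show ?thesis by blast
qed

text \<open>If \<open>h\<close> is close to \<open>g\<close> on the preimage of \<open>F\<close>
  under \<open>g\<close>, then the preimages of a point of \<open>F\<close> under \<open>g\<close>
  and under \<open>h\<close> are closer to each other than the points of \<open>F\<close> are. By
  convexity an order compares both kinds of preimages alike, so on \<open>F\<close> the translate by
  \<open>h\<close> depends only on the order on the one finite set \<open>K\<close>.\<close>

lemma continuous_cLO_action:
  "continuous_map (prod_topology (iso_topology m T) (cLO_topology m)) (cLO_topology m) (\<lambda>(g, r). cLO_action m g r)"
proof (rule continuous_map_prodI)
  show "cLO_action m g r \<in> topspace (cLO_topology m)"
    if "g \<in> topspace (iso_topology m T)" "r \<in> topspace (cLO_topology m)" for g r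
    using that by (simp add: topspace_iso_topology topspace_cLO cLO_action_closed)
  fix U g r
  assume U: "openin (cLO_topology m) U" and "g \<in> topspace (iso_topology m T)"
    "r \<in> topspace (cLO_topology m)" and grU: "cLO_action m g r \<in> U"
  then have g: "g \<in> G" and r: "r \<in> cLO m" by (auto simp: topspace_iso_topology topspace_cLO)
  obtain F where F: "finite F" "F \<subseteq> X"
    "\<And>r'. r' \<in> cLO m \<Longrightarrow> r' \<inter> F \<times> F = cLO_action m g r \<inter> F \<times> F \<Longrightarrow> r' \<in> U"
    using U grU unfolding openin_cLO by meson
  obtain \<epsilon> where \<epsilon>: "\<epsilon> > 0" "\<And>x y. x \<in> F \<Longrightarrow> y \<in> F \<Longrightarrow> x \<noteq> y \<Longrightarrow> \<epsilon> \<le> mdist m x y"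
    using finite_separation[OF F(1,2)] by blast
  define K where "K = inv_into X g ` F"
  have K: "finite K" "K \<subseteq> X" using F isometriesD(7)[OF g] by (auto simp: K_def)
  define V where "V = {h\<in>G. \<forall>x\<in>K. near disc m \<epsilon> (g x) (h x)}"
  define W where "W = {r' \<in> cLO m. r' \<inter> K \<times> K = r \<inter> K \<times> K}"
  have "openin (iso_topology m T) V" unfolding V_def by (rule openin_iso_nbhd[OF g K \<epsilon>(1)])
  moreover have "openin (cLO_topology m) W" unfolding W_def by (rule openin_cLO_basic[OF K r])
  moreover have "g \<in> V" "r \<in> W" using g r by (auto simp: V_def W_def near_refl)
  moreover have "cLO_action m h r' \<in> U" if "h \<in> V" "r' \<in> W" for h r'
  proof (rule F(3))
    have h: "h \<in> G" and r': "r' \<in> cLO m" using that by (auto simp: V_def W_def)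
    show "cLO_action m h r' \<in> cLO m" by (rule cLO_action_closed[OF h r'])
    have close: "mdist m (inv_into X g x) (inv_into X h x) < \<epsilon>" if x: "x \<in> F" for x
    proof -
      have xX: "x \<in> X" using x F(2) by blast
      have "near disc m \<epsilon> x (h (inv_into X g x))"
        using \<open>h \<in> V\<close> x isometriesD(8)[OF g xX] by (force simp: V_def K_def)
      then have "near disc m \<epsilon> (h (inv_into X h x)) (h (inv_into X g x))"
        using isometriesD(8)[OF h xX] by simp
      then have "near disc m \<epsilon> (inv_into X h x) (inv_into X g x)"
        using near_iso[OF h] isometriesD(7)[OF h xX] isometriesD(7)[OF g xX] by blast
      then show ?thesis using near_dist[OF near_sym] isometriesD(7)[OF g xX] \<epsilon>(1) by blast
    qed
    have "(x, y) \<in> cLO_action m h r' \<longleftrightarrow> (x, y) \<in> cLO_action m g r" if xy: "x \<in> F" "y \<in> F" for x y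
    proof (cases "x = y")
      case True
      then show ?thesis
        using convex_orderD(2)[OF convex_order_of_cLO] cLO_action_closed g r h r' by blast
    next
      case False
      have X: "x \<in> X" "y \<in> X" using xy F(2) by auto
      let ?x = "inv_into X g x" and ?y = "inv_into X g y"
      have d: "mdist m ?x ?y = mdist m x y"
        using isometriesD(6)[OF g, of ?x ?y] isometriesD(7,8)[OF g] X by simp
      have "(?x, ?y) \<in> r' \<longleftrightarrow> (inv_into X h x, inv_into X h y) \<in> r'"
        by (rule convex_order_move[OF convex_order_of_cLO[OF r']])
          (use X isometriesD(7)[OF g] isometriesD(7)[OF h] close[OF xy(1)] close[OF xy(2)] \<epsilon>(2)[OF xy False] d in auto)
      moreover have "(?x, ?y) \<in> r' \<longleftrightarrow> (?x, ?y) \<in> r"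
        using \<open>r' \<in> W\<close> xy by (auto simp: W_def K_def)
      ultimately show ?thesis using X by (simp add: cLO_action_mem r r')
    qed
    then show "cLO_action m h r' \<inter> F \<times> F = cLO_action m g r \<inter> F \<times> F" by auto
  qed
  ultimately show "\<exists>V W. openin (iso_topology m T) V \<and> openin (cLO_topology m) W \<and> g \<in> V \<and> r \<in> W \<and>
      (\<forall>h\<in>V. \<forall>r'\<in>W. cLO_action m h r' \<in> U)" by blast
qed

lemma flow_cLO:
  assumes "cLO m \<noteq> {}"
  shows "flow (iso_group m) (iso_topology m T) (cLO_topology m) (cLO_action m)"
proof -
  interpret topological_group "iso_group m" "iso_topology m T" by (rule topological_group_iso)
  interpret group_action "iso_group m" "topspace (cLO_topology m)" "cLO_action m"
    unfolding topspace_cLO by (rule group_action_cLO)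
  show ?thesis
  proof
    show "topspace (cLO_topology m) \<noteq> {}" unfolding topspace_cLO by (rule assms)
  qed (fact compact_cLO[OF ultrametric_axioms] Hausdorff_cLO continuous_cLO_action)+
qed

end

section \<open>Minimality\<close>

text \<open>The common setting of both assertions: \<open>e\<close> is the identity in the discrete
  case and the embedding into the completion in the other. Completeness enters through
  \<open>e_extend\<close>.\<close>

locale dense_QS = L: level_set S + near_space m T disc
  for S :: "real set" and m :: "'a metric" and T :: "'a topology" and disc :: bool +
  fixes e :: "(real \<Rightarrow> rat) \<Rightarrow> 'a"
  assumes e_mem: "p \<in> L.Q \<Longrightarrow> e p \<in> mspace m"
    and e_dist: "p \<in> L.Q \<Longrightarrow> q \<in> L.Q \<Longrightarrow> mdist m (e p) (e q) = L.d p q"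
    and e_dense: "x \<in> mspace m \<Longrightarrow> \<epsilon> > 0 \<Longrightarrow> \<exists>p\<in>L.Q. near disc m \<epsilon> (e p) x"
    and e_extend: "bij_betw k L.Q L.Q \<Longrightarrow> (\<And>p q. p \<in> L.Q \<Longrightarrow> q \<in> L.Q \<Longrightarrow> L.d (k p) (k q) = L.d p q) \<Longrightarrow>
      \<exists>g\<in>isometries m. \<forall>p\<in>L.Q. g (e p) = e (k p)"
begin

lemma e_dense_dist: "x \<in> X \<Longrightarrow> \<epsilon> > 0 \<Longrightarrow> \<exists>p\<in>L.Q. mdist m (e p) x < \<epsilon>"
  using e_dense near_dist e_mem by blast

lemma d_pos: "x \<in> X \<Longrightarrow> y \<in> X \<Longrightarrow> x \<noteq> y \<Longrightarrow> mdist m x y > 0"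
  using d_zero[of x y] d_nonneg[of x y] by linarith

text \<open>The lexicographic order carried over to the whole space. Two points are compared through
  approximations nearer to them than their distance; by \<open>lex_ext_iff\<close> any such
  approximations give the same answer.\<close>

definition lex_ext :: "('a \<times> 'a) set"
  where "lex_ext = {(x, y). x \<in> X \<and> y \<in> X \<and> (\<exists>p\<in>L.Q. \<exists>q\<in>L.Q.
    mdist m (e p) x < mdist m x y \<and> mdist m (e q) y < mdist m x y \<and> (p, q) \<in> L.lex)}"

text \<open>By the ultrametric inequality, two approximations of the same point are closer to each
  other than the approximations of different points are, so convexity of \<open>lex\<close> gives
  the independence of the choice.\<close>

lemma lex_ext_iff:
  assumes X: "x \<in> X" "y \<in> X" and Q: "p \<in> L.Q" "q \<in> L.Q"
    and d: "mdist m (e p) x < mdist m x y" "mdist m (e q) y < mdist m x y"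
  shows "(x, y) \<in> lex_ext \<longleftrightarrow> (p, q) \<in> L.lex"
proof
  assume "(x, y) \<in> lex_ext"
  then obtain p' q' where Q': "p' \<in> L.Q" "q' \<in> L.Q"
    and d': "mdist m (e p') x < mdist m x y" "mdist m (e q') y < mdist m x y" and l: "(p', q') \<in> L.lex"
    by (auto simp: lex_ext_def)
  have D: "mdist m (e p') (e q') = mdist m x y"
    using d_isosceles2[of x "e p'" y "e q'"] X Q' e_mem d' d_comm by metis
  have "L.d p' p < L.d p' q'" "L.d q' q < L.d p' q'"
    using ultra[of "e p'" x "e p"] ultra[of "e q'" y "e q"] X Q Q' e_mem d d' d_comm D
    unfolding e_dist[OF Q'(1) Q(1), symmetric] e_dist[OF Q'(2) Q(2), symmetric] e_dist[OF Q', symmetric]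
    by (smt (verit))+
  then show "(p, q) \<in> L.lex"
    using L.U.convex_order_move[OF L.lex_convex Q'(1) Q(1) Q'(2) Q(2)] l by blast
qed (use assms in \<open>auto simp: lex_ext_def\<close>)

lemma lex_ext_cLO: "lex_ext \<in> cLO m"
proof (rule cLO_of_convex_order, rule convex_orderI)
  show "lex_ext \<subseteq> X \<times> X" by (auto simp: lex_ext_def)
  show irr: "(x, x) \<notin> lex_ext" for x
  proof
    assume "(x, x) \<in> lex_ext"
    then obtain p where "x \<in> X" "mdist m (e p) x < mdist m x x" by (auto simp: lex_ext_def)
    then show False using d_zero[of x x] d_nonneg[of "e p" x] by fastforce
  qed
  show "(x', y) \<in> lex_ext"
    if x: "x \<in> X" "x' \<in> X" "y \<in> X" "mdist m x x' < mdist m x y" "(x, y) \<in> lex_ext" for x x' y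
  proof -
    have D: "mdist m x' y = mdist m x y" using d_isosceles x by blast
    obtain p q where Q: "p \<in> L.Q" "q \<in> L.Q"
      and d: "mdist m (e p) x < mdist m x y" "mdist m (e q) y < mdist m x y" and l: "(p, q) \<in> L.lex"
      using x(5) by (auto simp: lex_ext_def)
    have "mdist m (e p) x' < mdist m x y"
      using ultra[of "e p" x x'] x Q e_mem d by fastforce
    then show ?thesis using lex_ext_iff[of x' y p q] x Q d l D by simp
  qed
  have approx: "\<exists>p\<in>L.Q. \<forall>y\<in>F. x \<noteq> y \<longrightarrow> mdist m (e p) x < mdist m x y"
    if "finite F" "F \<subseteq> X" "x \<in> F" for x F
    using finite_separation[OF that(1,2)] e_dense_dist[of x] that by (metis order_less_le_trans subsetD)
  show "(x, y) \<in> lex_ext \<or> (y, x) \<in> lex_ext" if x: "x \<in> X" "y \<in> X" "x \<noteq> y" for x y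
  proof -
    obtain p where p: "p \<in> L.Q" "mdist m (e p) x < mdist m x y"
      using e_dense_dist[OF x(1) d_pos[OF x]] by blast
    obtain q where q: "q \<in> L.Q" "mdist m (e q) y < mdist m x y"
      using e_dense_dist[OF x(2) d_pos[OF x]] by blast
    have "mdist m (e p) (e q) = mdist m x y"
      using d_isosceles2[of x "e p" y "e q"] x p q e_mem d_comm by metis
    then have "p \<noteq> q" using d_pos[OF x] d_zero[of "e p" "e q"] e_mem p by auto
    then have "(p, q) \<in> L.lex \<or> (q, p) \<in> L.lex" using convex_orderD(4)[OF L.lex_convex] p q by blast
    then show ?thesis using lex_ext_iff[of x y p q] lex_ext_iff[of y x q p] x p q d_comm[of x y] by auto
  qed
  show "(x, z) \<in> lex_ext" if xy: "(x, y) \<in> lex_ext" and yz: "(y, z) \<in> lex_ext" for x y z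
  proof -
    have X: "x \<in> X" "y \<in> X" "z \<in> X" using that by (auto simp: lex_ext_def)
    have ne: "x \<noteq> y" "y \<noteq> z" using irr that by blast+
    \<comment> \<open>One approximation per point, finer than its distances to the other two, serves
      all comparisons at once and reduces transitivity to that of \<open>lex\<close>.\<close>
    let ?F = "{x, y, z}"
    have F: "finite ?F" "?F \<subseteq> X" using X by auto
    have "\<forall>u\<in>?F. \<exists>p\<in>L.Q. \<forall>y\<in>?F. u \<noteq> y \<longrightarrow> mdist m (e p) u < mdist m u y"
      using approx[OF F] by blast
    then obtain p where p: "\<And>u. u \<in> ?F \<Longrightarrow> p u \<in> L.Q"
      "\<And>u v. u \<in> ?F \<Longrightarrow> v \<in> ?F \<Longrightarrow> u \<noteq> v \<Longrightarrow> mdist m (e (p u)) u < mdist m u v"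
      by metis
    have iff: "(u, v) \<in> lex_ext \<longleftrightarrow> (p u, p v) \<in> L.lex" if "u \<in> ?F" "v \<in> ?F" "u \<noteq> v" for u v
      using lex_ext_iff[of u v "p u" "p v"] p that F(2) d_comm[of u v] by (metis subsetD)
    have "(p x, p y) \<in> L.lex" "(p y, p z) \<in> L.lex" using iff xy yz ne by auto
    then have l: "(p x, p z) \<in> L.lex" by (rule convex_orderD(3)[OF L.lex_convex])
    then have "x \<noteq> z" using convex_orderD(2)[OF L.lex_convex] by metis
    then show ?thesis using iff l by auto
  qed
qed

lemma e_approximation:
  assumes "finite F" "F \<subseteq> X" "\<epsilon> > 0" "\<And>x. x \<in> F \<Longrightarrow> u x \<in> X"
  shows "\<exists>p. \<forall>x\<in>F. p x \<in> L.Q \<and> near disc m \<epsilon> (e (p x)) (u x) \<and> mdist m (u x) (e (p x)) < \<epsilon>"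
proof -
  have "\<exists>p\<in>L.Q. near disc m \<epsilon> (e p) (u x) \<and> mdist m (u x) (e p) < \<epsilon>" if "x \<in> F" for x
    using e_dense[OF assms(4)[OF that] assms(3)] near_dist[OF near_sym _ assms(3)] assms(4)[OF that] by blast
  then show ?thesis by metis
qed

lemma pullback_e_convex: "r \<in> cLO m \<Longrightarrow> convex_order L.Q L.d (pullback_order L.Q e r)"
  by (rule L.U.convex_order_pullback[OF convex_order_of_cLO])
    (use e_mem e_dist d_zero in auto)

text \<open>Approximating \<open>F\<close> in the dense copy more closely than its points are apart
  reduces the claim to \<open>convex_orders_match\<close>; the isometry found there extends to the
  whole space.\<close>

lemma orbit_approximates:
  assumes r: "r \<in> cLO m" and r': "r' \<in> cLO m" and F: "finite F" "F \<subseteq> X"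
  shows "\<exists>g\<in>G. cLO_action m g r \<inter> F \<times> F = r' \<inter> F \<times> F"
proof -
  obtain \<epsilon> where \<epsilon>: "\<epsilon> > 0" "\<And>x y. x \<in> F \<Longrightarrow> y \<in> F \<Longrightarrow> x \<noteq> y \<Longrightarrow> \<epsilon> \<le> mdist m x y"
    using finite_separation[OF F] by blast
  have "\<exists>p. \<forall>x\<in>F. p x \<in> L.Q \<and> near disc m \<epsilon> (e (p x)) x \<and> mdist m x (e (p x)) < \<epsilon>"
    by (rule e_approximation[OF F \<epsilon>(1)]) (use F(2) in blast)
  then obtain p where p: "\<And>x. x \<in> F \<Longrightarrow> p x \<in> L.Q" "\<And>x. x \<in> F \<Longrightarrow> mdist m x (e (p x)) < \<epsilon>"
    by metis
  have "finite (p ` F)" "p ` F \<subseteq> L.Q" using F p by auto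
  then obtain k where k: "bij_betw k L.Q L.Q" "\<And>x y. x \<in> L.Q \<Longrightarrow> y \<in> L.Q \<Longrightarrow> L.d (k x) (k y) = L.d x y"
    "\<And>x y. x \<in> p ` F \<Longrightarrow> y \<in> p ` F \<Longrightarrow>
      (k x, k y) \<in> pullback_order L.Q e r \<longleftrightarrow> (x, y) \<in> pullback_order L.Q e r'"
    using L.convex_orders_match[OF _ _ pullback_e_convex[OF r] pullback_e_convex[OF r'], of "p ` F"] by metis
  obtain K where K: "K \<in> G" "\<And>p. p \<in> L.Q \<Longrightarrow> K (e p) = e (k p)"
    using e_extend[OF k(1,2)] by blast
  have kQ: "k x \<in> L.Q" if "x \<in> L.Q" for x using k(1) that by (auto simp: bij_betw_def)
  \<comment> \<open>The action pulls back along the inverse, so it is the inverse of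
    \<open>K\<close> that acts by pulling back along \<open>K\<close>.\<close>
  define g where "g = restrict (inv_into X K) X"
  have g: "g \<in> G" unfolding g_def by (rule restrict_inv_isometry[OF K(1)])
  have ginv: "inv_into X g x = K x" if "x \<in> X" for x
    using isometriesD(9)[OF g isometriesD(5)[OF K(1) that]] isometriesD(5,9)[OF K(1) that] by (simp add: g_def)
  have "(x, y) \<in> cLO_action m g r \<longleftrightarrow> (x, y) \<in> r'" if xy: "x \<in> F" "y \<in> F" for x y
  proof (cases "x = y")
    case True
    then show ?thesis
      using convex_orderD(2)[OF convex_order_of_cLO] cLO_action_closed g r r' by blast
  next
    case False
    have X: "x \<in> X" "y \<in> X" using xy F by auto
    have D: "mdist m x (e (p x)) < mdist m x y" "mdist m y (e (p y)) < mdist m x y"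
      using p(2)[OF xy(1)] p(2)[OF xy(2)] \<epsilon>(2)[OF xy False] by auto
    have "(x, y) \<in> cLO_action m g r \<longleftrightarrow> (K x, K y) \<in> r"
      using X by (simp add: cLO_action_mem[OF r] ginv)
    also have "\<dots> \<longleftrightarrow> (K (e (p x)), K (e (p y))) \<in> r"
      by (rule convex_order_move[OF convex_order_of_cLO[OF r]])
        (use X xy p D e_mem isometriesD(5,6)[OF K(1)] in auto)
    also have "\<dots> \<longleftrightarrow> (k (p x), k (p y)) \<in> pullback_order L.Q e r"
      using K(2) kQ p(1) xy by (simp add: pullback_order_def)
    also have "\<dots> \<longleftrightarrow> (p x, p y) \<in> pullback_order L.Q e r'" using k(3) xy by blast
    also have "\<dots> \<longleftrightarrow> (e (p x), e (p y)) \<in> r'" using p(1) xy by (simp add: pullback_order_def)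
    also have "\<dots> \<longleftrightarrow> (x, y) \<in> r'"
      by (rule convex_order_move[OF convex_order_of_cLO[OF r'], symmetric])
        (use X xy p D e_mem in auto)
    finally show ?thesis .
  qed
  then show ?thesis using g by blast
qed

lemma minimal_flow_cLO: "minimal_flow (iso_group m) (iso_topology m T) (cLO_topology m) (cLO_action m)"
proof -
  interpret flow "iso_group m" "iso_topology m T" "cLO_topology m" "cLO_action m"
    by (rule flow_cLO) (use lex_ext_cLO in blast)
  show ?thesis
  proof
    fix r assume "r \<in> topspace (cLO_topology m)"
    then have r: "r \<in> cLO m" by (simp add: topspace_cLO)
    have "r' \<in> (cLO_topology m) closure_of (orbit (iso_group m) (cLO_action m) r)" if r': "r' \<in> cLO m" for r'
      unfolding in_closure_of topspace_cLO
    proof (intro conjI allI impI r')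
      fix U assume U: "r' \<in> U \<and> openin (cLO_topology m) U"
      then obtain F where F: "finite F" "F \<subseteq> X" "\<forall>s\<in>cLO m. s \<inter> F \<times> F = r' \<inter> F \<times> F \<longrightarrow> s \<in> U"
        unfolding openin_cLO by meson
      obtain g where g: "g \<in> G" "cLO_action m g r \<inter> F \<times> F = r' \<inter> F \<times> F"
        using orbit_approximates[OF r r' F(1,2)] by blast
      then have "cLO_action m g r \<in> U" using F(3) cLO_action_closed[OF g(1) r] by blast
      then show "\<exists>s. s \<in> orbit (iso_group m) (cLO_action m) r \<and> s \<in> U"
        using g(1) unfolding orbit_def by auto
    qed
    moreover have "(cLO_topology m) closure_of (orbit (iso_group m) (cLO_action m) r) \<subseteq> topspace (cLO_topology m)"
      by (rule closure_of_subset_topspace)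
    ultimately show "(cLO_topology m) closure_of (orbit (iso_group m) (cLO_action m) r) = topspace (cLO_topology m)"
      by (auto simp: topspace_cLO)
  qed
qed

end

section \<open>A point fixed by the stabilizer of the lexicographic order\<close>

lemma compact_space_family_Int:
  assumes "compact_space Y" "\<And>i. i \<in> I \<Longrightarrow> closedin Y (C i)"
    and "\<And>J. finite J \<Longrightarrow> J \<subseteq> I \<Longrightarrow> \<exists>y\<in>topspace Y. \<forall>i\<in>J. y \<in> C i"
  shows "\<exists>y\<in>topspace Y. \<forall>i\<in>I. y \<in> C i"
proof -
  \<comment> \<open>Adding the whole space covers the empty family and places the common point in
    \<open>topspace Y\<close>.\<close>
  let ?U = "insert (topspace Y) (C ` I)"
  have "\<Inter>?U \<noteq> {}"
  proof (rule assms(1)[unfolded compact_space_fip, rule_format], intro conjI allI impI ballI)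
    show "closedin Y D" if "D \<in> ?U" for D using that assms(2) by auto
    fix \<F> assume \<F>: "finite \<F> \<and> \<F> \<subseteq> ?U"
    then have "finite (\<F> - {topspace Y})" "\<F> - {topspace Y} \<subseteq> C ` I" by auto
    then obtain J where J: "finite J" "J \<subseteq> I" "\<F> - {topspace Y} = C ` J"
      by (meson finite_subset_image)
    obtain y where y: "y \<in> topspace Y" "\<forall>i\<in>J. y \<in> C i" using assms(3)[OF J(1,2)] by blast
    have "y \<in> D" if "D \<in> \<F>" for D
    proof (cases "D = topspace Y")
      case False
      then have "D \<in> C ` J" using that J(3) by blast
      then show ?thesis using y(2) by blast
    qed (use y(1) in simp)
    then show "\<Inter>\<F> \<noteq> {}" by blast
  qed
  then show ?thesis by auto
qed

context dense_QS
begin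

definition isometry_QS :: "((real \<Rightarrow> rat) \<Rightarrow> real \<Rightarrow> rat) \<Rightarrow> bool"
  where "isometry_QS k \<longleftrightarrow> bij_betw k L.Q L.Q \<and> (\<forall>p\<in>L.Q. \<forall>q\<in>L.Q. L.d (k p) (k q) = L.d p q)"

text \<open>For isometries of the dense copy the choice is unique by \<open>isometries_eqI\<close>,
  which is why extending respects composition.\<close>

definition extension :: "((real \<Rightarrow> rat) \<Rightarrow> real \<Rightarrow> rat) \<Rightarrow> 'a \<Rightarrow> 'a"
  where "extension k = (SOME g. g \<in> G \<and> (\<forall>p\<in>L.Q. g (e p) = e (k p)))"

lemma isometry_QS_mem: "isometry_QS k \<Longrightarrow> p \<in> L.Q \<Longrightarrow> k p \<in> L.Q"
  by (auto simp: isometry_QS_def bij_betw_def)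

lemma isometry_QS_comp: "isometry_QS k \<Longrightarrow> isometry_QS l \<Longrightarrow> isometry_QS (k \<circ> l)"
  using isometry_QS_mem[of l] by (auto simp: isometry_QS_def intro: bij_betw_trans)

lemma isometry_QS_node_map: "s \<in> S \<Longrightarrow> \<phi> \<in> AutQ \<Longrightarrow> isometry_QS (node_map s w \<phi>)"
  by (simp add: isometry_QS_def L.node_map_bij L.node_map_dist AutQ_bij)

lemma isometry_QS_id: "isometry_QS id"
  by (simp add: isometry_QS_def bij_betw_def)

lemma isometry_QS_node_group: "g \<in> L.node_group \<Longrightarrow> isometry_QS g"
proof (induction rule: L.node_group.induct)
  case node_id
  show ?case by (rule isometry_QS_id)
next
  case (node_step g s \<phi> w)
  show ?case by (intro isometry_QS_comp isometry_QS_node_map node_step)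
qed

lemma extension:
  assumes "isometry_QS k"
  shows "extension k \<in> G" "p \<in> L.Q \<Longrightarrow> extension k (e p) = e (k p)"
proof -
  have "\<exists>g. g \<in> G \<and> (\<forall>p\<in>L.Q. g (e p) = e (k p))"
    using e_extend[of k] assms unfolding isometry_QS_def by blast
  then have "extension k \<in> G \<and> (\<forall>p\<in>L.Q. extension k (e p) = e (k p))"
    unfolding extension_def by (rule someI_ex)
  then show "extension k \<in> G" "p \<in> L.Q \<Longrightarrow> extension k (e p) = e (k p)" by blast+
qed

lemma isometries_eqI:
  assumes g: "g \<in> G" and h: "h \<in> G" and eq: "\<And>p. p \<in> L.Q \<Longrightarrow> g (e p) = h (e p)"
  shows "g = h"
proof (rule extensionalityI[of _ X])
  fix x assume x: "x \<in> X"
  show "g x = h x"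
  proof (rule near_eqI)
    fix \<epsilon> :: real assume \<epsilon>: "\<epsilon> > 0"
    obtain p where p: "p \<in> L.Q" "near disc m \<epsilon> (e p) x" using e_dense[OF x \<epsilon>] by blast
    have "near disc m \<epsilon> (g x) (g (e p))" "near disc m \<epsilon> (h (e p)) (h x)"
      using near_iso[OF g] near_iso[OF h] near_sym p x e_mem by blast+
    then show "near disc m \<epsilon> (g x) (h x)"
      using eq[OF p(1)] near_trans isometriesD(5)[OF g] isometriesD(5)[OF h] x e_mem p(1) by metis
  qed (use isometriesD(5)[OF g x] isometriesD(5)[OF h x] in auto)
qed (use isometriesD(1) g h in auto)

lemma extension_comp:
  assumes "isometry_QS k" "isometry_QS l"
  shows "extension (k \<circ> l) = extension k \<otimes>\<^bsub>iso_group m\<^esub> extension l"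
proof -
  note k = extension[OF assms(1)] and l = extension[OF assms(2)] and kl = extension[OF isometry_QS_comp[OF assms]]
  have "extension (k \<circ> l) = compose X (extension k) (extension l)"
    by (rule isometries_eqI[OF kl(1) compose_isometry[OF k(1) l(1)]])
      (use k l kl isometry_QS_mem[OF assms(2)] e_mem in \<open>auto simp: compose_eq\<close>)
  then show ?thesis using k(1) l(1) by (simp add: mult_iso_group)
qed

lemma extension_id: "extension id = \<one>\<^bsub>iso_group m\<^esub>"
proof (rule isometries_eqI[OF extension(1)[OF isometry_QS_id]])
  show "\<one>\<^bsub>iso_group m\<^esub> \<in> G"
    using monoid.one_closed[OF group.is_monoid[OF group_iso_group]] by simp
  show "extension id (e p) = \<one>\<^bsub>iso_group m\<^esub> (e p)" if "p \<in> L.Q" for p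
    using extension(2)[OF isometry_QS_id that] e_mem[OF that] by (simp add: one_iso_group)
qed

end

section \<open>Fixed points of single nodes and levels in an arbitrary flow\<close>

locale dense_QS_flow = dense_QS S m T disc e + A: flow "iso_group m" "iso_topology m T" Y \<psi>
  for S and m :: "'a metric" and T :: "'a topology" and disc and e and Y :: "'y topology" and \<psi>
begin

lemma act_in: "g \<in> G \<Longrightarrow> y \<in> topspace Y \<Longrightarrow> \<psi> g y \<in> topspace Y"
  using A.element_image by simp

lemma act_mult: "g \<in> G \<Longrightarrow> h \<in> G \<Longrightarrow> y \<in> topspace Y \<Longrightarrow> \<psi> (g \<otimes>\<^bsub>iso_group m\<^esub> h) y = \<psi> g (\<psi> h y)"
  using A.composition_rule by simp

lemma act_one: "y \<in> topspace Y \<Longrightarrow> \<psi> \<one>\<^bsub>iso_group m\<^esub> y = y"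
  by (metis A.id_eq_one restrict_apply)

lemma act_cont:
  assumes g: "g \<in> G"
  shows "continuous_map Y Y (\<psi> g)"
proof -
  have "continuous_map Y (prod_topology (iso_topology m T) Y) (\<lambda>y. (g, y))"
    using g by (simp add: continuous_map_pairwise o_def topspace_iso_topology)
  from continuous_map_compose[OF this A.continuous_action]
  show ?thesis by (simp add: o_def)
qed

text \<open>Joint continuity at the pair of the unit and \<open>y\<close>. It is used twice: for the
  continuity assumption of \<open>AutQ_fixed_point\<close> and for the uniqueness of limits in
  \<open>limit_set_unique\<close>.\<close>

lemma act_small:
  assumes U: "openin Y U" and y: "y \<in> U"
  shows "\<exists>N F \<epsilon>. openin Y N \<and> y \<in> N \<and> finite F \<and> F \<subseteq> X \<and> \<epsilon> > 0 \<and>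
    (\<forall>g\<in>G. (\<forall>x\<in>F. near disc m \<epsilon> x (g x)) \<longrightarrow> (\<forall>u\<in>N. \<psi> g u \<in> U))"
proof -
  let ?P = "prod_topology (iso_topology m T) Y"
  have yY: "y \<in> topspace Y" using openin_subset[OF U] y by blast
  have one: "\<one>\<^bsub>iso_group m\<^esub> \<in> G" using A.one_closed by simp
  have "openin ?P {p \<in> topspace ?P. (case p of (g, x) \<Rightarrow> \<psi> g x) \<in> U}"
    using A.continuous_action U by (rule openin_continuous_map_preimage)
  moreover have "(\<one>\<^bsub>iso_group m\<^esub>, y) \<in> {p \<in> topspace ?P. (case p of (g, x) \<Rightarrow> \<psi> g x) \<in> U}"
    using one yY y act_one by (simp add: topspace_iso_topology)
  ultimately obtain V N where VN: "openin (iso_topology m T) V" "openin Y N" "\<one>\<^bsub>iso_group m\<^esub> \<in> V" "y \<in> N"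
    "V \<times> N \<subseteq> {p \<in> topspace ?P. (case p of (g, x) \<Rightarrow> \<psi> g x) \<in> U}"
    unfolding openin_prod_topology_alt by meson
  obtain F \<epsilon> where F: "finite F" "F \<subseteq> X" "\<epsilon> > 0"
    "\<forall>h\<in>G. (\<forall>x\<in>F. near disc m \<epsilon> (\<one>\<^bsub>iso_group m\<^esub> x) (h x)) \<longrightarrow> h \<in> V"
    using VN(1,3) unfolding openin_iso_topology by meson
  have "\<psi> g u \<in> U" if "g \<in> G" "\<forall>x\<in>F. near disc m \<epsilon> x (g x)" "u \<in> N" for g u
  proof -
    have "\<forall>x\<in>F. near disc m \<epsilon> (\<one>\<^bsub>iso_group m\<^esub> x) (g x)"
      using that(2) F(2) by (auto simp: one_iso_group)
    then have "g \<in> V" using F(4) that(1) by blast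
    then have "(g, u) \<in> V \<times> N" using that(3) by simp
    from subsetD[OF VN(5) this] show ?thesis by simp
  qed
  then show ?thesis using VN(2,4) F(1-3) by blast
qed

definition node_fix :: "real \<Rightarrow> (real \<Rightarrow> rat) \<Rightarrow> 'y set"
  where "node_fix s w = {y \<in> topspace Y. \<forall>\<phi>\<in>AutQ. \<psi> (extension (node_map s w \<phi>)) y = y}"

lemma closedin_node_fix:
  assumes s: "s \<in> S"
  shows "closedin Y (node_fix s w)"
proof -
  have "openin Y (topspace Y - node_fix s w)"
  proof (subst openin_subopen, rule ballI)
    fix y assume "y \<in> topspace Y - node_fix s w"
    then obtain \<phi> where \<phi>: "\<phi> \<in> AutQ" "\<psi> (extension (node_map s w \<phi>)) y \<noteq> y" and y: "y \<in> topspace Y"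
      by (auto simp: node_fix_def)
    let ?k = "extension (node_map s w \<phi>)"
    have k: "?k \<in> G" using extension(1) isometry_QS_node_map s \<phi>(1) by blast
    obtain U V where UV: "openin Y U" "openin Y V" "\<psi> ?k y \<in> U" "y \<in> V" "disjnt U V"
      using A.Hausdorff act_in[OF k y] y \<phi>(2) unfolding Hausdorff_space_def by meson
    let ?W = "{u \<in> topspace Y. \<psi> ?k u \<in> U} \<inter> V"
    have "openin Y ?W"
      using openin_continuous_map_preimage[OF act_cont[OF k] UV(1)] UV(2) by blast
    moreover have "y \<in> ?W" using y UV by blast
    moreover have "?W \<subseteq> topspace Y - node_fix s w"
    proof
      fix u assume u: "u \<in> ?W"
      then have "\<psi> ?k u \<noteq> u" using UV(5) by (auto simp: disjnt_iff)
      then show "u \<in> topspace Y - node_fix s w" using u \<phi>(1) by (auto simp: node_fix_def)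
    qed
    ultimately show "\<exists>W. openin Y W \<and> y \<in> W \<and> W \<subseteq> topspace Y - node_fix s w" by blast
  qed
  then show ?thesis by (simp add: closedin_def node_fix_def)
qed

lemma act_comp_nodes:
  assumes "s \<in> S" "t \<in> S" "\<phi> \<in> AutQ" "\<rho> \<in> AutQ" "y \<in> topspace Y"
  shows "\<psi> (extension (node_map s w \<phi>)) (\<psi> (extension (node_map t v \<rho>)) y) =
    \<psi> (extension (node_map s w \<phi> \<circ> node_map t v \<rho>)) y"
  using assms extension(1)[OF isometry_QS_node_map]
  by (simp add: extension_comp isometry_QS_node_map act_mult)

definition level_invariant :: "real \<Rightarrow> 'y set \<Rightarrow> bool"
  where "level_invariant s Z \<longleftrightarrow> (\<forall>w. \<forall>\<phi>\<in>AutQ. \<forall>y\<in>Z. \<psi> (extension (node_map s w \<phi>)) y \<in> Z)"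

lemma level_invariantD:
  "level_invariant s Z \<Longrightarrow> \<phi> \<in> AutQ \<Longrightarrow> y \<in> Z \<Longrightarrow> \<psi> (extension (node_map s w \<phi>)) y \<in> Z"
  by (simp add: level_invariant_def)

text \<open>Pestov's theorem for the copy at one node. It is applied to a closed invariant set and
  not just to \<open>Y\<close>, so that fixed points of several nodes can be found in
  succession.\<close>

lemma node_fixed_point:
  assumes s: "s \<in> S" and Z: "closedin Y Z" "Z \<noteq> {}" and inv: "level_invariant s Z"
  shows "Z \<inter> node_fix s w \<noteq> {}"
proof -
  define \<alpha> where "\<alpha> \<phi> = \<psi> (extension (node_map s w \<phi>))" for \<phi>
  let ?Z = "subtopology Y Z"
  have ZY: "Z \<subseteq> topspace Y" using closedin_subset[OF Z(1)] .
  then have top: "topspace ?Z = Z" by auto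
  have iso: "isometry_QS (node_map s w \<phi>)" if "\<phi> \<in> AutQ" for \<phi>
    using isometry_QS_node_map s that by blast
  have "\<exists>z\<in>topspace ?Z. \<forall>\<phi>\<in>AutQ. \<alpha> \<phi> z = z"
  proof (rule AutQ_fixed_point)
    show "compact_space ?Z"
      using closedin_compact_space[OF A.compact Z(1)] by (simp add: compact_space_subtopology)
    show "Hausdorff_space ?Z" using A.Hausdorff by (rule Hausdorff_space_subtopology)
    show "topspace ?Z \<noteq> {}" using top Z(2) by simp
    show "\<alpha> (\<phi> \<circ> \<rho>) z = \<alpha> \<phi> (\<alpha> \<rho> z)" if "\<phi> \<in> AutQ" "\<rho> \<in> AutQ" "z \<in> topspace ?Z" for \<phi> \<rho> z
    proof -
      have "node_map s w \<phi> \<circ> node_map s w \<rho> = node_map s w (\<phi> \<circ> \<rho>)" by (simp add: fun_eq_iff node_map_comp)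
      then show ?thesis unfolding \<alpha>_def using act_comp_nodes[OF s s that(1,2)] that(3) by simp
    qed
    show "continuous_map ?Z ?Z (\<alpha> \<phi>)" if \<phi>: "\<phi> \<in> AutQ" for \<phi>
    proof -
      have "continuous_map ?Z Y (\<alpha> \<phi>)"
        unfolding \<alpha>_def by (rule continuous_map_from_subtopology[OF act_cont[OF extension(1)[OF iso[OF \<phi>]]]])
      then show ?thesis
        using inv \<phi> by (auto simp: continuous_map_in_subtopology \<alpha>_def level_invariant_def)
    qed
    fix z U assume "openin ?Z U" and z: "z \<in> U"
    then obtain U' where U': "openin Y U'" "U = U' \<inter> Z" by (auto simp: openin_subtopology)
    then have "z \<in> U'" using z by blast
    then obtain N F \<epsilon> where N: "openin Y N" "z \<in> N" "finite F" "F \<subseteq> X" "\<epsilon> > 0"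
      "\<And>g u. g \<in> G \<Longrightarrow> \<forall>x\<in>F. near disc m \<epsilon> x (g x) \<Longrightarrow> u \<in> N \<Longrightarrow> \<psi> g u \<in> U'"
      using act_small[OF U'(1)] by metis
    have "\<exists>p. \<forall>x\<in>F. p x \<in> L.Q \<and> near disc m \<epsilon> (e (p x)) x \<and> mdist m x (e (p x)) < \<epsilon>"
      by (rule e_approximation[OF N(3-5)]) (use N(4) in blast)
    then obtain p where p: "\<And>x. x \<in> F \<Longrightarrow> p x \<in> L.Q" "\<And>x. x \<in> F \<Longrightarrow> near disc m \<epsilon> (e (p x)) x"
      by metis
    \<comment> \<open>The coordinates at \<open>s\<close> of the approximations. If
      \<open>\<phi>\<close> fixes them, then \<open>node_map s w \<phi>\<close> fixes every
      \<open>p x\<close>, so its extension keeps each \<open>x\<close> in \<open>F\<close> within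
      \<open>\<epsilon>\<close> in the sense of \<open>near\<close>.\<close>
    let ?A = "(\<lambda>x. p x s) ` F"
    have "\<alpha> \<phi> y \<in> U" if \<phi>: "\<phi> \<in> AutQ" "\<forall>a\<in>?A. \<phi> a = a" and y: "y \<in> N \<inter> Z" for \<phi> y
    proof -
      let ?k = "extension (node_map s w \<phi>)"
      note k = extension[OF iso[OF \<phi>(1)]]
      have "near disc m \<epsilon> x (?k x)" if x: "x \<in> F" for x
      proof -
        have "node_map s w \<phi> (p x) t = p x t" for t
          using \<phi>(2) x by (cases "t = s \<and> trunc s (p x) = w") (auto simp: node_map_at node_map_other)
        then have "node_map s w \<phi> (p x) = p x" by blast
        then have fixed: "?k (e (p x)) = e (p x)" using k(2)[OF p(1)[OF x]] by simp
        have X: "x \<in> X" "e (p x) \<in> X" using x N(4) p(1) e_mem by auto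
        have "near disc m \<epsilon> (?k (e (p x))) (?k x)" using near_iso[OF k(1)] X p(2)[OF x] by blast
        then show ?thesis
          using near_trans[OF X isometriesD(5)[OF k(1) X(1)] near_sym[OF p(2)[OF x]]] fixed by simp
      qed
      then have "\<alpha> \<phi> y \<in> U'" unfolding \<alpha>_def using N(6)[OF k(1)] y by blast
      moreover have "\<alpha> \<phi> y \<in> Z" using inv \<phi>(1) y by (auto simp: \<alpha>_def level_invariant_def)
      ultimately show ?thesis using U'(2) by blast
    qed
    moreover have "openin ?Z (N \<inter> Z)" using N(1) by (auto simp: openin_subtopology)
    moreover have "z \<in> N \<inter> Z" using N(2) z U' by blast
    moreover have "finite ?A" using N(3) by simp
    ultimately show "\<exists>V A. openin ?Z V \<and> z \<in> V \<and> finite A \<and>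
        (\<forall>\<phi>\<in>AutQ. (\<forall>a\<in>A. \<phi> a = a) \<longrightarrow> (\<forall>y\<in>V. \<alpha> \<phi> y \<in> U))" by metis
  qed
  then show ?thesis using top ZY by (auto simp: node_fix_def \<alpha>_def)
qed

text \<open>The copy at \<open>w\<close> does not move its own fixed points, and copies at other
  nodes of the level commute with it and hence preserve them.\<close>

lemma level_invariant_node_fix_same:
  assumes s: "s \<in> S" and Z: "level_invariant s Z"
  shows "level_invariant s (Z \<inter> node_fix s w)"
  unfolding level_invariant_def
proof (intro allI ballI)
  fix v \<phi> y assume \<phi>: "\<phi> \<in> AutQ" and y: "y \<in> Z \<inter> node_fix s w"
  let ?k = "extension (node_map s v \<phi>)"
  have yY: "y \<in> topspace Y" using y by (auto simp: node_fix_def)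
  have k: "?k \<in> G" using extension(1) isometry_QS_node_map s \<phi> by blast
  have "\<psi> ?k y \<in> node_fix s w"
  proof (cases "v = w")
    case True
    then show ?thesis using y \<phi> by (auto simp: node_fix_def)
  next
    case False
    have "\<psi> (extension (node_map s w \<rho>)) (\<psi> ?k y) = \<psi> ?k y" if \<rho>: "\<rho> \<in> AutQ" for \<rho>
    proof -
      have "node_map s w \<rho> \<circ> node_map s v \<phi> = node_map s v \<phi> \<circ> node_map s w \<rho>"
        by (rule ext) (use node_map_commute[of w v] False in simp)
      then have "\<psi> (extension (node_map s w \<rho>)) (\<psi> ?k y) = \<psi> ?k (\<psi> (extension (node_map s w \<rho>)) y)"
        using act_comp_nodes[OF s s] \<phi> \<rho> yY by metis
      then show ?thesis using y \<rho> by (auto simp: node_fix_def)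
    qed
    then show ?thesis using act_in[OF k yY] by (simp add: node_fix_def)
  qed
  then show "\<psi> ?k y \<in> Z \<inter> node_fix s w" using Z \<phi> y by (auto simp: level_invariant_def)
qed

text \<open>By \<open>node_map_normalises\<close> a higher map conjugates the copy at one node of
  level \<open>s\<close> to the copy at another. It may move the fixed points of a single node, but
  it preserves the intersection over all nodes of the level.\<close>

lemma level_invariant_node_fix_lower:
  assumes s: "s \<in> S" and t: "t \<in> S" and st: "s < t"
  shows "level_invariant t (\<Inter>w. node_fix s w)"
  unfolding level_invariant_def
proof (intro allI ballI)
  fix v \<phi> y assume \<phi>: "\<phi> \<in> AutQ" and y: "y \<in> (\<Inter>w. node_fix s w)"
  let ?k = "extension (node_map t v \<phi>)"
  have yY: "y \<in> topspace Y" using y by (auto simp: node_fix_def)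
  have k: "?k \<in> G" using extension(1) isometry_QS_node_map t \<phi> by blast
  have bij: "bij \<phi>" using \<phi> by (rule AutQ_bij)
  have "\<psi> (extension (node_map s w \<rho>)) (\<psi> ?k y) = \<psi> ?k y" if \<rho>: "\<rho> \<in> AutQ" for \<rho> w
  proof -
    \<comment> \<open>The node that the higher map takes to \<open>w\<close>.\<close>
    define w' where "w' = node_map t v (inv_into UNIV \<phi>) w"
    have "\<phi> \<circ> inv_into UNIV \<phi> = id" using bij by (auto simp: fun_eq_iff bij_def surj_f_inv_f)
    then have w': "node_map t v \<phi> w' = w"
      unfolding w'_def node_map_comp by (simp add: node_map_def level_map_id)
    have "node_map s w \<rho> \<circ> node_map t v \<phi> = node_map t v \<phi> \<circ> node_map s w' \<rho>"
      by (rule ext) (use node_map_normalises[OF st bij, of v w' \<rho>] w' in simp)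
    then have "\<psi> (extension (node_map s w \<rho>)) (\<psi> ?k y) = \<psi> ?k (\<psi> (extension (node_map s w' \<rho>)) y)"
      using act_comp_nodes[OF s t \<rho> \<phi> yY] act_comp_nodes[OF t s \<phi> \<rho> yY] by metis
    then show ?thesis using y \<rho> by (auto simp: node_fix_def)
  qed
  then show "\<psi> ?k y \<in> (\<Inter>w. node_fix s w)" using act_in[OF k yY] by (simp add: node_fix_def)
qed

text \<open>Closedness and invariance under the level persist when the fixed points of one more node
  are cut out, so any finitely many nodes have a common fixed point in \<open>Z\<close>; compactness
  gives all of them.\<close>

lemma level_fixed_point:
  assumes s: "s \<in> S" and Z: "closedin Y Z" "Z \<noteq> {}" "level_invariant s Z"
  shows "Z \<inter> (\<Inter>w. node_fix s w) \<noteq> {}"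
proof -
  have fin: "Z \<inter> (\<Inter>w\<in>B. node_fix s w) \<noteq> {} \<and> closedin Y (Z \<inter> (\<Inter>w\<in>B. node_fix s w)) \<and>
      level_invariant s (Z \<inter> (\<Inter>w\<in>B. node_fix s w))" if "finite B" for B
    using that
  proof induction
    case empty
    then show ?case using Z by simp
  next
    case (insert w B)
    have eq: "Z \<inter> (\<Inter>w\<in>insert w B. node_fix s w) = Z \<inter> (\<Inter>w\<in>B. node_fix s w) \<inter> node_fix s w" by blast
    show ?case
      unfolding eq
      using insert.IH node_fixed_point[OF s] level_invariant_node_fix_same[OF s] closedin_node_fix[OF s] closedin_Int
      by blast
  qed
  have "\<exists>y\<in>topspace Y. \<forall>w\<in>UNIV. y \<in> Z \<inter> node_fix s w"
  proof (rule compact_space_family_Int[OF A.compact])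
    show "closedin Y (Z \<inter> node_fix s w)" for w using Z(1) closedin_node_fix[OF s] by (rule closedin_Int)
    fix B :: "(real \<Rightarrow> rat) set" assume "finite B"
    then obtain y where "y \<in> Z \<inter> (\<Inter>w\<in>B. node_fix s w)" using fin by blast
    moreover have "Z \<subseteq> topspace Y" using closedin_subset[OF Z(1)] .
    ultimately show "\<exists>y\<in>topspace Y. \<forall>w\<in>B. y \<in> Z \<inter> node_fix s w" by blast
  qed
  then show ?thesis by blast
qed

text \<open>For finitely many levels by induction upwards: what the lower levels fix is a closed set
  invariant under the new level, so \<open>level_fixed_point\<close> applies to it. Compactness
  passes to all of \<open>S\<close>.\<close>

lemma common_fixed_point: "\<exists>y\<in>topspace Y. \<forall>s\<in>S. \<forall>w. y \<in> node_fix s w"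
proof -
  have fin: "\<exists>y\<in>topspace Y. \<forall>s\<in>A. \<forall>w. y \<in> node_fix s w" if "finite A" "A \<subseteq> S" for A
    using that
  proof (induction A rule: finite_linorder_max_induct)
    case empty
    then show ?case using A.nonempty by blast
  next
    case (insert t A)
    define Z where "Z = topspace Y \<inter> (\<Inter>s\<in>A. \<Inter>w. node_fix s w)"
    have "Z \<noteq> {}" using insert by (auto simp: Z_def)
    moreover have "closedin Y Z"
    proof -
      have lv: "closedin Y (\<Inter>w. node_fix s w)" if "s \<in> A" for s
        using closedin_node_fix insert.prems that by (intro closedin_INT) auto
      have "closedin Y (\<Inter>s\<in>A. \<Inter>w. node_fix s w)" if ne: "A \<noteq> {}"
        by (rule closedin_INT[OF ne lv])
      then show ?thesis unfolding Z_def by (cases "A = {}") (auto intro: closedin_Int)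
    qed
    moreover have "level_invariant t Z"
      unfolding level_invariant_def
    proof (intro allI ballI)
      fix v \<phi> y assume \<phi>: "\<phi> \<in> AutQ" and y: "y \<in> Z"
      have "\<psi> (extension (node_map t v \<phi>)) y \<in> (\<Inter>w. node_fix s w)" if "s \<in> A" for s
      proof -
        have "y \<in> (\<Inter>w. node_fix s w)" using y that unfolding Z_def by blast
        moreover have "s \<in> S" "t \<in> S" "s < t" using that insert.prems insert.hyps by auto
        then have "level_invariant t (\<Inter>w. node_fix s w)" by (rule level_invariant_node_fix_lower)
        ultimately show ?thesis using level_invariantD \<phi> by metis
      qed
      moreover have "\<psi> (extension (node_map t v \<phi>)) y \<in> topspace Y"
        using act_in extension(1) isometry_QS_node_map insert.prems \<phi> y by (simp add: Z_def)
      ultimately show "\<psi> (extension (node_map t v \<phi>)) y \<in> Z" unfolding Z_def by blast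
    qed
    ultimately have "Z \<inter> (\<Inter>w. node_fix t w) \<noteq> {}" using level_fixed_point insert.prems by blast
    then obtain y where y: "y \<in> Z" "\<And>w. y \<in> node_fix t w" by blast
    show ?case
    proof (intro bexI[of _ y] ballI allI)
      show "y \<in> topspace Y" using y(1) by (simp add: Z_def)
      show "y \<in> node_fix s w" if "s \<in> insert t A" for s w
        using that y by (auto simp: Z_def)
    qed
  qed
  have "\<exists>y\<in>topspace Y. \<forall>s\<in>S. y \<in> (\<Inter>w. node_fix s w)"
  proof (rule compact_space_family_Int[OF A.compact])
    show "closedin Y (\<Inter>w. node_fix s w)" if "s \<in> S" for s
      using closedin_node_fix[OF that] by (intro closedin_INT) auto
    show "\<exists>y\<in>topspace Y. \<forall>s\<in>J. y \<in> (\<Inter>w. node_fix s w)" if "finite J" "J \<subseteq> S" for J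
      using fin[OF that] by simp
  qed
  then show ?thesis by simp
qed

lemma node_group_fixed_point: "\<exists>y\<in>topspace Y. \<forall>g\<in>L.node_group. \<psi> (extension g) y = y"
proof -
  obtain y where y: "y \<in> topspace Y" "\<And>s w. s \<in> S \<Longrightarrow> y \<in> node_fix s w"
    using common_fixed_point by blast
  have "\<psi> (extension g) y = y" if "g \<in> L.node_group" for g
    using that
  proof induction
    case node_id
    show ?case unfolding extension_id by (rule act_one[OF y(1)])
  next
    case (node_step g s \<phi> w)
    have iso: "isometry_QS g" "isometry_QS (node_map s w \<phi>)"
      using node_step isometry_QS_node_group isometry_QS_node_map by blast+
    have "\<psi> (extension (node_map s w \<phi>)) y = y"
      using y(2)[OF node_step(2), of w] node_step(3) by (auto simp: node_fix_def)
    then show ?case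
      unfolding extension_comp[OF iso]
      using node_step.IH extension(1)[OF iso(1)] extension(1)[OF iso(2)] y(1) by (simp add: act_mult)
  qed
  then show ?thesis using y(1) by blast
qed


section \<open>Universality\<close>

text \<open>If \<open>g\<close> and \<open>h\<close> take the lexicographic order to orders that agree on \<open>F\<close>, then homogeneity
  provides \<open>k\<close> in the stabilizer of \<open>y0\<close> such that \<open>h k g\<^sup>-\<^sup>1\<close> is close to the identity on \<open>F\<close>.\<close>

lemma agreeing_translates:
  assumes F: "finite F" "F \<subseteq> X" "\<epsilon> > 0" and g: "g \<in> G" and h: "h \<in> G"
    and eq: "cLO_action m g lex_ext \<inter> F \<times> F = cLO_action m h lex_ext \<inter> F \<times> F"
    and y0: "y0 \<in> topspace Y" "\<And>k. k \<in> L.node_group \<Longrightarrow> \<psi> (extension k) y0 = y0"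
  shows "\<exists>l\<in>G. (\<forall>x\<in>F. near disc m \<epsilon> x (l x)) \<and> \<psi> l (\<psi> g y0) = \<psi> h y0"
proof -
  let ?u = "inv_into X g" and ?v = "inv_into X h"
  obtain \<epsilon>0 where \<epsilon>0: "\<epsilon>0 > 0" "\<And>x y. x \<in> F \<Longrightarrow> y \<in> F \<Longrightarrow> x \<noteq> y \<Longrightarrow> \<epsilon>0 \<le> mdist m x y"
    using finite_separation[OF F(1,2)] by blast
  \<comment> \<open>At most \<open>\<epsilon>\<close> for the conclusion, and at most the distances
    within \<open>F\<close> so that approximations keep distances and order.\<close>
  define \<delta> where "\<delta> = min \<epsilon> \<epsilon>0"
  have \<delta>: "\<delta> > 0" "\<delta> \<le> \<epsilon>" "\<And>x y. x \<in> F \<Longrightarrow> y \<in> F \<Longrightarrow> x \<noteq> y \<Longrightarrow> \<delta> \<le> mdist m x y"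
    using F(3) \<epsilon>0 by (auto simp: \<delta>_def min_le_iff_disj)
  have u: "?u x \<in> X" and v: "?v x \<in> X" and FX: "x \<in> X" if "x \<in> F" for x
    using isometriesD(7)[OF g, of x] isometriesD(7)[OF h, of x] F(2) that by auto
  have uv: "mdist m (?u x) (?u y) = mdist m x y" "mdist m (?v x) (?v y) = mdist m x y" if "x \<in> F" "y \<in> F" for x y
    using isometriesD(6)[OF g u u, of x y] isometriesD(6)[OF h v v, of x y]
      isometriesD(8)[OF g FX] isometriesD(8)[OF h FX] that by auto
  have "\<exists>p. \<forall>x\<in>F. p x \<in> L.Q \<and> near disc m \<delta> (e (p x)) (?u x) \<and> mdist m (?u x) (e (p x)) < \<delta>"
    by (rule e_approximation[OF F(1,2) \<delta>(1) u])
  then obtain p where p: "\<And>x. x \<in> F \<Longrightarrow> p x \<in> L.Q" "\<And>x. x \<in> F \<Longrightarrow> near disc m \<delta> (e (p x)) (?u x)"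
    "\<And>x. x \<in> F \<Longrightarrow> mdist m (?u x) (e (p x)) < \<delta>" by metis
  have "\<exists>q. \<forall>x\<in>F. q x \<in> L.Q \<and> near disc m \<delta> (e (q x)) (?v x) \<and> mdist m (?v x) (e (q x)) < \<delta>"
    by (rule e_approximation[OF F(1,2) \<delta>(1) v])
  then obtain q where q: "\<And>x. x \<in> F \<Longrightarrow> q x \<in> L.Q" "\<And>x. x \<in> F \<Longrightarrow> near disc m \<delta> (e (q x)) (?v x)"
    "\<And>x. x \<in> F \<Longrightarrow> mdist m (?v x) (e (q x)) < \<delta>" by metis
  \<comment> \<open>Stated for any family \<open>w\<close> isometric to \<open>F\<close>, since it
    serves the preimages under \<open>g\<close> as well as those under \<open>h\<close>.\<close>
  have approx: "L.d (a x) (a y) = mdist m x y \<and> ((a x, a y) \<in> L.lex \<longleftrightarrow> (w x, w y) \<in> lex_ext)"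
    if a: "\<And>x. x \<in> F \<Longrightarrow> a x \<in> L.Q" "\<And>x. x \<in> F \<Longrightarrow> mdist m (w x) (e (a x)) < \<delta>"
      and w: "\<And>x. x \<in> F \<Longrightarrow> w x \<in> X" "\<And>x y. x \<in> F \<Longrightarrow> y \<in> F \<Longrightarrow> mdist m (w x) (w y) = mdist m x y"
      and xy: "x \<in> F" "y \<in> F" for a w x y
  proof (cases "x = y")
    case True
    have "mdist m y y = 0" using d_zero FX xy by blast
    moreover have "(a y, a y) \<notin> L.lex" using convex_orderD(2)[OF L.lex_convex] .
    moreover have "(w y, w y) \<notin> lex_ext" using convex_orderD(2)[OF convex_order_of_cLO[OF lex_ext_cLO]] .
    ultimately show ?thesis using True by (simp add: L.d_self)
  next
    case False
    have wX: "w x \<in> X" "w y \<in> X" using w xy by auto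
    have aQ: "a x \<in> L.Q" "a y \<in> L.Q" using a xy by auto
    have lt: "mdist m (w x) (e (a x)) < mdist m (w x) (w y)" "mdist m (w y) (e (a y)) < mdist m (w x) (w y)"
      using a(2)[OF xy(1)] a(2)[OF xy(2)] \<delta>(3)[OF xy False] w(2)[OF xy] by auto
    have "mdist m (e (a x)) (e (a y)) = mdist m (w x) (w y)"
      using d_isosceles2[OF wX(1) e_mem[OF aQ(1)] wX(2) e_mem[OF aQ(2)] lt] .
    moreover have "(w x, w y) \<in> lex_ext \<longleftrightarrow> (a x, a y) \<in> L.lex"
      using lex_ext_iff[OF wX aQ] lt d_comm by metis
    ultimately show ?thesis using e_dist[OF aQ] w(2)[OF xy] by simp
  qed
  have lexuv: "(?u x, ?u y) \<in> lex_ext \<longleftrightarrow> (?v x, ?v y) \<in> lex_ext" if xy: "x \<in> F" "y \<in> F" for x y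
  proof -
    have "(x, y) \<in> cLO_action m g lex_ext \<longleftrightarrow> (x, y) \<in> cLO_action m h lex_ext" using eq xy by blast
    then show ?thesis using FX xy by (simp add: cLO_action_mem[OF lex_ext_cLO])
  qed
  have "\<exists>k\<in>L.node_group. \<forall>x\<in>F. k (p x) = q x"
  proof (rule L.lex_homogeneous[OF F(1) p(1) q(1)])
    fix x y assume xy: "x \<in> F" "y \<in> F"
    have P: "L.d (p x) (p y) = mdist m x y \<and> ((p x, p y) \<in> L.lex \<longleftrightarrow> (?u x, ?u y) \<in> lex_ext)"
      by (rule approx[OF p(1,3) u uv(1) xy])
    have R: "L.d (q x) (q y) = mdist m x y \<and> ((q x, q y) \<in> L.lex \<longleftrightarrow> (?v x, ?v y) \<in> lex_ext)"
      by (rule approx[OF q(1,3) v uv(2) xy])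
    show "L.d (p x) (p y) = L.d (q x) (q y)" using P R by simp
    show "(p x, p y) \<in> L.lex \<longleftrightarrow> (q x, q y) \<in> L.lex" using P R lexuv[OF xy] by blast
  qed
  then obtain k where k: "k \<in> L.node_group" "\<And>x. x \<in> F \<Longrightarrow> k (p x) = q x" by blast
  note K = extension[OF isometry_QS_node_group[OF k(1)]]
  let ?K = "extension k"
  define l where "l = h \<otimes>\<^bsub>iso_group m\<^esub> (?K \<otimes>\<^bsub>iso_group m\<^esub> inv\<^bsub>iso_group m\<^esub> g)"
  have ginv: "inv\<^bsub>iso_group m\<^esub> g \<in> G" using A.inv_closed g by simp
  have Kg: "?K \<otimes>\<^bsub>iso_group m\<^esub> inv\<^bsub>iso_group m\<^esub> g \<in> G" using A.m_closed K(1) ginv by simp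
  have l: "l \<in> G" unfolding l_def using A.m_closed h Kg by simp
  have "near disc m \<epsilon> x (l x)" if x: "x \<in> F" for x
  proof -
    have lx: "l x = h (?K (?u x))"
      using FX[OF x] h Kg K(1) ginv by (simp add: l_def mult_iso_group compose_eq inv_iso_group[OF g])
    have X: "?K (?u x) \<in> X" "?K (e (p x)) \<in> X" "?v x \<in> X"
      using isometriesD(5)[OF K(1)] u v x e_mem p(1) by auto
    have "near disc m \<delta> (?v x) (?K (e (p x)))" using K(2)[OF p(1)[OF x]] k(2)[OF x] near_sym q(2)[OF x] by simp
    moreover have "near disc m \<delta> (?K (e (p x))) (?K (?u x))"
      using near_iso[OF K(1) e_mem[OF p(1)[OF x]] u[OF x]] p(2)[OF x] by blast
    ultimately have "near disc m \<delta> (?v x) (?K (?u x))" using near_trans[OF X(3,2,1)] by blast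
    then have "near disc m \<delta> (h (?v x)) (l x)" unfolding lx using near_iso[OF h X(3,1)] by blast
    then show ?thesis using isometriesD(8)[OF h FX[OF x]] near_mono[OF \<delta>(2)] by simp
  qed
  moreover have "\<psi> l (\<psi> g y0) = \<psi> h y0"
  proof -
    have "\<psi> (inv\<^bsub>iso_group m\<^esub> g) (\<psi> g y0) = y0"
      using act_mult[OF ginv g y0(1)] A.l_inv[of g] g act_one[OF y0(1)] by simp
    then show ?thesis
      unfolding l_def using h Kg K(1) ginv g y0 k(1) act_in by (simp add: act_mult)
  qed
  ultimately show ?thesis using l by blast
qed

text \<open>The intersection of these sets over all finite \<open>F\<close> is the fibre over
  \<open>r\<close> of the closure of the pairs of translates of \<open>lex_ext\<close> and
  \<open>y0\<close>. Each of them depends on \<open>r\<close> only through its restriction to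
  \<open>F\<close>.\<close>

definition limit_set :: "'y \<Rightarrow> 'a set \<Rightarrow> ('a \<times> 'a) set \<Rightarrow> 'y set"
  where "limit_set y0 F r =
    Y closure_of {\<psi> g y0 | g. g \<in> G \<and> cLO_action m g lex_ext \<inter> F \<times> F = r \<inter> F \<times> F}"

text \<open>Take \<open>\<psi> g y0\<close> close to \<open>y\<close> and \<open>\<psi> h y0\<close>
  close to \<open>z\<close>, where both translates of \<open>lex_ext\<close> agree with
  \<open>r\<close> on a suitable finite set. By \<open>agreeing_translates\<close> an isometry close
  to the identity takes the first point to the second, which therefore stays near \<open>y\<close>;
  so \<open>y\<close> and \<open>z\<close> cannot be separated.\<close>

lemma limit_set_unique:
  assumes y0: "y0 \<in> topspace Y" "\<And>k. k \<in> L.node_group \<Longrightarrow> \<psi> (extension k) y0 = y0"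
    and y: "\<And>F. finite F \<Longrightarrow> F \<subseteq> X \<Longrightarrow> y \<in> limit_set y0 F r"
    and z: "\<And>F. finite F \<Longrightarrow> F \<subseteq> X \<Longrightarrow> z \<in> limit_set y0 F r"
  shows "y = z"
proof (rule ccontr)
  assume ne: "y \<noteq> z"
  have "y \<in> topspace Y" "z \<in> topspace Y"
    using y[of "{}"] z[of "{}"] by (auto simp: limit_set_def in_closure_of)
  then obtain U V where UV: "openin Y U" "openin Y V" "y \<in> U" "z \<in> V" "disjnt U V"
    using A.Hausdorff ne unfolding Hausdorff_space_def by meson
  obtain N F \<epsilon> where N: "openin Y N" "y \<in> N" "finite F" "F \<subseteq> X" "\<epsilon> > 0"
    "\<And>g u. g \<in> G \<Longrightarrow> \<forall>x\<in>F. near disc m \<epsilon> x (g x) \<Longrightarrow> u \<in> N \<Longrightarrow> \<psi> g u \<in> U"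
    using act_small[OF UV(1,3)] by metis
  obtain g where g: "g \<in> G" "cLO_action m g lex_ext \<inter> F \<times> F = r \<inter> F \<times> F" "\<psi> g y0 \<in> N"
    using y[OF N(3,4)] N(1,2) unfolding limit_set_def in_closure_of by blast
  obtain h where h: "h \<in> G" "cLO_action m h lex_ext \<inter> F \<times> F = r \<inter> F \<times> F" "\<psi> h y0 \<in> V"
    using z[OF N(3,4)] UV(2,4) unfolding limit_set_def in_closure_of by blast
  obtain l where l: "l \<in> G" "\<forall>x\<in>F. near disc m \<epsilon> x (l x)" "\<psi> l (\<psi> g y0) = \<psi> h y0"
    using agreeing_translates[OF N(3-5) g(1) h(1) _ y0] g(2) h(2) by metis
  have "\<psi> h y0 \<in> U" using N(6)[OF l(1,2) g(3)] l(3) by simp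
  then show False using UV(5) h(3) by (auto simp: disjnt_iff)
qed

lemma limit_set_mono:
  assumes "F \<subseteq> K"
  shows "limit_set y0 K r \<subseteq> limit_set y0 F r"
  unfolding limit_set_def
proof (rule closure_of_mono, rule subsetI)
  fix y assume "y \<in> {\<psi> g y0 | g. g \<in> G \<and> cLO_action m g lex_ext \<inter> K \<times> K = r \<inter> K \<times> K}"
  then obtain g where g: "y = \<psi> g y0" "g \<in> G" "cLO_action m g lex_ext \<inter> K \<times> K = r \<inter> K \<times> K" by blast
  then have "cLO_action m g lex_ext \<inter> F \<times> F = r \<inter> F \<times> F" using assms by blast
  then show "y \<in> {\<psi> g y0 | g. g \<in> G \<and> cLO_action m g lex_ext \<inter> F \<times> F = r \<inter> F \<times> F}"
    using g(1,2) by blast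
qed

lemma closedin_limit_set: "closedin Y (limit_set y0 F r)"
  unfolding limit_set_def by (rule closedin_closure_of)

text \<open>Finitely many sets \<open>F\<close> are handled through their union, on which
  \<open>orbit_approximates\<close> provides a translate of \<open>lex_ext\<close> that agrees with
  \<open>r\<close>.\<close>

lemma limit_set_exists:
  assumes y0: "y0 \<in> topspace Y" and r: "r \<in> cLO m"
  shows "\<exists>y\<in>topspace Y. \<forall>F\<in>{F. finite F \<and> F \<subseteq> X}. y \<in> limit_set y0 F r"
proof (rule compact_space_family_Int[OF A.compact closedin_limit_set])
  fix J assume J: "finite J" "J \<subseteq> {F. finite F \<and> F \<subseteq> X}"
  have K: "finite (\<Union>J)" "\<Union>J \<subseteq> X" using J by auto
  obtain g where g: "g \<in> G" "cLO_action m g lex_ext \<inter> \<Union>J \<times> \<Union>J = r \<inter> \<Union>J \<times> \<Union>J"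
    using orbit_approximates[OF lex_ext_cLO r K] by blast
  have gY: "\<psi> g y0 \<in> topspace Y" using act_in g(1) y0 by blast
  then have "\<psi> g y0 \<in> limit_set y0 (\<Union>J) r"
    unfolding limit_set_def in_closure_of using g by blast
  moreover have "limit_set y0 (\<Union>J) r \<subseteq> limit_set y0 F r" if "F \<in> J" for F
    by (rule limit_set_mono) (use that in blast)
  ultimately show "\<exists>y\<in>topspace Y. \<forall>F\<in>J. y \<in> limit_set y0 F r" using gY by blast
qed

text \<open>Multiplying \<open>g\<close> by \<open>k\<close> on the left turns agreement with
  \<open>r\<close> on the preimage of \<open>F\<close> into agreement with the translate of
  \<open>r\<close> on \<open>F\<close>; continuity of \<open>\<psi> k\<close> takes this to the
  closures.\<close>

lemma limit_set_equivariant: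
  assumes y: "y \<in> limit_set y0 (inv_into X k ` F) r" and y0: "y0 \<in> topspace Y"
    and k: "k \<in> G" and r: "r \<in> cLO m" and F: "F \<subseteq> X"
  shows "\<psi> k y \<in> limit_set y0 F (cLO_action m k r)"
proof -
  let ?K = "inv_into X k ` F"
  let ?A = "{\<psi> g y0 | g. g \<in> G \<and> cLO_action m g lex_ext \<inter> ?K \<times> ?K = r \<inter> ?K \<times> ?K}"
  let ?B = "{\<psi> g y0 | g. g \<in> G \<and> cLO_action m g lex_ext \<inter> F \<times> F = cLO_action m k r \<inter> F \<times> F}"
  have "\<psi> k ` ?A \<subseteq> ?B"
  proof clarify
    fix g assume g: "g \<in> G" "cLO_action m g lex_ext \<inter> ?K \<times> ?K = r \<inter> ?K \<times> ?K"
    let ?h = "k \<otimes>\<^bsub>iso_group m\<^esub> g"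
    have h: "?h \<in> G" using A.m_closed k g(1) by simp
    have act: "cLO_action m ?h lex_ext = cLO_action m k (cLO_action m g lex_ext)"
      using group_action.composition_rule[OF group_action_cLO lex_ext_cLO, of k g] k g(1) by simp
    have glex: "cLO_action m g lex_ext \<in> cLO m" by (rule cLO_action_closed[OF g(1) lex_ext_cLO])
    have "(x, y) \<in> cLO_action m ?h lex_ext \<longleftrightarrow> (x, y) \<in> cLO_action m k r" if xy: "x \<in> F" "y \<in> F" for x y
    proof -
      have "(inv_into X k x, inv_into X k y) \<in> cLO_action m g lex_ext \<longleftrightarrow> (inv_into X k x, inv_into X k y) \<in> r"
        using g(2) xy by blast
      then show ?thesis unfolding act cLO_action_mem[OF glex] cLO_action_mem[OF r] by blast
    qed
    then have "cLO_action m ?h lex_ext \<inter> F \<times> F = cLO_action m k r \<inter> F \<times> F" by auto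
    then show "\<exists>h. \<psi> k (\<psi> g y0) = \<psi> h y0 \<and> h \<in> G \<and>
        cLO_action m h lex_ext \<inter> F \<times> F = cLO_action m k r \<inter> F \<times> F"
      using h act_mult[OF k g(1) y0] by metis
  qed
  moreover have "\<psi> k y \<in> Y closure_of (\<psi> k ` ?A)"
    using continuous_map_image_closure_subset[OF act_cont[OF k], of ?A] y unfolding limit_set_def by blast
  ultimately show ?thesis unfolding limit_set_def using closure_of_mono by blast
qed

theorem factor_of_cLO:
  assumes minimal: "\<And>y. y \<in> topspace Y \<Longrightarrow> Y closure_of (orbit (iso_group m) \<psi> y) = topspace Y"
  shows "\<exists>f. continuous_map (cLO_topology m) Y f \<and> f ` topspace (cLO_topology m) = topspace Y \<and>
    (\<forall>g\<in>carrier (iso_group m). \<forall>r\<in>topspace (cLO_topology m). f (cLO_action m g r) = \<psi> g (f r))"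
proof -
  obtain y0 where y0: "y0 \<in> topspace Y" "\<And>k. k \<in> L.node_group \<Longrightarrow> \<psi> (extension k) y0 = y0"
    using node_group_fixed_point by blast
  define f where "f r = (SOME y. y \<in> topspace Y \<and> (\<forall>F. finite F \<and> F \<subseteq> X \<longrightarrow> y \<in> limit_set y0 F r))" for r
  have f: "f r \<in> topspace Y" "\<And>F. finite F \<Longrightarrow> F \<subseteq> X \<Longrightarrow> f r \<in> limit_set y0 F r" if r: "r \<in> cLO m" for r
  proof -
    have "\<exists>y. y \<in> topspace Y \<and> (\<forall>F. finite F \<and> F \<subseteq> X \<longrightarrow> y \<in> limit_set y0 F r)"
      using limit_set_exists[OF y0(1) r] by blast
    then have "f r \<in> topspace Y \<and> (\<forall>F. finite F \<and> F \<subseteq> X \<longrightarrow> f r \<in> limit_set y0 F r)"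
      unfolding f_def by (rule someI_ex)
    then show "f r \<in> topspace Y" "\<And>F. finite F \<Longrightarrow> F \<subseteq> X \<Longrightarrow> f r \<in> limit_set y0 F r" by blast+
  qed
  have f_eq: "y = f r" if "r \<in> cLO m" "\<And>F. finite F \<Longrightarrow> F \<subseteq> X \<Longrightarrow> y \<in> limit_set y0 F r" for y r
    by (rule limit_set_unique[OF y0 that(2) f(2)[OF that(1)]])
  have cont: "continuous_map (cLO_topology m) Y f"
    unfolding continuous_map_def topspace_cLO
  proof (intro conjI allI impI)
    show "f \<in> cLO m \<rightarrow> topspace Y" using f(1) by blast
    fix U assume U: "openin Y U"
    show "openin (cLO_topology m) {r \<in> cLO m. f r \<in> U}"
      unfolding openin_cLO
    proof (intro conjI ballI)
      fix r assume "r \<in> {r \<in> cLO m. f r \<in> U}"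
      then have r: "r \<in> cLO m" and rU: "f r \<in> U" by auto
      let ?I = "{F. finite F \<and> F \<subseteq> X}"
      \<comment> \<open>Otherwise every limit set meets the complement of \<open>U\<close>, and by
        compactness a point outside \<open>U\<close> lies in all of them, against
        uniqueness.\<close>
      have "\<exists>F. finite F \<and> F \<subseteq> X \<and> limit_set y0 F r \<subseteq> U"
      proof (rule ccontr)
        assume no: "\<not> ?thesis"
        have "\<exists>y\<in>topspace Y. \<forall>F\<in>?I. y \<in> limit_set y0 F r \<inter> (topspace Y - U)"
        proof (rule compact_space_family_Int[OF A.compact])
          show "closedin Y (limit_set y0 F r \<inter> (topspace Y - U))" for F
            using closedin_limit_set U by (intro closedin_Int) auto
          fix J assume J: "finite J" "J \<subseteq> ?I"
          then have "finite (\<Union>J)" "\<Union>J \<subseteq> X" by auto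
          then have "\<not> limit_set y0 (\<Union>J) r \<subseteq> U" using no by metis
          then obtain y where y: "y \<in> limit_set y0 (\<Union>J) r" "y \<notin> U" by (metis subsetI)
          have yY: "y \<in> topspace Y" using y(1) closedin_subset[OF closedin_limit_set] by blast
          have "y \<in> limit_set y0 F r" if "F \<in> J" for F
            using limit_set_mono[of F "\<Union>J"] that y(1) by blast
          then show "\<exists>y\<in>topspace Y. \<forall>F\<in>J. y \<in> limit_set y0 F r \<inter> (topspace Y - U)"
            using y(2) yY by blast
        qed
        then obtain y where "y \<notin> U" "\<And>F. finite F \<Longrightarrow> F \<subseteq> X \<Longrightarrow> y \<in> limit_set y0 F r" by blast
        then show False using f_eq[OF r] rU by blast
      qed
      then obtain F where F: "finite F" "F \<subseteq> X" "limit_set y0 F r \<subseteq> U" by blast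
      \<comment> \<open>For such \<open>r'\<close> the limit sets of \<open>r\<close> and
        \<open>r'\<close> at \<open>F\<close> coincide, and \<open>f r'\<close> lies in
        them.\<close>
      have "f r' \<in> U" if r': "r' \<in> cLO m" "r' \<inter> F \<times> F = r \<inter> F \<times> F" for r'
        using f(2)[OF r'(1) F(1,2)] F(3) unfolding limit_set_def r'(2) by blast
      then show "\<exists>F. finite F \<and> F \<subseteq> X \<and> (\<forall>r'\<in>cLO m. r' \<inter> F \<times> F = r \<inter> F \<times> F \<longrightarrow> r' \<in> {r \<in> cLO m. f r \<in> U})"
        using F(1,2) by blast
    qed blast
  qed
  have equi: "f (cLO_action m g r) = \<psi> g (f r)" if g: "g \<in> G" and r: "r \<in> cLO m" for g r
  proof (rule f_eq[OF cLO_action_closed[OF g r], symmetric])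
    fix F assume F: "finite F" "F \<subseteq> X"
    have "finite (inv_into X g ` F)" "inv_into X g ` F \<subseteq> X" using F isometriesD(7)[OF g] by auto
    then have "f r \<in> limit_set y0 (inv_into X g ` F) r" by (rule f(2)[OF r])
    then show "\<psi> g (f r) \<in> limit_set y0 F (cLO_action m g r)"
      using limit_set_equivariant y0(1) g r F(2) by blast
  qed
  have "f ` cLO m = topspace Y"
  proof
    show "f ` cLO m \<subseteq> topspace Y" using f(1) by blast
    \<comment> \<open>The image is compact, hence closed, and it contains an orbit, which is dense
      by minimality.\<close>
    have "compactin Y (f ` cLO m)"
      using image_compactin[OF _ cont, of "topspace (cLO_topology m)"] compact_cLO[OF ultrametric_axioms]
      by (simp add: compact_space_def topspace_cLO)
    then have closed: "closedin Y (f ` cLO m)" using A.Hausdorff compactin_imp_closedin by blast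
    have "orbit (iso_group m) \<psi> (f lex_ext) \<subseteq> f ` cLO m"
    proof
      fix y assume "y \<in> orbit (iso_group m) \<psi> (f lex_ext)"
      then obtain g where g: "g \<in> G" "y = \<psi> g (f lex_ext)" by (auto simp: orbit_def)
      then have "y = f (cLO_action m g lex_ext)" using equi[OF g(1) lex_ext_cLO] by simp
      then show "y \<in> f ` cLO m" using cLO_action_closed[OF g(1) lex_ext_cLO] by blast
    qed
    then have "Y closure_of orbit (iso_group m) \<psi> (f lex_ext) \<subseteq> f ` cLO m"
      using closed by (rule closure_of_minimal)
    then show "topspace Y \<subseteq> f ` cLO m" using minimal[OF f(1)[OF lex_ext_cLO]] by simp
  qed
  then show ?thesis using cont equi by (intro exI[of _ f]) (simp add: topspace_cLO)
qed

end

lemma (in dense_QS) universal_minimal_flow_cLO: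
  "universal_minimal_flow TYPE('y) (iso_group m) (iso_topology m T) (cLO_topology m) (cLO_action m)"
  unfolding universal_minimal_flow_def
proof (intro conjI allI impI)
  show "minimal_flow (iso_group m) (iso_topology m T) (cLO_topology m) (cLO_action m)"
    by (rule minimal_flow_cLO)
  fix Y :: "'y topology" and \<psi>
  assume "minimal_flow (iso_group m) (iso_topology m T) Y \<psi>"
  then interpret M: minimal_flow "iso_group m" "iso_topology m T" Y \<psi> .
  interpret dense_QS_flow S m T disc e Y \<psi> by unfold_locales
  show "\<exists>f. continuous_map (cLO_topology m) Y f \<and> f ` topspace (cLO_topology m) = topspace Y \<and>
      (\<forall>g\<in>carrier (iso_group m). \<forall>r\<in>topspace (cLO_topology m). f (cLO_action m g r) = \<psi> g (f r))"
    by (rule factor_of_cLO[OF M.dense_orbits])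
qed

section \<open>The space of finitely supported functions and its completion\<close>

lemma dense_QS_QS:
  assumes "S \<subseteq> {0<..}"
  shows "dense_QS S (QS S) (discrete_topology (mspace (QS S))) True id"
proof -
  interpret L: level_set S by standard (rule assms)
  interpret ultrametric "mspace (QS S)" "mdist (QS S)"
    using L.ultrametric_QS by (simp add: mspace_QS[OF assms] mdist_QS[OF assms])
  show ?thesis
  proof
    show "openin (discrete_topology (mspace (QS S))) U \<longleftrightarrow> U \<subseteq> mspace (QS S) \<and>
      (\<forall>x\<in>U. \<exists>\<epsilon>>0. \<forall>y\<in>mspace (QS S). near True (QS S) \<epsilon> x y \<longrightarrow> y \<in> U)" for U
      by (auto simp: near_def intro: exI[of _ 1])
    show "\<exists>p\<in>L.Q. near True (QS S) \<epsilon> (id p) x" if "x \<in> mspace (QS S)" for x \<epsilon>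
      using that by (auto simp: near_def mspace_QS[OF assms])
    show "\<exists>g\<in>isometries (QS S). \<forall>p\<in>L.Q. g (id p) = id (k p)"
      if "bij_betw k L.Q L.Q" "\<And>p q. p \<in> L.Q \<Longrightarrow> q \<in> L.Q \<Longrightarrow> L.d (k p) (k q) = L.d p q" for k
      using restrict_isometry[of k "QS S"] that
      by (intro bexI[of _ "restrict k L.Q"]) (auto simp: mspace_QS[OF assms] mdist_QS[OF assms])
  qed (auto simp: mspace_QS[OF assms] mdist_QS[OF assms])
qed

section \<open>Extending isometries from a dense subspace\<close>

locale isometric_dense_embedding = Metric_space X d for X :: "'a set" and d +
  fixes Q :: "'q set" and \<delta> :: "'q \<Rightarrow> 'q \<Rightarrow> real" and e :: "'q \<Rightarrow> 'a"
  assumes e_mem: "p \<in> Q \<Longrightarrow> e p \<in> X"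
    and e_dist: "p \<in> Q \<Longrightarrow> q \<in> Q \<Longrightarrow> d (e p) (e q) = \<delta> p q"
    and e_dense: "x \<in> X \<Longrightarrow> \<epsilon> > 0 \<Longrightarrow> \<exists>p\<in>Q. d (e p) x < \<epsilon>"
begin

lemma e_inj: "inj_on e Q" if "\<And>p q. p \<in> Q \<Longrightarrow> q \<in> Q \<Longrightarrow> \<delta> p q = 0 \<Longrightarrow> p = q"
proof (rule inj_onI)
  fix p q assume pq: "p \<in> Q" "q \<in> Q" "e p = e q"
  then have "d (e p) (e q) = 0" using zero e_mem by metis
  then show "p = q" using that e_dist pq by metis
qed

lemma ultrametric_extends:
  assumes ultra: "\<And>p q r. p \<in> Q \<Longrightarrow> q \<in> Q \<Longrightarrow> r \<in> Q \<Longrightarrow> \<delta> p r \<le> max (\<delta> p q) (\<delta> q r)"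
  shows "ultrametric X d"
proof
  show "d x z \<le> max (d x y) (d y z)" if X: "x \<in> X" "y \<in> X" "z \<in> X" for x y z
  proof (rule field_le_epsilon)
    fix \<epsilon> :: real assume "\<epsilon> > 0"
    \<comment> \<open>Four errors add up to \<open>\<epsilon>\<close>: one each at \<open>x\<close>
      and at \<open>z\<close>, and two in comparing a distance of approximations with the distance
      of the points.\<close>
    then have e4: "\<epsilon> / 4 > 0" by simp
    obtain p q r where Q: "p \<in> Q" "q \<in> Q" "r \<in> Q"
      and near: "d (e p) x < \<epsilon> / 4" "d (e q) y < \<epsilon> / 4" "d (e r) z < \<epsilon> / 4"
      using e_dense[OF X(1) e4] e_dense[OF X(2) e4] e_dense[OF X(3) e4] by blast
    note E = e_mem[OF Q(1)] e_mem[OF Q(2)] e_mem[OF Q(3)]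
    have "d x z \<le> d (e p) x + d (e p) (e r) + d (e r) z"
      using triangle[OF X(1) E(1) X(3)] triangle[OF E(1,3) X(3)] commute[of x "e p"] by linarith
    moreover have "d (e p) (e r) \<le> max (d (e p) (e q)) (d (e q) (e r))"
      using ultra[OF Q] e_dist Q by simp
    moreover have "d (e p) (e q) \<le> d (e p) x + d x y + d (e q) y"
      using triangle[OF E(1) X(1) E(2)] triangle[OF X(1,2) E(2)] commute[of y "e q"] by linarith
    moreover have "d (e q) (e r) \<le> d (e q) y + d y z + d (e r) z"
      using triangle[OF E(2) X(2) E(3)] triangle[OF X(2,3) E(3)] commute[of z "e r"] by linarith
    ultimately show "d x z \<le> max (d x y) (d y z) + \<epsilon>"
      using near by linarith
  qed
qed (auto simp: zero intro: commute)

text \<open>Lipschitz extension to the closure yields a map with some constant \<open>B\<close>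
  only; that it preserves distances is recovered by comparison with points of the dense set.\<close>

lemma isometry_extends:
  assumes complete: "mcomplete"
    and k: "k \<in> Q \<rightarrow> Q" "\<And>p q. p \<in> Q \<Longrightarrow> q \<in> Q \<Longrightarrow> \<delta> (k p) (k q) = \<delta> p q"
    and inj: "inj_on e Q"
  shows "\<exists>g. g \<in> X \<rightarrow> X \<and> (\<forall>x\<in>X. \<forall>y\<in>X. d (g x) (g y) = d x y) \<and> (\<forall>p\<in>Q. g (e p) = e (k p))"
proof -
  let ?m = "metric (X, d)"
  define f where "f y = e (k (inv_into Q e y))" for y
  have f: "f (e p) = e (k p)" if "p \<in> Q" for p
    using inj that by (simp add: f_def)
  have kQ: "k p \<in> Q" if "p \<in> Q" for p using k(1) that by blast
  have eX: "e ` Q \<subseteq> X" using e_mem by blast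
  have "Lipschitz_continuous_map (submetric ?m (e ` Q)) ?m f"
    unfolding Lipschitz_continuous_map_def
    by (intro conjI exI[of _ 1]) (auto simp: f kQ e_mem e_dist k(2))
  moreover have "mcomplete_of ?m" using complete by (simp add: mcomplete_of_def)
  ultimately obtain g where g: "Lipschitz_continuous_map (submetric ?m (mtopology_of ?m closure_of (e ` Q))) ?m g"
    "\<And>x. x \<in> e ` Q \<Longrightarrow> g x = f x"
    using Lipschitz_continuous_map_extends_to_closure_of by metis
  have "mtopology_of ?m closure_of (e ` Q) = X"
    using e_dense e_mem commute by (auto simp: mtopology_of_def metric_closure_of in_mball)
  then have "Lipschitz_continuous_map ?m ?m g"
    using g(1) submetric_mspace[of ?m] by simp
  then obtain B where gX: "g \<in> X \<rightarrow> X" and B: "B > 0" "\<And>x y. x \<in> X \<Longrightarrow> y \<in> X \<Longrightarrow> d (g x) (g y) \<le> B * d x y"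
    unfolding Lipschitz_continuous_map_pos by auto
  have ge: "g (e p) = e (k p)" if "p \<in> Q" for p using g(2) f that by simp
  have "d (g x) (g y) = d x y" if X: "x \<in> X" "y \<in> X" for x y
  proof -
    have "\<bar>d (g x) (g y) - d x y\<bar> \<le> 0 + \<eta>" if "\<eta> > 0" for \<eta>
    proof -
      \<comment> \<open>Replacing \<open>x\<close> and \<open>y\<close> by approximations costs
        \<open>2 * \<epsilon>\<close> in their distance and \<open>2 * B * \<epsilon>\<close> in the
        distance of their images.\<close>
      define \<epsilon> where "\<epsilon> = \<eta> / (2 * (B + 1))"
      have \<epsilon>: "\<epsilon> > 0" "2 * (B + 1) * \<epsilon> = \<eta>" using that B(1) by (simp_all add: \<epsilon>_def)
      obtain p q where Q: "p \<in> Q" "q \<in> Q" and near: "d (e p) x < \<epsilon>" "d (e q) y < \<epsilon>"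
        using e_dense[OF X(1) \<epsilon>(1)] e_dense[OF X(2) \<epsilon>(1)] by blast
      note E = e_mem[OF Q(1)] e_mem[OF Q(2)]
      have G: "g x \<in> X" "g y \<in> X" "g (e p) \<in> X" "g (e q) \<in> X" using gX X E by auto
      have close: "\<bar>d u v - d u' v'\<bar> \<le> d u' u + d v' v" if "u \<in> X" "v \<in> X" "u' \<in> X" "v' \<in> X" for u v u' v'
        using triangle[of u u' v] triangle[of u' v' v] triangle[of u' u v'] triangle[of u v v'] that
          commute[of u u'] commute[of v v'] by linarith
      have "d (g (e p)) (g x) \<le> B * \<epsilon>" "d (g (e q)) (g y) \<le> B * \<epsilon>"
        using B(2)[OF E(1) X(1)] B(2)[OF E(2) X(2)] near B(1)
        by (meson less_imp_le mult_left_mono order_trans)+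
      then have "\<bar>d (g x) (g y) - d (g (e p)) (g (e q))\<bar> \<le> 2 * (B * \<epsilon>)"
        using close[OF G] by linarith
      moreover have "\<bar>d x y - d (e p) (e q)\<bar> \<le> 2 * \<epsilon>"
        using close[OF X E] near by linarith
      moreover have "d (g (e p)) (g (e q)) = d (e p) (e q)"
        using Q kQ by (simp add: ge e_dist k(2))
      ultimately have "\<bar>d (g x) (g y) - d x y\<bar> \<le> 2 * (B + 1) * \<epsilon>" by (simp add: algebra_simps)
      then show ?thesis using \<epsilon>(2) by simp
    qed
    then have "\<bar>d (g x) (g y) - d x y\<bar> \<le> 0" by (rule field_le_epsilon)
    then show ?thesis by simp
  qed
  then show ?thesis using gX ge by blast
qed

lemma agree_on_dense:
  assumes g: "g \<in> X \<rightarrow> X" "\<And>x y. x \<in> X \<Longrightarrow> y \<in> X \<Longrightarrow> d (g x) (g y) = d x y"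
    and fixed: "\<And>p. p \<in> Q \<Longrightarrow> g (e p) = e p" and x: "x \<in> X"
  shows "g x = x"
proof -
  have "d (g x) x \<le> 0 + \<epsilon>" if "\<epsilon> > 0" for \<epsilon>
  proof -
    have "\<epsilon> / 2 > 0" using that by simp
    then obtain p where p: "p \<in> Q" "d (e p) x < \<epsilon> / 2" using e_dense[OF x] by blast
    have "d (g x) x \<le> d (g x) (g (e p)) + d (e p) x"
      using triangle[of "g x" "e p" x] g(1) x e_mem[OF p(1)] fixed[OF p(1)] by auto
    also have "\<dots> = 2 * d (e p) x" using g(2)[OF x e_mem[OF p(1)]] commute[of x "e p"] by simp
    finally show ?thesis using p(2) by simp
  qed
  then have "d (g x) x \<le> 0" by (rule field_le_epsilon)
  then show ?thesis using zero[of "g x" x] nonneg[of "g x" x] g(1) x by force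
qed

text \<open>Both \<open>k\<close> and its inverse extend, and the two composites of the extensions
  are the identity on the dense set, hence everywhere by \<open>agree_on_dense\<close>.\<close>

lemma bijective_isometry_extends:
  assumes complete: "mcomplete"
    and k: "bij_betw k Q Q" "\<And>p q. p \<in> Q \<Longrightarrow> q \<in> Q \<Longrightarrow> \<delta> (k p) (k q) = \<delta> p q"
    and inj: "inj_on e Q"
  shows "\<exists>g. bij_betw g X X \<and> (\<forall>x\<in>X. \<forall>y\<in>X. d (g x) (g y) = d x y) \<and> (\<forall>p\<in>Q. g (e p) = e (k p))"
proof -
  let ?l = "inv_into Q k"
  have kQ: "k p \<in> Q" "?l p \<in> Q" "k (?l p) = p" "?l (k p) = p" if "p \<in> Q" for p
    using k(1) that bij_betw_apply[OF k(1)] bij_betw_apply[OF bij_betw_inv_into[OF k(1)]]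
    by (auto simp: bij_betw_inv_into_right bij_betw_inv_into_left)
  have l: "\<delta> (?l p) (?l q) = \<delta> p q" if "p \<in> Q" "q \<in> Q" for p q
    using k(2)[of "?l p" "?l q"] kQ that by simp
  obtain g where g: "g \<in> X \<rightarrow> X" "\<And>x y. x \<in> X \<Longrightarrow> y \<in> X \<Longrightarrow> d (g x) (g y) = d x y"
    "\<And>p. p \<in> Q \<Longrightarrow> g (e p) = e (k p)"
    using isometry_extends[OF complete _ k(2) inj] kQ(1) by blast
  obtain h where h: "h \<in> X \<rightarrow> X" "\<And>x y. x \<in> X \<Longrightarrow> y \<in> X \<Longrightarrow> d (h x) (h y) = d x y"
    "\<And>p. p \<in> Q \<Longrightarrow> h (e p) = e (?l p)"
    using isometry_extends[OF complete _ l inj] kQ(2) by blast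
  have gX: "g x \<in> X" and hX: "h x \<in> X" if "x \<in> X" for x using g(1) h(1) that by auto
  have "h (g x) = x" if "x \<in> X" for x
    by (rule agree_on_dense[of "\<lambda>x. h (g x)"]) (use g h gX hX kQ that in auto)
  moreover have "g (h x) = x" if "x \<in> X" for x
    by (rule agree_on_dense[of "\<lambda>x. g (h x)"]) (use g h gX hX kQ that in auto)
  ultimately have "bij_betw g X X"
    using gX hX by (intro bij_betw_byWitness[of _ h]) auto
  then show ?thesis using g by blast
qed

end

lemma dense_QS_completion:
  assumes S: "S \<subseteq> {0<..}" and US: "is_completion (QS S) US"
  shows "\<exists>e. dense_QS S US (mtopology_of US) False e"
proof -
  interpret L: level_set S by standard (rule S)
  interpret Metric_space "mspace US" "mdist US" by (rule Metric_space_mspace_mdist)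
  obtain e where complete: "mcomplete_of US" and e: "e \<in> L.Q \<rightarrow> mspace US"
      "\<And>p q. p \<in> L.Q \<Longrightarrow> q \<in> L.Q \<Longrightarrow> mdist US (e p) (e q) = L.d p q"
      "mtopology_of US closure_of (e ` L.Q) = mspace US"
    using US by (auto simp: is_completion_def mspace_QS[OF S] mdist_QS[OF S])
  have dense: "\<exists>p\<in>L.Q. mdist US (e p) x < \<epsilon>" if "x \<in> mspace US" "\<epsilon> > 0" for x \<epsilon>
  proof -
    have "x \<in> mtopology closure_of (e ` L.Q)" using e(3) that(1) by (simp add: mtopology_of_def)
    then have "\<exists>y\<in>e ` L.Q. y \<in> mball x \<epsilon>" using that(2) by (simp add: metric_closure_of)
    then show ?thesis by (auto simp: in_mball commute)
  qed
  interpret D: isometric_dense_embedding "mspace US" "mdist US" L.Q L.d e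
    by unfold_locales (use e dense in auto)
  have inj: "inj_on e L.Q" by (rule D.e_inj) (simp add: L.d_zero)
  interpret ultrametric "mspace US" "mdist US" by (rule D.ultrametric_extends) (rule L.ultra)
  have "dense_QS S US (mtopology_of US) False e"
  proof
    show "openin (mtopology_of US) U \<longleftrightarrow> U \<subseteq> mspace US \<and>
      (\<forall>x\<in>U. \<exists>\<epsilon>>0. \<forall>y\<in>mspace US. near False US \<epsilon> x y \<longrightarrow> y \<in> U)" for U
    proof (cases "U \<subseteq> mspace US")
      case True
      have "mball x \<epsilon> \<subseteq> U \<longleftrightarrow> (\<forall>y\<in>mspace US. near False US \<epsilon> x y \<longrightarrow> y \<in> U)" if "x \<in> U" for x \<epsilon>
        using True that by (auto simp: near_def subset_iff)
      then have "(\<exists>\<epsilon>>0. mball x \<epsilon> \<subseteq> U) \<longleftrightarrow> (\<exists>\<epsilon>>0. \<forall>y\<in>mspace US. near False US \<epsilon> x y \<longrightarrow> y \<in> U)"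
        if "x \<in> U" for x
        using that by simp
      then show ?thesis using True by (simp add: mtopology_of_def openin_mtopology Ball_def)
    qed (simp add: mtopology_of_def openin_mtopology)
    show "\<exists>p\<in>L.Q. near False US \<epsilon> (e p) x" if "x \<in> mspace US" "\<epsilon> > 0" for x \<epsilon>
      using dense[OF that] by (auto simp: near_def)
    show "\<exists>g\<in>isometries US. \<forall>p\<in>L.Q. g (e p) = e (k p)"
      if k: "bij_betw k L.Q L.Q" "\<And>p q. p \<in> L.Q \<Longrightarrow> q \<in> L.Q \<Longrightarrow> L.d (k p) (k q) = L.d p q" for k
    proof -
      have "mcomplete" using complete by (simp add: mcomplete_of_def)
      then obtain g where "bij_betw g (mspace US) (mspace US)"
        "\<forall>x\<in>mspace US. \<forall>y\<in>mspace US. mdist US (g x) (g y) = mdist US x y" "\<forall>p\<in>L.Q. g (e p) = e (k p)"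
        using D.bijective_isometry_extends[OF _ k inj] by blast
      then show ?thesis
        using restrict_isometry[of g US] D.e_mem by (intro bexI[of _ "restrict g (mspace US)"]) auto
    qed
  qed (use e in auto)
  then show ?thesis by blast
qed

theorem theorem4:
  fixes S :: "real set"
  assumes "S \<subseteq> {0<..}" and "countable S"
  shows "universal_minimal_flow TYPE('y)
           (iso_group (QS S)) (iso_topology (QS S) (discrete_topology (mspace (QS S))))
           (cLO_topology (QS S)) (cLO_action (QS S))
       \<and> (\<forall>US :: 'u metric. is_completion (QS S) US \<longrightarrow>
            universal_minimal_flow TYPE('y)
              (iso_group US) (iso_topology US (mtopology_of US))
              (cLO_topology US) (cLO_action US))"
  using dense_QS.universal_minimal_flow_cLO[OF dense_QS_QS[OF assms(1)]]
    dense_QS_completion[OF assms(1)] dense_QS.universal_minimal_flow_cLO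
  by blast

end
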